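(* Let $g_n\colon\mathbb{D}\to\mathbb{D}$, $n\ge1$, be inner functions with $g_n(0)=0$, and let $G_n = g_n\circ\cdots\circ g_1$. Then the sequence $\{\widehat G_n\}_{n\in\mathbb{N}}$ is mixing in the usual sense if and only if $\{g_n\}_{n\in\mathbb{N}}$ is contracting.
   Context: $\mathbb{D}$ is the open unit disc in $\mathbb{C}$ and $m$ is normalised Lebesgue measure on $\partial\mathbb{D}$. An analytic map $g\colon\mathbb{D}\to\mathbb{D}$ is inner if $\hat g(e^{i\theta})=\lim_{r\nearrow 1}g(re^{i\theta})$ exists and has modulus one for almost every $e^{i\theta}\in\partial\mathbb{D}$; $\hat g$ is its (a.e. defined) boundary map. The sequence $\{\widehat G_n\}$ is mixing in the usual sense if $m\left(A\cap\widehat G_n^{-1}(B)\right)\to m(A)m(B)$ as $n\to+\infty$ for all measurable sets $A,B\subset\partial\mathbb{D}$. The sequence $\{g_n\}$ is contracting if $G_n\to0$ uniformly on compact subsets of $\mathbb{D}$ as $n\to\infty$. *)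

theory Defs
  imports "HOL-Complex_Analysis.Complex_Analysis" "HOL-Probability.Probability"
begin

text \<open>
  The completion makes the measurable sets the Lebesgue (not merely the Borel) measurable
  subsets of the circle.
\<close>
definition circle_measure :: "complex measure" where
  "circle_measure =
     completion (distr (uniform_measure lborel {0..<2*pi}) (restrict_space borel (sphere 0 1)) cis)"

lemma cis_measurable_circle: "cis \<in> borel \<rightarrow>\<^sub>M restrict_space borel (sphere 0 1)"
  by (intro measurable_restrict_space2 borel_measurable_continuous_onI continuous_intros) auto

lemma space_circle_measure [simp]: "space circle_measure = sphere 0 1"
  by (simp add: circle_measure_def space_restrict_space)

lemma prob_space_circle_measure: "prob_space circle_measure"
proof -
  have "prob_space (uniform_measure lborel {0..<2*pi::real})"
    by (rule prob_space_uniform_measure) (use pi_gt_zero in \<open>auto simp: ennreal_eq_0_iff not_le\<close>)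
  then have "prob_space (distr (uniform_measure lborel {0..<2*pi})
               (restrict_space borel (sphere 0 1)) cis)"
    by (rule prob_space.prob_space_distr)
       (simp add: measurable_cong_sets[OF sets_uniform_measure refl] cis_measurable_circle)
  then show ?thesis
    unfolding circle_measure_def by (rule prob_space.prob_space_completion)
qed

definition inner_function :: "(complex \<Rightarrow> complex) \<Rightarrow> bool" where
  "inner_function g \<longleftrightarrow>
     g holomorphic_on ball 0 1 \<and> g ` ball 0 1 \<subseteq> ball 0 1 \<and>
     (AE \<zeta> in circle_measure.
        \<exists>l. ((\<lambda>r. g (of_real r * \<zeta>)) \<longlongrightarrow> l) (at_left 1) \<and> norm l = 1)"

text \<open>
  At points where the radial limit does not exist the value is unspecified; for inner functions
  these points form a null set.
\<close>
definition boundary_map :: "(complex \<Rightarrow> complex) \<Rightarrow> complex \<Rightarrow> complex" where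
  "boundary_map g \<zeta> = Lim (at_left 1) (\<lambda>r. g (of_real r * \<zeta>))"

text \<open>
  \<open>forward_comp g n = g n \<circ> \<dots> \<circ> g 1\<close>; the map \<open>g 0\<close> is not used.
\<close>
primrec forward_comp :: "(nat \<Rightarrow> complex \<Rightarrow> complex) \<Rightarrow> nat \<Rightarrow> complex \<Rightarrow> complex" where
  "forward_comp g 0 = id"
| "forward_comp g (Suc n) = g (Suc n) \<circ> forward_comp g n"

definition mixing :: "(nat \<Rightarrow> complex \<Rightarrow> complex) \<Rightarrow> bool" where
  "mixing T \<longleftrightarrow>
     (\<forall>A \<in> sets circle_measure. \<forall>B \<in> sets circle_measure.
        (\<lambda>n. measure circle_measure (A \<inter> T n -` B))
          \<longlonglongrightarrow> measure circle_measure A * measure circle_measure B)"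

definition contracting :: "(nat \<Rightarrow> complex \<Rightarrow> complex) \<Rightarrow> bool" where
  "contracting g \<longleftrightarrow>
     (\<forall>K. compact K \<and> K \<subseteq> ball 0 1 \<longrightarrow>
        uniform_limit K (forward_comp g) (\<lambda>_. 0) sequentially)"

end

theory Submission
  imports Defs "HOL-Real_Asymp.Real_Asymp"
begin

text \<open>
  An inner function fixing \<open>0\<close> preserves the normalised measure on the circle, and the boundary map of
  \<open>G\<^sub>n\<close> is almost everywhere the composition \<open>T\<^sub>n\<close> of the boundary maps of the \<open>g\<^sub>k\<close>. Hence mixing is
  equivalent to the decay of the correlations \<open>\<integral> u (v \<circ> T\<^sub>n)\<close>, an \<open>L\<^sup>1\<close>-stable condition on \<open>u\<close> and \<open>v\<close>
  which may be tested on trigonometric monomials. For \<open>k > 0\<close> the function \<open>T\<^sub>n\<^sup>k\<close> has the same Fourier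
  coefficients as \<open>G\<^sub>n\<^sup>k\<close>, up to powers of the radius, on any smaller circle, and these tend to \<open>0\<close> if
  \<open>G\<^sub>n \<longlonglongrightarrow> 0\<close> locally uniformly. Conversely, the correlation of \<open>T\<^sub>n\<close> with the Cauchy kernel
  \<open>z / (z - w)\<close> is \<open>G\<^sub>n w\<close>, so mixing gives \<open>G\<^sub>n \<longlonglongrightarrow> 0\<close> pointwise; by the Schwarz lemma \<open>\<bar>G\<^sub>n w\<bar>\<close>
  decreases in \<open>n\<close>, which makes the convergence locally uniform as in Dini's theorem.

  Radial limits of a bounded holomorphic function exist almost everywhere because its primitive is
  Lipschitz on the closed disc, and Lipschitz functions of a real variable are differentiable almost
  everywhere.
\<close>

subsection \<open>Almost everywhere differentiability of Lipschitz functions\<close>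

text \<open>Being inner is assumed of the single maps only, so nothing is given about radial limits
  of the compositions; Fatou's theorem supplies them. Its proof trades a boundary limit of a bounded
  function for differentiability of a Lipschitz primitive along the circle, a question of one real
  variable; the way back from the circle to the radius is a maximum principle followed by a Cauchy
  estimate.

  \<open>boundary_map\<close> is arbitrary on a null set. The argument therefore runs with
  representatives \<open>T n\<close> that map the whole circle into itself, and the completeness of
  \<open>circle_measure\<close> carries the result back to \<open>boundary_map\<close>.

  The fixed point 0 enters twice: the mean of \<open>T z ^ k\<close> is \<open>f 0 ^ k = 0\<close>,
  which yields invariance of the measure, and the Schwarz lemma needs it. Fourier coefficients are
  moved to a smaller circle because pointwise convergence inside the disc, with the bound 1,
  suffices there for dominated convergence, and the powers of the radius do not depend on
  \<open>n\<close>. Holomorphy treats only positive powers of \<open>T n\<close>; negative ones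
  follow by conjugation on the circle.\<close>

lemma Vitali_intervals:
  fixes S :: "real set"
  assumes S: "\<And>x d. x \<in> S \<Longrightarrow> 0 < d \<Longrightarrow> \<exists>a b. a \<le> x \<and> x \<le> b \<and> a < b \<and> b - a < d \<and> Q a b"
  obtains C :: "(real \<times> real) set" where "countable C"
    "\<And>a b. (a, b) \<in> C \<Longrightarrow> a < b \<and> Q a b"
    "disjoint_family_on (\<lambda>(a, b). {a..b}) C"
    "S - (\<Union>(a, b)\<in>C. {a..b}) \<in> null_sets lebesgue"
proof -
  define K where "K = {(a, b). a < b \<and> Q a b}"
  \<comment> \<open>A compact interval is the closed ball about its midpoint with half its length as
    radius; the covered point \<open>x\<close> may lie anywhere in it.\<close>
  have ball_eq: "cball ((fst i + snd i) / 2) ((snd i - fst i) / 2) = (\<lambda>(a, b). {a..b}) i" for i :: "real \<times> real"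
    by (cases i) (simp add: cball_eq_atLeastAtMost field_simps)
  have cover: "\<exists>i. i \<in> K \<and> x \<in> cball ((fst i + snd i) / 2) ((snd i - fst i) / 2) \<and> (snd i - fst i) / 2 < d"
    if x: "x \<in> S" and d: "0 < d" for x d
  proof -
    obtain a b where "a \<le> x" "x \<le> b" "a < b" "b - a < d" "Q a b"
      using S[OF x d] by blast
    then show ?thesis
      unfolding ball_eq by (intro exI[of _ "(a, b)"]) (auto simp: K_def)
  qed
  obtain C where C: "countable C" "C \<subseteq> K"
     "pairwise (\<lambda>i j. disjnt (cball ((fst i + snd i) / 2) ((snd i - fst i) / 2)) (cball ((fst j + snd j) / 2) ((snd j - fst j) / 2))) C"
     "negligible (S - (\<Union>i \<in> C. cball ((fst i + snd i) / 2) ((snd i - fst i) / 2)))"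
    by (rule Vitali_covering_theorem_cballs[of K "\<lambda>i. (snd i - fst i) / 2" S "\<lambda>i. (fst i + snd i) / 2"])
       (use cover in \<open>auto simp: K_def\<close>)
  show thesis
  proof
    show "a < b \<and> Q a b" if "(a, b) \<in> C" for a b
      using that C(2) by (auto simp: K_def)
    show "disjoint_family_on (\<lambda>(a, b). {a..b}) C"
      using C(3) unfolding ball_eq by (simp add: pairwise_def disjoint_family_on_def disjnt_def)
    show "S - (\<Union>(a, b)\<in>C. {a..b}) \<in> null_sets lebesgue"
      using C(4) unfolding ball_eq by (simp add: negligible_iff_null_sets)
  qed fact
qed

text \<open>Disjoint intervals inside \<open>U\<close> exhaust \<open>S\<close> up to a null set,
  and their \<mu>-masses add up to at most \<open>p\<close> times their total length. The set
  \<open>V\<close> is made open so that a second Vitali cover can be placed inside it.\<close>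

lemma Vitali_upper_density:
  fixes S U :: "real set" and \<mu> :: "real measure" and p :: real
  assumes sets: "sets \<mu> = sets borel" and U: "open U" "S \<subseteq> U"
    and S: "\<And>x d. x \<in> S \<Longrightarrow> 0 < d \<Longrightarrow>
      \<exists>a b. a \<le> x \<and> x \<le> b \<and> a < b \<and> b - a < d \<and> emeasure \<mu> {a..b} \<le> ennreal p * ennreal (b - a)"
  obtains V where "open V" "S - V \<in> null_sets lebesgue" "emeasure \<mu> V \<le> ennreal p * emeasure lborel U"
proof -
  have cover: "\<exists>a b. a \<le> x \<and> x \<le> b \<and> a < b \<and> b - a < d \<and>
      ({a..b} \<subseteq> U \<and> emeasure \<mu> {a..b} \<le> ennreal p * ennreal (b - a))" if x: "x \<in> S" and d: "0 < d" for x d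
  proof -
    obtain e where e: "e > 0" "ball x e \<subseteq> U"
      using U x by (meson openE subsetD)
    obtain a b where ab: "a \<le> x" "x \<le> b" "a < b" "b - a < min d e" "emeasure \<mu> {a..b} \<le> ennreal p * ennreal (b - a)"
      using S[OF x, of "min d e"] d e by auto
    have "{a..b} \<subseteq> ball x e"
      using ab by (auto simp: ball_def dist_real_def)
    with ab e show ?thesis by fastforce
  qed
  obtain C where C: "countable C"
    "\<And>a b. (a, b) \<in> C \<Longrightarrow> a < b \<and> {a..b} \<subseteq> U \<and> emeasure \<mu> {a..b} \<le> ennreal p * ennreal (b - a)"
    "disjoint_family_on (\<lambda>(a, b). {a..b}) C"
    "S - (\<Union>(a, b)\<in>C. {a..b}) \<in> null_sets lebesgue"
    by (rule Vitali_intervals[of S "\<lambda>a b. {a..b} \<subseteq> U \<and> emeasure \<mu> {a..b} \<le> ennreal p * ennreal (b - a)"])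
       (use cover in auto)
  let ?I = "\<lambda>(a, b). {a..b::real}"
  define V where "V = (\<Union>(a, b)\<in>C. {a<..<b})"
  have meas: "?I i \<in> sets \<mu>" "?I i \<in> sets lborel" for i
    by (auto simp: sets split: prod.split)
  show thesis
  proof
    show "open V" unfolding V_def by auto
    \<comment> \<open>Opening the intervals loses only their endpoints, which are countably
      many.\<close>
    have "S - V \<subseteq> (S - (\<Union>(a, b)\<in>C. {a..b})) \<union> (fst ` C \<union> snd ` C)"
      unfolding V_def by (force simp: less_le image_iff)
    moreover have "fst ` C \<union> snd ` C \<in> null_sets lebesgue"
      using C(1) by (intro null_sets_completionI countable_imp_null_set_lborel) auto
    ultimately show "S - V \<in> null_sets lebesgue"
      using C(4) null_sets_completion_subset null_sets.Un by metis
    have "emeasure \<mu> V \<le> emeasure \<mu> (\<Union>i\<in>C. ?I i)"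
    proof (rule emeasure_mono)
      show "V \<subseteq> (\<Union>i\<in>C. ?I i)" unfolding V_def by fastforce
    qed (auto intro!: sets.countable_UN' C simp: sets)
    also have "\<dots> = (\<integral>\<^sup>+i. emeasure \<mu> (?I i) \<partial>count_space C)"
      using C meas by (intro emeasure_UN_countable) auto
    also have "\<dots> \<le> (\<integral>\<^sup>+i. ennreal p * emeasure lborel (?I i) \<partial>count_space C)"
      using C(2) by (intro nn_integral_mono) (auto split: prod.split simp: less_imp_le)
    also have "\<dots> = ennreal p * (\<integral>\<^sup>+i. emeasure lborel (?I i) \<partial>count_space C)"
      by (rule nn_integral_cmult) auto
    also have "(\<integral>\<^sup>+i. emeasure lborel (?I i) \<partial>count_space C) = emeasure lborel (\<Union>i\<in>C. ?I i)"
      using C meas by (intro emeasure_UN_countable[symmetric]) auto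
    also have "\<dots> \<le> emeasure lborel U"
      using C(2) U by (intro emeasure_mono) auto
    finally show "emeasure \<mu> V \<le> ennreal p * emeasure lborel U"
      by (simp add: mult_left_mono)
  qed
qed

text \<open>The dual estimate: disjoint intervals inside \<open>V\<close>, each of \<mu>-mass at
  least \<open>q\<close> times its length, exhaust \<open>S\<close> up to a null set.\<close>

lemma Vitali_lower_density:
  fixes S V :: "real set" and \<mu> :: "real measure" and q :: real
  assumes sets: "sets \<mu> = sets borel" and V: "open V" "S - V \<in> null_sets lebesgue" and S_meas: "S \<in> sets borel"
    and S: "\<And>x d. x \<in> S \<Longrightarrow> 0 < d \<Longrightarrow>
      \<exists>a b. a \<le> x \<and> x \<le> b \<and> a < b \<and> b - a < d \<and> ennreal q * ennreal (b - a) \<le> emeasure \<mu> {a..b}"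
  shows "ennreal q * emeasure lborel S \<le> emeasure \<mu> V"
proof -
  let ?Q = "\<lambda>a b. {a..b} \<subseteq> V \<and> ennreal q * ennreal (b - a) \<le> emeasure \<mu> {a..b}"
  have cover: "\<exists>a b. a \<le> x \<and> x \<le> b \<and> a < b \<and> b - a < d \<and> ?Q a b" if x: "x \<in> S \<inter> V" and d: "0 < d" for x d
  proof -
    obtain e where e: "e > 0" "ball x e \<subseteq> V"
      using V x by (meson openE IntD2)
    obtain a b where ab: "a \<le> x" "x \<le> b" "a < b" "b - a < min d e" "ennreal q * ennreal (b - a) \<le> emeasure \<mu> {a..b}"
      using S[of x "min d e"] x d e by auto
    have "{a..b} \<subseteq> ball x e"
      using ab by (auto simp: ball_def dist_real_def)
    with ab e show ?thesis by fastforce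
  qed
  obtain C where C: "countable C"
    "\<And>a b. (a, b) \<in> C \<Longrightarrow> a < b \<and> ?Q a b"
    "disjoint_family_on (\<lambda>(a, b). {a..b}) C"
    "S \<inter> V - (\<Union>(a, b)\<in>C. {a..b}) \<in> null_sets lebesgue"
    by (rule Vitali_intervals[of "S \<inter> V" ?Q]) (use cover in auto)
  let ?I = "\<lambda>(a, b). {a..b::real}"
  have meas: "?I i \<in> sets \<mu>" "?I i \<in> sets lborel" for i
    by (auto simp: sets split: prod.split)
  have U_meas: "(\<Union>i\<in>C. ?I i) \<in> sets lborel"
    by (auto intro!: sets.countable_UN' C meas)
  have "S - (\<Union>i\<in>C. ?I i) \<subseteq> (S \<inter> V - (\<Union>i\<in>C. ?I i)) \<union> (S - V)"
    by auto
  then have "S - (\<Union>i\<in>C. ?I i) \<in> null_sets lebesgue"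
    using C(4) V(2) null_sets_completion_subset null_sets.Un by metis
  then have null: "S - (\<Union>i\<in>C. ?I i) \<in> null_sets lborel"
    using S_meas U_meas by (subst (asm) null_sets_completion_iff) auto
  have "emeasure lborel S \<le> emeasure lborel ((\<Union>i\<in>C. ?I i) \<union> (S - (\<Union>i\<in>C. ?I i)))"
    using S_meas U_meas by (intro emeasure_mono) auto
  also have "\<dots> = emeasure lborel (\<Union>i\<in>C. ?I i)"
    by (rule emeasure_Un_null_set[OF U_meas null])
  finally have "ennreal q * emeasure lborel S \<le> ennreal q * emeasure lborel (\<Union>i\<in>C. ?I i)"
    by (rule mult_left_mono) simp
  also have "emeasure lborel (\<Union>i\<in>C. ?I i) = (\<integral>\<^sup>+i. emeasure lborel (?I i) \<partial>count_space C)"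
    using C meas by (intro emeasure_UN_countable) auto
  also have "ennreal q * \<dots> = (\<integral>\<^sup>+i. ennreal q * emeasure lborel (?I i) \<partial>count_space C)"
    by (rule nn_integral_cmult[symmetric]) auto
  also have "\<dots> \<le> (\<integral>\<^sup>+i. emeasure \<mu> (?I i) \<partial>count_space C)"
    using C(2) by (intro nn_integral_mono) (auto split: prod.split simp: less_imp_le)
  also have "\<dots> = emeasure \<mu> (\<Union>i\<in>C. ?I i)"
    using C meas by (intro emeasure_UN_countable[symmetric]) auto
  also have "\<dots> \<le> emeasure \<mu> V"
    using C(2) V sets by (intro emeasure_mono) auto
  finally show ?thesis .
qed

text \<open>The point lies strictly inside the interval, which makes the set open. Slopes of
  \<open>F\<close> above \<open>q\<close> are expressed as low slopes of \<open>- F\<close> with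
  bound \<open>- q\<close>.\<close>

definition low_slope :: "(real \<Rightarrow> real) \<Rightarrow> real \<Rightarrow> real \<Rightarrow> real set" where
  "low_slope F p d = {x. \<exists>a b. a < x \<and> x < b \<and> b - a < d \<and> F b - F a < p * (b - a)}"

lemma open_low_slope: "open (low_slope F p d)"
proof -
  have "low_slope F p d = (\<Union>(a, b)\<in>{(a, b). b - a < d \<and> F b - F a < p * (b - a)}. {a<..<b})"
    unfolding low_slope_def by fastforce
  then show ?thesis by (auto intro!: open_UN)
qed

text \<open>
  With \<open>\<mu>\<close> the Stieltjes measure of \<open>F\<close>, a Vitali cover by intervals of slope below \<open>p\<close> and then a
  second one, inside the first, by intervals of slope above \<open>q\<close> give
  \<open>q |S| \<le> \<mu> V \<le> p |U|\<close> for open \<open>U \<supseteq> S\<close> with \<open>|U|\<close> close to \<open>|S|\<close>.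
\<close>

lemma null_set_slope_gap:
  fixes F :: "real \<Rightarrow> real"
  assumes mono: "\<And>x y. x \<le> y \<Longrightarrow> F x \<le> F y" and cont: "continuous_on UNIV F"
    and pq: "p < q"
  shows "(\<Inter>n::nat. low_slope F p (1 / Suc n) \<inter> low_slope (\<lambda>x. - F x) (- q) (1 / Suc n)) \<in> null_sets lborel"
    (is "?E \<in> _")
proof (cases "p \<le> 0")
  case True
  \<comment> \<open>Slopes of a monotone function are never negative, so the set is empty here. In
    the other case \<open>p > 0\<close>, and \<open>ennreal p\<close> loses no information.\<close>
  have "x \<notin> ?E" for x
  proof
    assume "x \<in> ?E"
    then have "x \<in> low_slope F p (1 / Suc 0)" by blast
    then obtain a b where "a < b" "F b - F a < p * (b - a)"
      unfolding low_slope_def mem_Collect_eq by (metis less_trans)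
    then show False
      using mono[of a b] True mult_nonpos_nonneg[of p "b - a"] by linarith
  qed
  then have "?E = {}" by blast
  then show ?thesis by simp
next
  case False
  let ?\<mu> = "interval_measure F"
  have Icc: "emeasure ?\<mu> {a..b} = ennreal (F b - F a)" if "a < b" for a b
    using that by (intro emeasure_interval_measure_Icc mono cont) auto
  have E_meas: "?E \<in> sets borel"
    by (intro sets.countable_INT) (auto intro!: borel_open open_low_slope open_Int)
  \<comment> \<open>A bounded piece has finite measure \<open>s\<close>, so that
    \<open>q * s <= p * (s + e)\<close> for all \<open>e > 0\<close> forces
    \<open>s = 0\<close>.\<close>
  have bounded_null: "?E \<inter> {-real N..real N} \<in> null_sets lborel" for N
  proof -
    define S where "S = ?E \<inter> {-real N..real N}"
    have S_meas: "S \<in> sets borel" using E_meas unfolding S_def by auto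
    have slopes: "\<exists>a b. a < x \<and> x < b \<and> b - a < d \<and> F b - F a < p * (b - a)"
        "\<exists>a b. a < x \<and> x < b \<and> b - a < d \<and> - F b + F a < - q * (b - a)"
      if x: "x \<in> S" and d: "0 < d" for x d
    proof -
      obtain n :: nat where n: "1 / Suc n < d"
        using reals_Archimedean[OF d] by (auto simp: inverse_eq_divide)
      have "x \<in> low_slope F p (1 / Suc n)" "x \<in> low_slope (\<lambda>x. - F x) (- q) (1 / Suc n)"
        using x by (auto simp: S_def)
      with n show "\<exists>a b. a < x \<and> x < b \<and> b - a < d \<and> F b - F a < p * (b - a)"
        "\<exists>a b. a < x \<and> x < b \<and> b - a < d \<and> - F b + F a < - q * (b - a)"
        unfolding low_slope_def mem_Collect_eq by (smt (verit, best))+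
    qed
    have fin: "emeasure lborel S < \<infinity>"
    proof -
      have "emeasure lborel S \<le> emeasure lborel {-real N..real N}"
        unfolding S_def by (intro emeasure_mono) auto
      then show ?thesis by (simp add: le_less_trans)
    qed
    have ineq: "ennreal q * emeasure lborel S \<le> ennreal p * (emeasure lborel S + ennreal e)" if e: "e > 0" for e
    proof -
      obtain U where U: "open U" "S \<subseteq> U" "emeasure lborel (U - S) < ennreal e"
        using outer_regular_lborel[OF S_meas e] by metis
      obtain V where V: "open V" "S - V \<in> null_sets lebesgue" "emeasure ?\<mu> V \<le> ennreal p * emeasure lborel U"
      proof (rule Vitali_upper_density[OF _ U(1,2), of ?\<mu> p])
        fix x d :: real assume "x \<in> S" "0 < d"
        then obtain a b where ab: "a < x" "x < b" "b - a < d" "F b - F a < p * (b - a)"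
          using slopes(1) by blast
        then have "emeasure ?\<mu> {a..b} \<le> ennreal p * ennreal (b - a)"
          using False by (subst Icc) (auto simp flip: ennreal_mult intro!: ennreal_leI)
        with ab show "\<exists>a b. a \<le> x \<and> x \<le> b \<and> a < b \<and> b - a < d \<and> emeasure ?\<mu> {a..b} \<le> ennreal p * ennreal (b - a)"
          by (intro exI[of _ a] exI[of _ b]) auto
      qed auto
      have "ennreal q * emeasure lborel S \<le> emeasure ?\<mu> V"
      proof (rule Vitali_lower_density[OF _ V(1,2) S_meas])
        fix x d :: real assume "x \<in> S" "0 < d"
        then obtain a b where ab: "a < x" "x < b" "b - a < d" "- F b + F a < - q * (b - a)"
          using slopes(2) by blast
        then have "ennreal q * ennreal (b - a) \<le> emeasure ?\<mu> {a..b}"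
          using False pq by (subst Icc) (auto simp flip: ennreal_mult intro!: ennreal_leI)
        with ab show "\<exists>a b. a \<le> x \<and> x \<le> b \<and> a < b \<and> b - a < d \<and> ennreal q * ennreal (b - a) \<le> emeasure ?\<mu> {a..b}"
          by (intro exI[of _ a] exI[of _ b]) auto
      qed simp
      also note V(3)
      also have "emeasure lborel U \<le> emeasure lborel S + emeasure lborel (U - S)"
        using U S_meas by (subst emeasure_subadditive[THEN order_trans[rotated]]) (auto intro!: emeasure_mono)
      also have "\<dots> \<le> emeasure lborel S + ennreal e"
        using U(3) by (intro add_left_mono) auto
      finally show ?thesis by (simp add: mult_left_mono)
    qed
    obtain s where s: "s \<ge> 0" "emeasure lborel S = ennreal s"
      using fin by (cases "emeasure lborel S") auto
    have "q * s \<le> p * (s + e)" if "e > 0" for e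
      using ineq[OF that] that s False pq
      by (simp flip: ennreal_mult ennreal_plus)
    then have "(q - p) * s / p \<le> e" if "e > 0" for e
      using that False by (simp add: field_simps)
    then have "(q - p) * s / p \<le> 0"
      by (rule field_le_epsilon[where y=0, simplified])
    then have "s = 0"
      using s(1) pq False by (simp add: divide_le_0_iff mult_le_0_iff)
    with s S_meas show ?thesis
      unfolding S_def by (simp add: null_sets_def)
  qed
  have E_UN: "?E = (\<Union>N::nat. ?E \<inter> {-real N..real N})"
  proof (intro equalityI subsetI)
    fix x assume x: "x \<in> ?E"
    obtain N :: nat where "\<bar>x\<bar> \<le> real N"
      using real_arch_simple by blast
    with x show "x \<in> (\<Union>N::nat. ?E \<inter> {-real N..real N})"
      by (intro UN_I[of N]) (auto simp: abs_le_iff)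
  qed auto
  show ?thesis
    by (subst E_UN) (rule null_sets_UN[OF bounded_null])
qed

text \<open>Off the null sets attached to the rational pairs \<open>p < q\<close>, the lower and
  upper limits of the slopes over short intervals around \<open>x\<close> coincide. Monotonicity and
  the Lipschitz bound keep this common value finite.\<close>

lemma mono_lipschitz_differentiable_AE:
  fixes F :: "real \<Rightarrow> real"
  assumes mono: "\<And>x y. x \<le> y \<Longrightarrow> F x \<le> F y" and lip: "\<And>x y. \<bar>F x - F y\<bar> \<le> B * \<bar>x - y\<bar>"
  shows "AE x in lborel. F differentiable (at x)"
proof -
  have cont: "continuous_on UNIV F"
  proof (rule lipschitz_on_continuous_on)
    show "(max B 0)-lipschitz_on UNIV F"
      by (intro lipschitz_onI) (auto simp: dist_real_def intro!: order_trans[OF lip] mult_right_mono)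
  qed
  define E where "E p q = (\<Inter>n::nat. low_slope F p (1 / Suc n) \<inter> low_slope (\<lambda>x. - F x) (- q) (1 / Suc n))" for p q
  have "AE x in lborel. \<forall>pq \<in> {(p, q). p \<in> \<rat> \<and> q \<in> \<rat> \<and> p < q}. x \<notin> E (fst pq) (snd pq)"
  proof (subst AE_ball_countable)
    show "countable {(p, q). p \<in> \<rat> \<and> q \<in> \<rat> \<and> p < (q::real)}"
      by (rule countable_subset[of _ "\<rat> \<times> \<rat>"]) (auto intro: countable_rat)
    show "\<forall>pq\<in>{(p, q). p \<in> \<rat> \<and> q \<in> \<rat> \<and> p < q}. AE x in lborel. x \<notin> E (fst pq) (snd pq)"
      unfolding E_def by (intro ballI AE_not_in null_set_slope_gap mono cont) auto
  qed
  then show ?thesis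
  proof (rule AE_mp, intro AE_I2 impI)
    fix x assume "\<forall>pq \<in> {(p, q). p \<in> \<rat> \<and> q \<in> \<rat> \<and> p < q}. x \<notin> E (fst pq) (snd pq)"
    then have notE: "x \<notin> E p q" if "p \<in> \<rat>" "q \<in> \<rat>" "p < q" for p q
      using that by auto
    \<comment> \<open>\<open>P\<close> collects the eventual lower bounds for the slopes over short
      intervals around \<open>x\<close>; its supremum \<open>l\<close> is the candidate
      derivative.\<close>
    define P where "P = {p. \<exists>d>0. \<forall>a b. a < x \<longrightarrow> x < b \<longrightarrow> b - a < d \<longrightarrow> p * (b - a) \<le> F b - F a}"
    have "0 \<in> P"
      unfolding P_def using mono by (auto intro!: exI[of _ 1])
    have "p \<le> B" if p: "p \<in> P" for p
    proof -
      obtain d where d: "d > 0" "\<And>a b. a < x \<Longrightarrow> x < b \<Longrightarrow> b - a < d \<Longrightarrow> p * (b - a) \<le> F b - F a"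
        using p unfolding P_def by blast
      have "p * (d / 2) \<le> F (x + d / 4) - F (x - d / 4)"
        using d(2)[of "x - d / 4" "x + d / 4"] d(1) by simp
      also have "\<dots> \<le> B * (d / 2)"
        using order_trans[OF abs_ge_self lip[of "x + d / 4" "x - d / 4"]] d(1) by simp
      finally show ?thesis using d(1) by simp
    qed
    then have bdd: "bdd_above P" by (rule bdd_aboveI)
    define l where "l = Sup P"
    have straddle: "\<exists>d>0. \<forall>a b. a < x \<longrightarrow> x < b \<longrightarrow> b - a < d \<longrightarrow> \<bar>F b - F a - l * (b - a)\<bar> \<le> e * (b - a)"
      if e: "e > 0" for e
    proof -
      obtain p where p: "p \<in> P" "l - e < p"
        using less_cSupD[of P "l - e"] \<open>0 \<in> P\<close> e unfolding l_def by auto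
      then obtain d1 where d1: "d1 > 0"
        "\<And>a b. a < x \<Longrightarrow> x < b \<Longrightarrow> b - a < d1 \<Longrightarrow> p * (b - a) \<le> F b - F a"
        unfolding P_def mem_Collect_eq by metis
      \<comment> \<open>Two rationals are wedged between \<open>l\<close> and \<open>l + e\<close>.
        As \<open>s\<close> exceeds the supremum, slopes below \<open>s\<close> occur at every
        scale; slopes above \<open>t\<close> at every scale would then put \<open>x\<close> into
        \<open>E s t\<close>.\<close>
      obtain s where s: "s \<in> \<rat>" "l < s" "s < l + e"
        using Rats_dense_in_real[of l "l + e"] e by auto
      obtain t where t: "t \<in> \<rat>" "s < t" "t < l + e"
        using Rats_dense_in_real[OF s(3)] by auto
      have "s \<notin> P"
        using cSup_upper[OF _ bdd, of s] s(2) unfolding l_def by auto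
      then have "x \<in> low_slope F s (1 / Suc n)" for n :: nat
        unfolding P_def low_slope_def mem_Collect_eq not_ex de_Morgan_conj not_all not_imp not_le
        by (metis zero_less_divide_1_iff of_nat_0_less_iff zero_less_Suc)
      with notE[OF s(1) t(1,2)] obtain n :: nat where n: "x \<notin> low_slope (\<lambda>x. - F x) (- t) (1 / Suc n)"
        unfolding E_def by auto
      show ?thesis
      proof (intro exI[of _ "min d1 (1 / Suc n)"] conjI allI impI)
        show "0 < min d1 (1 / real (Suc n))" using d1 by auto
        fix a b assume ab: "a < x" "x < b" "b - a < min d1 (1 / Suc n)"
        have "(l - e) * (b - a) \<le> p * (b - a)"
          using p ab by (intro mult_right_mono) auto
        also have "\<dots> \<le> F b - F a" using d1 ab by auto
        finally have "(l - e) * (b - a) \<le> F b - F a" .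
        moreover have "F b - F a \<le> t * (b - a)"
          using n ab unfolding low_slope_def mem_Collect_eq by (smt (verit, best) mult_minus_left)
        moreover have "t * (b - a) \<le> (l + e) * (b - a)"
          using t ab by (intro mult_right_mono) auto
        ultimately show "\<bar>F b - F a - l * (b - a)\<bar> \<le> e * (b - a)"
          by (simp add: abs_le_iff algebra_simps)
      qed
    qed
    have "(F has_derivative (\<lambda>h. l * h)) (at x)"
      unfolding has_derivative_within_alt
    proof (intro conjI allI impI)
      show "bounded_linear ((*) l)" by (rule bounded_linear_mult_right)
      fix e :: real assume e: "e > 0"
      obtain d where d: "d > 0"
        "\<And>a b. a < x \<Longrightarrow> x < b \<Longrightarrow> b - a < d \<Longrightarrow> \<bar>F b - F a - l * (b - a)\<bar> \<le> e * (b - a)"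
        using straddle[OF e] by blast
      show "\<exists>d>0. \<forall>y\<in>UNIV. norm (y - x) < d \<longrightarrow> norm (F y - F x - l * (y - x)) \<le> e * norm (y - x)"
      proof (intro exI[of _ d] conjI d ballI impI)
        fix y assume y: "norm (y - x) < d"
        \<comment> \<open>The estimate concerns intervals with \<open>x\<close> strictly inside. By
          continuity one endpoint may be moved to \<open>x\<close>, which gives the ordinary
          difference quotient.\<close>
        have lim: "((\<lambda>t. F (x + t)) \<longlongrightarrow> F x) (at_right 0)" "((\<lambda>t. F (x - t)) \<longlongrightarrow> F x) (at_right 0)"
          by (rule continuous_on_tendsto_compose[OF cont] tendsto_eq_intros | simp)+
        consider "y = x" | "y > x" | "y < x" by linarith
        then show "norm (F y - F x - l * (y - x)) \<le> e * norm (y - x)"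
        proof cases
          case 2
          have "\<bar>F y - F x - l * (y - x)\<bar> \<le> e * (y - x)"
          proof (rule tendsto_le[OF trivial_limit_at_right_real])
            show "((\<lambda>t. \<bar>F y - F (x - t) - l * (y - (x - t))\<bar>) \<longlongrightarrow> \<bar>F y - F x - l * (y - x)\<bar>) (at_right 0)"
              by (rule tendsto_eq_intros lim refl | simp)+
            show "((\<lambda>t. e * (y - (x - t))) \<longlongrightarrow> e * (y - x)) (at_right 0)"
              by (rule tendsto_eq_intros refl | simp)+
            show "\<forall>\<^sub>F t in at_right 0. \<bar>F y - F (x - t) - l * (y - (x - t))\<bar> \<le> e * (y - (x - t))"
              unfolding eventually_at_right_field using y 2
              by (intro exI[of _ "d - (y - x)"]) (auto intro!: d(2))
          qed
          with 2 show ?thesis by simp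
        next
          case 3
          have "\<bar>F x - F y - l * (x - y)\<bar> \<le> e * (x - y)"
          proof (rule tendsto_le[OF trivial_limit_at_right_real])
            show "((\<lambda>t. \<bar>F (x + t) - F y - l * ((x + t) - y)\<bar>) \<longlongrightarrow> \<bar>F x - F y - l * (x - y)\<bar>) (at_right 0)"
              by (rule tendsto_eq_intros lim refl | simp)+
            show "((\<lambda>t. e * ((x + t) - y)) \<longlongrightarrow> e * (x - y)) (at_right 0)"
              by (rule tendsto_eq_intros refl | simp)+
            show "\<forall>\<^sub>F t in at_right 0. \<bar>F (x + t) - F y - l * ((x + t) - y)\<bar> \<le> e * ((x + t) - y)"
              unfolding eventually_at_right_field using y 3
              by (intro exI[of _ "d - (x - y)"]) (auto intro!: d(2))
          qed
          with 3 show ?thesis by (simp add: abs_if algebra_simps split: if_splits)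
        qed auto
      qed
    qed
    then show "F differentiable at x"
      by (auto simp: differentiable_def)
  qed
qed

text \<open>Adding \<open>B * t\<close> to the real or the imaginary part makes it monotone and
  keeps it Lipschitz, with constant \<open>2 * B\<close>.\<close>

lemma lipschitz_vector_derivative_AE:
  fixes f :: "real \<Rightarrow> complex"
  assumes lip: "B-lipschitz_on UNIV f"
  shows "AE x in lborel. f differentiable (at x)"
proof -
  have B: "norm (f x - f y) \<le> B * \<bar>x - y\<bar>" for x y
    using lipschitz_onD[OF lip, of x y] by (simp add: dist_norm)
  have real_case: "AE x in lborel. h differentiable (at x)"
    if h: "\<And>x y. \<bar>h x - h y\<bar> \<le> norm (f x - f y)" for h :: "real \<Rightarrow> real"
  proof -
    have hB: "\<bar>h x - h y\<bar> \<le> B * \<bar>x - y\<bar>" for x y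
      using h B order_trans by blast
    have "AE x in lborel. (\<lambda>t. h t + B * t) differentiable (at x)"
    proof (rule mono_lipschitz_differentiable_AE[where B = "2 * B"])
      show "h x + B * x \<le> h y + B * y" if "x \<le> y" for x y
        using hB[of x y] that by (simp add: algebra_simps abs_le_iff)
      show "\<bar>h x + B * x - (h y + B * y)\<bar> \<le> 2 * B * \<bar>x - y\<bar>" for x y
      proof -
        have "\<bar>h x + B * x - (h y + B * y)\<bar> \<le> \<bar>h x - h y\<bar> + \<bar>B * (x - y)\<bar>"
          by (simp add: algebra_simps)
        also have "\<dots> \<le> B * \<bar>x - y\<bar> + B * \<bar>x - y\<bar>"
          using hB lipschitz_on_nonneg[OF lip] by (intro add_mono) (auto simp: abs_mult)
        finally show ?thesis by simp
      qed
    qed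
    then show ?thesis
    proof (rule AE_mp, intro AE_I2 impI)
      fix x assume "(\<lambda>t. h t + B * t) differentiable (at x)"
      then have "(\<lambda>t. (h t + B * t) - B * t) differentiable (at x)"
        by (intro differentiable_diff) auto
      then show "h differentiable (at x)" by simp
    qed
  qed
  have "AE x in lborel. (\<lambda>t. Re (f t)) differentiable (at x)" "AE x in lborel. (\<lambda>t. Im (f t)) differentiable (at x)"
    by (rule real_case; metis abs_Re_le_cmod minus_complex.sel(1) abs_Im_le_cmod minus_complex.sel(2))+
  then show ?thesis
  proof eventually_elim
    case (elim x)
    then have "(\<lambda>t. complex_of_real (Re (f t)) + \<i> * complex_of_real (Im (f t))) differentiable (at x)"
      by (intro differentiable_add differentiable_mult differentiable_const)
        (auto simp: differentiable_def intro: has_derivative_of_real)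
    then show ?case by (simp add: complex_eq[symmetric])
  qed
qed

subsection \<open>Fatou's theorem\<close>

text \<open>On the circle the squared distance to 1 coincides with a harmonic function, which can
  serve as a boundary bound in a maximum principle.\<close>

lemma dist_1_sphere: "norm (z - 1) ^ 2 = 2 - 2 * Re z" if "norm z = 1" for z :: complex
proof -
  have "Re z ^ 2 + Im z ^ 2 = 1" using that cmod_power2[of z] by simp
  moreover have "norm (z - 1) ^ 2 = (Re z - 1) ^ 2 + Im z ^ 2" by (simp add: cmod_power2)
  ultimately show ?thesis by (simp add: power2_eq_square algebra_simps)
qed

lemma has_vector_derivative_quotient_tendsto:
  assumes "(f has_vector_derivative D) (at x)"
  shows "((\<lambda>h. (f (x + h) - f x) /\<^sub>R h) \<longlongrightarrow> D) (at 0)"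
proof -
  have "((\<lambda>h. norm (f (x + h) - f x - h *\<^sub>R D) / norm h) \<longlongrightarrow> 0) (at 0)"
    using assms unfolding has_vector_derivative_def has_derivative_at by blast
  moreover have "\<forall>\<^sub>F h in at 0. norm (f (x + h) - f x - h *\<^sub>R D) / norm h = norm ((f (x + h) - f x) /\<^sub>R h - D)"
  proof (rule eventually_mono[OF eventually_neq_at_within[of 0]])
    fix h :: real assume "h \<noteq> 0"
    then have "(f (x + h) - f x) /\<^sub>R h - D = (f (x + h) - f x - h *\<^sub>R D) /\<^sub>R h"
      by (simp add: scaleR_diff_right)
    then show "norm (f (x + h) - f x - h *\<^sub>R D) / norm h = norm ((f (x + h) - f x) /\<^sub>R h - D)"
      by (simp add: divide_inverse mult.commute)
  qed
  ultimately have "((\<lambda>h. norm ((f (x + h) - f x) /\<^sub>R h - D)) \<longlongrightarrow> 0) (at 0)"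
    by (rule Lim_transform_eventually)
  then show ?thesis
    using LIM_zero_iff tendsto_norm_zero_iff by blast
qed

lemma has_vector_derivative_cis: "(cis has_vector_derivative \<i> * cis x) (at x)"
  using has_derivative_cis[OF has_derivative_ident, of x UNIV] by (simp add: has_vector_derivative_def)

text \<open>
  The right-hand side divided by \<open>|z - 1|\<close> is harmonic, so this is the maximum principle for
  \<open>\<Psi> z / (z - 1)\<close>; the pole is first moved out of the disc, to \<open>1 + s\<close>.
\<close>

lemma quotient_bound_interior:
  fixes \<Psi> :: "complex \<Rightarrow> complex"
  assumes cont: "continuous_on (cball 0 1) \<Psi>" and hol: "\<Psi> holomorphic_on ball 0 1"
    and e: "e \<ge> 0"
    and bound: "\<And>z. norm z = 1 \<Longrightarrow> norm (\<Psi> z) \<le> norm (z - 1) * (e + C * (2 - 2 * Re z))"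
    and z0: "z0 \<in> ball 0 1"
  shows "norm (\<Psi> z0) \<le> norm (z0 - 1) * (e + C * (2 - 2 * Re z0))"
proof -
  have "norm (\<Psi> z0) \<le> norm (complex_of_real (1 + s) - z0) * (e + C * (2 - 2 * Re z0))" if s: "s > 0" for s
  proof -
    define f where "f z = \<Psi> z / (complex_of_real (1 + s) - z)" for z
    have nz: "complex_of_real (1 + s) - z \<noteq> 0" if "z \<in> cball 0 1" for z
    proof
      assume "complex_of_real (1 + s) - z = 0"
      then have "norm z = 1 + s" using s by (metis abs_of_pos add_pos_pos eq_iff_diff_eq_0 norm_of_real zero_less_one)
      with that s show False by simp
    qed
    have f_bound: "norm (f z) \<le> e + C * (2 - 2 * Re z)" if z: "norm z = 1" for z
    proof (cases "z = 1")
      case True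
      then show ?thesis using bound[of 1] e by (simp add: f_def)
    next
      case False
      \<comment> \<open>Moving the pole outwards only increases its distance from points of the
        circle, so the boundary bound survives division by \<open>1 + s - z\<close>.\<close>
      have "norm (z - 1) ^ 2 \<le> norm (complex_of_real (1 + s) - z) ^ 2"
      proof -
        have "norm (complex_of_real (1 + s) - z) ^ 2 = (1 + s)^2 - 2 * (1 + s) * Re z + (Re z ^ 2 + Im z ^ 2)"
          unfolding cmod_power2 by (simp add: power2_eq_square algebra_simps)
        also have "Re z ^ 2 + Im z ^ 2 = 1" using z cmod_power2[of z] by simp
        finally have "norm (complex_of_real (1 + s) - z) ^ 2 = norm (z - 1) ^ 2 + (s ^ 2 + 2 * (s * (1 - Re z)))"
          unfolding dist_1_sphere[OF z] by (simp only: power2_eq_square algebra_simps)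
        moreover have "0 \<le> s * (1 - Re z)"
          using s complex_Re_le_cmod[of z] z by (intro mult_nonneg_nonneg) auto
        ultimately show ?thesis by (metis add_nonneg_nonneg le_add_same_cancel1 mult_nonneg_nonneg zero_le_numeral zero_le_power2)
      qed
      then have le: "norm (z - 1) \<le> norm (complex_of_real (1 + s) - z)"
        by (rule power2_le_imp_le) simp
      have pos: "norm (z - 1) > 0" using False by simp
      have "norm (f z) = norm (\<Psi> z) / norm (complex_of_real (1 + s) - z)"
        by (simp add: f_def norm_divide)
      also have "\<dots> \<le> norm (\<Psi> z) / norm (z - 1)"
        using le pos by (intro divide_left_mono mult_pos_pos) auto
      also have "\<dots> \<le> e + C * (2 - 2 * Re z)"
        using bound[OF z] pos by (simp add: divide_le_eq mult.commute)
      finally show ?thesis .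
    qed
    \<comment> \<open>A rotation that makes \<open>u * f z0\<close> equal to the modulus of
      \<open>f z0\<close>: the real part at \<open>z0\<close> then sees the full modulus.\<close>
    define u where "u = cnj (sgn (f z0))"
    have u: "norm u \<le> 1" "u * f z0 = norm (f z0)"
      by (simp add: u_def norm_sgn)
        (cases "f z0 = 0", simp_all add: u_def sgn_eq mult.commute[of "cnj (f z0)"]
           complex_norm_square[symmetric] power2_eq_square)
    \<comment> \<open>The modulus of \<open>h z\<close> is the exponential of
      \<open>Re (u * f z)\<close> minus the harmonic bound \<open>e + C * (2 - 2 * Re z)\<close>, so
      it is at most 1 on the circle.\<close>
    define h where "h z = exp (u * f z - of_real (e + 2 * C) + of_real (2 * C) * z)" for z
    have "continuous_on (cball 0 1) f"
      unfolding f_def using nz by (intro continuous_intros cont) auto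
    then have h_cont: "continuous_on (cball 0 1) h"
      unfolding h_def by (intro continuous_intros)
    have "f holomorphic_on ball 0 1"
      unfolding f_def using nz by (intro holomorphic_intros hol) auto
    then have h_hol: "h holomorphic_on ball 0 1"
      unfolding h_def by (intro holomorphic_intros)
    have "norm (h z0) \<le> 1"
    proof (rule maximum_modulus_frontier[of h "ball 0 1"])
      fix z :: complex assume "z \<in> frontier (ball 0 1)"
      then have z: "norm z = 1" by simp
      have "Re (u * f z) \<le> norm u * norm (f z)"
        using complex_Re_le_cmod[of "u * f z"] by (simp add: norm_mult)
      also have "\<dots> \<le> norm (f z)"
        using u(1) by (simp add: mult_left_le_one_le)
      also note f_bound[OF z]
      finally show "norm (h z) \<le> 1"
        by (simp add: h_def algebra_simps)
    qed (use h_hol h_cont z0 in auto)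
    then have "norm (f z0) \<le> e + C * (2 - 2 * Re z0)"
      by (simp add: h_def u(2) algebra_simps)
    moreover have "norm (\<Psi> z0) = norm (complex_of_real (1 + s) - z0) * norm (f z0)"
      using nz[of z0] z0 by (simp add: f_def norm_divide)
    ultimately show ?thesis by (simp add: mult_left_mono)
  qed
  then have ev: "\<forall>\<^sub>F s in at_right 0. norm (\<Psi> z0) \<le> norm (complex_of_real (1 + s) - z0) * (e + C * (2 - 2 * Re z0))"
    by (simp add: eventually_at_right_less[THEN eventually_mono])
  have "((\<lambda>s. norm (complex_of_real (1 + s) - z0) * (e + C * (2 - 2 * Re z0))) \<longlongrightarrow>
      norm (complex_of_real (1 + 0) - z0) * (e + C * (2 - 2 * Re z0))) (at_right 0)"
    by (intro tendsto_intros)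
  from tendsto_lowerbound[OF this ev] show ?thesis
    by (simp add: norm_minus_commute)
qed

text \<open>After removal of the linear part, \<Psi> is small compared with
  \<open>norm (z - 1)\<close> along the circle near 1. \<open>quotient_bound_interior\<close>
  carries this into the disc, and Cauchy's estimate on discs of radius proportional to
  \<open>1 - r\<close> makes the derivative of \<Psi> small at \<open>r\<close>.\<close>

lemma radial_derivative_limit:
  fixes \<Phi> :: "complex \<Rightarrow> complex"
  assumes cont: "continuous_on (cball 0 1) \<Phi>" and hol: "\<Phi> holomorphic_on ball 0 1"
    and lim: "((\<lambda>z. (\<Phi> z - \<Phi> 1) / (z - 1)) \<longlongrightarrow> L) (at 1 within sphere 0 1)"
  shows "((\<lambda>r. deriv \<Phi> (of_real r)) \<longlongrightarrow> L) (at_left 1)"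
proof -
  define \<Psi> where "\<Psi> z = \<Phi> z - \<Phi> 1 - L * (z - 1)" for z
  have \<Psi>_cont: "continuous_on (cball 0 1) \<Psi>"
    unfolding \<Psi>_def by (intro continuous_intros cont)
  have \<Psi>_hol: "\<Psi> holomorphic_on ball 0 1"
    unfolding \<Psi>_def by (intro holomorphic_intros hol)
  obtain B where B: "\<And>z. z \<in> cball 0 1 \<Longrightarrow> norm (\<Psi> z) \<le> B"
    using compact_imp_bounded[OF compact_continuous_image[OF \<Psi>_cont compact_cball]]
    unfolding bounded_iff by (metis image_eqI)
  have B0: "B \<ge> 0" using B[of 0] norm_ge_zero[of "\<Psi> 0"] by (simp del: norm_ge_zero)
  have est: "\<exists>C\<ge>0. \<forall>z\<in>ball 0 1. norm (\<Psi> z) \<le> norm (z - 1) * (e + C * (2 - 2 * Re z))" if e: "e > 0" for e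
  proof -
    obtain \<delta> where \<delta>: "\<delta> > 0" "\<And>z. norm z = 1 \<Longrightarrow> z \<noteq> 1 \<Longrightarrow> dist z 1 < \<delta> \<Longrightarrow> norm ((\<Phi> z - \<Phi> 1) / (z - 1) - L) < e"
      using tendstoD[OF lim e] unfolding eventually_at by (auto simp: dist_norm)
    \<comment> \<open>Away from 1 only the bound \<open>B\<close> is available; this
      \<open>C\<close> absorbs it, since \<open>norm (z - 1) >= \<delta>\<close> gives
      \<open>B <= C * norm (z - 1) ^ 3\<close>, and the cube is
      \<open>norm (z - 1) * (2 - 2 * Re z)\<close> on the circle.\<close>
    define C where "C = B / \<delta> ^ 3"
    have C: "C \<ge> 0" unfolding C_def using B0 \<delta> by auto
    have bound: "norm (\<Psi> z) \<le> norm (z - 1) * (e + C * (2 - 2 * Re z))" if z: "norm z = 1" for z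
    proof -
      consider "z = 1" | "z \<noteq> 1" "dist z 1 < \<delta>" | "\<delta> \<le> norm (z - 1)"
        by (metis dist_norm not_less)
      then show ?thesis
      proof cases
        case 1 then show ?thesis by (simp add: \<Psi>_def)
      next
        case 2
        have "\<Psi> z = ((\<Phi> z - \<Phi> 1) / (z - 1) - L) * (z - 1)"
          using 2 by (simp add: \<Psi>_def field_simps)
        then have "norm (\<Psi> z) = norm ((\<Phi> z - \<Phi> 1) / (z - 1) - L) * norm (z - 1)"
          by (simp only: norm_mult)
        also have "\<dots> \<le> e * norm (z - 1)"
          using \<delta>(2)[OF z 2] by (intro mult_right_mono) auto
        also have "\<dots> \<le> norm (z - 1) * (e + C * (2 - 2 * Re z))"
          using C complex_Re_le_cmod[of z] z mult_left_mono[of e "e + C * (2 - 2 * Re z)" "norm (z - 1)"]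
          by (simp add: mult.commute)
        finally show ?thesis .
      next
        case 3
        have "norm (\<Psi> z) \<le> B" using B z by simp
        also have "\<dots> = C * \<delta> ^ 3" using \<delta> by (simp add: C_def)
        also have "\<dots> \<le> C * norm (z - 1) ^ 3"
          using C 3 \<delta> by (intro mult_left_mono power_mono) auto
        also have "\<dots> = norm (z - 1) * (C * (2 - 2 * Re z))"
          by (simp flip: dist_1_sphere[OF z] add: power3_eq_cube power2_eq_square)
        also have "\<dots> \<le> norm (z - 1) * (e + C * (2 - 2 * Re z))"
          using e by (intro mult_left_mono) auto
        finally show ?thesis .
      qed
    qed
    show ?thesis
      using C quotient_bound_interior[OF \<Psi>_cont \<Psi>_hol _ bound] e less_imp_le by blast
  qed
  have deriv_\<Psi>: "deriv \<Psi> z = deriv \<Phi> z - L" if "z \<in> ball 0 1" for z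
  proof -
    have "(\<Phi> has_field_derivative deriv \<Phi> z) (at z)"
      using holomorphic_derivI[OF hol open_ball that] .
    then have "(\<Psi> has_field_derivative deriv \<Phi> z - L) (at z)"
      unfolding \<Psi>_def by (auto intro!: derivative_eq_intros)
    then show ?thesis by (rule DERIV_imp_deriv)
  qed
  show ?thesis
  proof (rule tendstoI)
    fix \<epsilon> :: real assume \<epsilon>: "\<epsilon> > 0"
    \<comment> \<open>Cauchy's estimate with radius \<open>(1 - r) / 2\<close>, where
      \<open>norm (x - 1) <= 2 * (1 - r)\<close>, costs a factor 4. So \<open>\<epsilon> / 8\<close>
      contributes \<open>\<epsilon> / 2\<close>, and the remainder tends to 0 with
      \<open>1 - r\<close>.\<close>
    then obtain C where C: "C \<ge> 0" "\<And>z. z \<in> ball 0 1 \<Longrightarrow> norm (\<Psi> z) \<le> norm (z - 1) * (\<epsilon> / 8 + C * (2 - 2 * Re z))"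
      using est[of "\<epsilon> / 8"] by auto
    have "((\<lambda>r. 4 * (\<epsilon> / 8 + 4 * C * (1 - r))) \<longlongrightarrow> 4 * (\<epsilon> / 8 + 4 * C * (1 - 1))) (at_left 1)"
      by (intro tendsto_intros)
    then have "\<forall>\<^sub>F r in at_left 1. 4 * (\<epsilon> / 8 + 4 * C * (1 - r)) < \<epsilon>"
      by (rule order_tendstoD(2)) (use \<epsilon> in simp)
    moreover have "\<forall>\<^sub>F r in at_left (1::real). r \<in> {0<..<1}"
      by (rule eventually_at_leftI[of 0]) auto
    ultimately show "\<forall>\<^sub>F r in at_left 1. dist (deriv \<Phi> (of_real r)) L < \<epsilon>"
    proof eventually_elim
      case (elim r)
      have sub: "cball (complex_of_real r) ((1 - r) / 2) \<subseteq> ball 0 1"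
      proof
        fix x assume "x \<in> cball (complex_of_real r) ((1 - r) / 2)"
        then have "norm (x - of_real r) \<le> (1 - r) / 2" by (simp add: dist_norm norm_minus_commute)
        then show "x \<in> ball 0 1"
          using norm_triangle_sub[of x "of_real r"] elim by (simp add: field_simps)
      qed
      have "norm ((deriv ^^ 1) \<Psi> (of_real r)) \<le> fact 1 * ((2 * (1 - r)) * (\<epsilon> / 8 + 4 * C * (1 - r))) / ((1 - r) / 2) ^ 1"
      proof (rule Cauchy_inequality)
        show "\<Psi> holomorphic_on ball (of_real r) ((1 - r) / 2)"
          by (rule holomorphic_on_subset[OF \<Psi>_hol]) (use sub ball_subset_cball in blast)
        show "continuous_on (cball (of_real r) ((1 - r) / 2)) \<Psi>"
          by (rule continuous_on_subset[OF \<Psi>_cont]) (use sub ball_subset_cball in blast)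
        fix x :: complex assume x: "norm (of_real r - x) = (1 - r) / 2"
        have "x - 1 = - (of_real r - x) - of_real (1 - r)" by simp
        then have "norm (x - 1) \<le> norm (- (of_real r - x)) + norm (complex_of_real (1 - r))"
          by (metis norm_triangle_ineq4)
        also have "\<dots> = (1 - r) / 2 + (1 - r)"
          unfolding norm_minus_cancel x using elim by (simp del: of_real_diff)
        also have "\<dots> \<le> 2 * (1 - r)" using elim(2) by (simp add: field_simps)
        finally have x1: "norm (x - 1) \<le> 2 * (1 - r)" .
        have "Re (1 - x) \<le> norm (x - 1)"
          using complex_Re_le_cmod[of "1 - x"] by (simp add: norm_minus_commute)
        then have x2: "2 - 2 * Re x \<le> 4 * (1 - r)"
          using x1 by simp
        have "x \<in> cball (of_real r) ((1 - r) / 2)" using x by (simp add: dist_norm)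
        with sub have xb: "x \<in> ball 0 1" by blast
        have "norm (\<Psi> x) \<le> norm (x - 1) * (\<epsilon> / 8 + C * (2 - 2 * Re x))"
          by (rule C(2)[OF xb])
        also have "\<dots> \<le> norm (x - 1) * (\<epsilon> / 8 + C * (4 * (1 - r)))"
          using x2 C by (intro mult_left_mono add_left_mono) auto
        also have "\<dots> \<le> (2 * (1 - r)) * (\<epsilon> / 8 + C * (4 * (1 - r)))"
          using x1 C elim \<epsilon> by (intro mult_right_mono) auto
        finally show "norm (\<Psi> x) \<le> (2 * (1 - r)) * (\<epsilon> / 8 + 4 * C * (1 - r))"
          by (simp add: algebra_simps)
      qed (use elim in auto)
      also have "\<dots> = 4 * (\<epsilon> / 8 + 4 * C * (1 - r))"
        using elim by (simp add: field_simps)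
      also have "\<dots> < \<epsilon>" by (rule elim)
      finally show ?case
        using deriv_\<Psi>[of "of_real r"] elim by (simp add: dist_norm)
    qed
  qed
qed

lemma cis_Arg_sphere: "norm z = 1 \<Longrightarrow> cis (Arg z) = z"
  using cis_Arg[of z] by (cases "z = 0") (auto simp: sgn_eq)

lemma cis_lipschitz: "1-lipschitz_on UNIV cis"
proof (rule lipschitz_onI)
  fix x y :: real
  have "norm (cis x - cis y) \<le> 1 * norm (x - y)"
    by (rule differentiable_bound[of UNIV cis "\<lambda>t h. h *\<^sub>R (\<i> * cis t)"])
       (auto intro!: onorm_le has_vector_derivative_cis simp: norm_mult has_vector_derivative_def[symmetric])
  then show "dist (cis x) (cis y) \<le> 1 * dist x y" by (simp add: dist_norm)
qed simp

text \<open>The primitive extends to a Lipschitz function \<Phi> on the closed disc. Where \<Phi> is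
  differentiable along the circle, its difference quotient at that boundary point converges, and
  \<open>radial_derivative_limit\<close> yields the radial limit of its derivative
  \<open>F\<close>.\<close>

theorem Fatou_cis_AE:
  fixes F :: "complex \<Rightarrow> complex"
  assumes hol: "F holomorphic_on ball 0 1" and bound: "\<And>z. z \<in> ball 0 1 \<Longrightarrow> norm (F z) \<le> B"
  shows "AE t in lborel. \<exists>l. ((\<lambda>r. F (of_real r * cis t)) \<longlongrightarrow> l) (at_left 1)"
proof -
  have B0: "B \<ge> 0" using bound[of 0] norm_ge_zero[of "F 0"] by (simp del: norm_ge_zero)
  obtain G where G: "\<And>z. z \<in> ball 0 1 \<Longrightarrow> (G has_field_derivative F z) (at z)"
    using holomorphic_convex_primitive'[OF _ open_ball hol] convex_ball at_within_open[OF _ open_ball] by metis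
  have G_lip: "B-lipschitz_on (ball 0 1) G"
  proof (rule lipschitz_onI[OF _ B0])
    fix x y :: complex assume xy: "x \<in> ball 0 1" "y \<in> ball 0 1"
    have "norm (G x - G y) \<le> B * norm (x - y)"
      by (rule field_differentiable_bound[of "ball 0 1" G F])
         (use xy in \<open>auto intro!: has_field_derivative_at_within G bound\<close>)
    then show "dist (G x) (G y) \<le> B * dist x y" by (simp add: dist_norm)
  qed
  obtain \<Phi> where \<Phi>: "uniformly_continuous_on (closure (ball 0 1)) \<Phi>" "\<And>x. x \<in> ball 0 1 \<Longrightarrow> G x = \<Phi> x"
    using uniformly_continuous_on_extension_on_closure[OF lipschitz_on_uniformly_continuous[OF G_lip]] by metis
  have \<Phi>_cont: "continuous_on (cball 0 1) \<Phi>"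
    using uniformly_continuous_imp_continuous[OF \<Phi>(1)] by simp
  have \<Phi>_lip: "B-lipschitz_on (cball 0 1) \<Phi>"
  proof -
    have "B-lipschitz_on (ball 0 1) \<Phi>"
      using G_lip \<Phi>(2) by (metis lipschitz_on_transform)
    from lipschitz_on_closure[OF this] show ?thesis
      using \<Phi>_cont by simp
  qed
  have \<Phi>_deriv: "(\<Phi> has_field_derivative F z) (at z)" if "z \<in> ball 0 1" for z
    using has_field_derivative_transform_within_open[OF G[OF that] open_ball that] \<Phi>(2) by blast
  have "(B * 1)-lipschitz_on UNIV (\<lambda>t. \<Phi> (cis t))"
    by (rule lipschitz_on_compose2[OF cis_lipschitz]) (rule lipschitz_on_subset[OF \<Phi>_lip], auto)
  then have "AE t in lborel. (\<lambda>t. \<Phi> (cis t)) differentiable (at t)"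
    by (rule lipschitz_vector_derivative_AE)
  then show ?thesis
  proof (rule AE_mp, intro AE_I2 impI)
    fix t assume "(\<lambda>t. \<Phi> (cis t)) differentiable (at t)"
    then obtain D where D: "((\<lambda>t. \<Phi> (cis t)) has_vector_derivative D) (at t)"
      by (auto simp: vector_derivative_works)
    \<comment> \<open>Rotation moves the boundary point \<open>cis t\<close> to 1; the resulting
      factor \<open>cis t\<close> in the derivative is divided out at the end.\<close>
    define \<Phi>' where "\<Phi>' z = \<Phi> (cis t * z)" for z
    have quot: "((\<lambda>s. (\<Phi>' (cis s) - \<Phi>' 1) / (cis s - 1)) \<longlongrightarrow> D / \<i>) (at 0)"
    proof -
      have d1: "((\<lambda>s. (\<Phi> (cis (t + s)) - \<Phi> (cis t)) /\<^sub>R s) \<longlongrightarrow> D) (at 0)"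
        by (rule has_vector_derivative_quotient_tendsto[OF D])
      have d2: "((\<lambda>s. (cis (0 + s) - cis 0) /\<^sub>R s) \<longlongrightarrow> \<i>) (at 0)"
        using has_vector_derivative_quotient_tendsto[OF has_vector_derivative_cis, of 0] by simp
      have "((\<lambda>s. ((\<Phi> (cis (t + s)) - \<Phi> (cis t)) /\<^sub>R s) / ((cis (0 + s) - cis 0) /\<^sub>R s)) \<longlongrightarrow> D / \<i>) (at 0)"
        by (intro tendsto_divide d1 d2) auto
      moreover have "\<forall>\<^sub>F s in at 0. ((\<Phi> (cis (t + s)) - \<Phi> (cis t)) /\<^sub>R s) / ((cis (0 + s) - cis 0) /\<^sub>R s) =
          (\<Phi>' (cis s) - \<Phi>' 1) / (cis s - 1)"
        unfolding eventually_at by (intro exI[of _ 1]) (auto simp: \<Phi>'_def cis_mult scaleR_conv_of_real)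
      ultimately show ?thesis by (rule Lim_transform_eventually)
    qed
    \<comment> \<open>Near 1 on the circle, \<open>Arg\<close> inverts \<open>cis\<close>, so the
      limit in the angle becomes a limit along the sphere.\<close>
    have Arg_lim: "filterlim Arg (at 0) (at 1 within sphere 0 1)"
      unfolding filterlim_at
    proof (intro conjI, simp only: UNIV_I simp_thms)
      show "\<forall>\<^sub>F z in at 1 within sphere 0 1. Arg z \<noteq> 0"
        unfolding eventually_at
      proof (intro exI[of _ 1] conjI ballI impI)
        fix z :: complex assume "z \<in> sphere 0 1" "z \<noteq> 1 \<and> dist z 1 < 1"
        then have "cis (Arg z) = z" "z \<noteq> 1" by (simp_all add: cis_Arg_sphere)
        then show "Arg z \<noteq> 0" by (metis cis_zero)
      qed auto
      have "isCont Arg 1" by (intro continuous_at_Arg) (auto simp: complex_nonpos_Reals_iff)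
      then have "(Arg \<longlongrightarrow> Arg 1) (at 1 within sphere 0 1)"
        using continuous_at_imp_continuous_at_within continuous_within by blast
      then show "(Arg \<longlongrightarrow> 0) (at 1 within sphere 0 1)" by simp
    qed
    have "((\<lambda>z. (\<Phi>' z - \<Phi>' 1) / (z - 1)) \<longlongrightarrow> D / \<i>) (at 1 within sphere 0 1)"
    proof (rule Lim_transform_eventually[OF filterlim_compose[OF quot Arg_lim]])
      show "\<forall>\<^sub>F z in at 1 within sphere 0 1. (\<Phi>' (cis (Arg z)) - \<Phi>' 1) / (cis (Arg z) - 1) = (\<Phi>' z - \<Phi>' 1) / (z - 1)"
        unfolding eventually_at by (intro exI[of _ 1]) (auto simp: cis_Arg_sphere)
    qed
    moreover have deriv': "(\<Phi>' has_field_derivative F (cis t * z) * cis t) (at z)" if "z \<in> ball 0 1" for z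
      unfolding \<Phi>'_def using DERIV_chain2[OF \<Phi>_deriv, of "\<lambda>z. cis t * z" z "cis t"] that
      by (auto simp: norm_mult intro!: derivative_eq_intros)
    moreover have "continuous_on (cball 0 1) \<Phi>'"
      unfolding \<Phi>'_def by (intro continuous_on_compose2[OF \<Phi>_cont] continuous_intros) (auto simp: norm_mult)
    moreover have "\<Phi>' holomorphic_on ball 0 1"
      using deriv' holomorphic_on_open[OF open_ball] by blast
    ultimately have "((\<lambda>r. deriv \<Phi>' (of_real r)) \<longlongrightarrow> D / \<i>) (at_left 1)"
      by (intro radial_derivative_limit)
    then have "((\<lambda>r. deriv \<Phi>' (of_real r) / cis t) \<longlongrightarrow> D / \<i> / cis t) (at_left 1)"
      by (intro tendsto_intros) auto
    moreover have "\<forall>\<^sub>F r in at_left 1. deriv \<Phi>' (of_real r) / cis t = F (of_real r * cis t)"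
    proof (rule eventually_at_leftI[of 0])
      fix r :: real assume "r \<in> {0<..<1}"
      then show "deriv \<Phi>' (of_real r) / cis t = F (of_real r * cis t)"
        using DERIV_imp_deriv[OF deriv'[of "of_real r"]]
        by (simp add: mult.commute[of "cis t" "complex_of_real r"])
    qed simp
    ultimately show "\<exists>l. ((\<lambda>r. F (of_real r * cis t)) \<longlongrightarrow> l) (at_left 1)"
      by (intro exI) (rule Lim_transform_eventually)
  qed
qed

subsection \<open>Integrals over the circle\<close>

interpretation circle: prob_space circle_measure
  by (rule prob_space_circle_measure)

interpretation circle: complete_measure circle_measure
  unfolding circle_measure_def by (rule completion.complete_measure_axioms)

text \<open>The measure before completion: measurability and image measures are first checked on its
  Borel sets and then passed to the completion.\<close>

definition borel_circle :: "complex measure" where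
  "borel_circle = distr (uniform_measure lborel {0..<2*pi}) (restrict_space borel (sphere 0 1)) cis"

lemma circle_measure_eq_completion: "circle_measure = completion borel_circle"
  by (simp add: circle_measure_def borel_circle_def)

lemma sets_borel_circle [simp, measurable_cong]: "sets borel_circle = sets (restrict_space borel (sphere 0 1))"
  by (simp add: borel_circle_def)

lemma space_borel_circle [simp]: "space borel_circle = sphere 0 1"
  by (simp add: borel_circle_def space_restrict_space)

lemma measurable_circle_measure:
  "f \<in> measurable (restrict_space borel (sphere 0 1)) N \<Longrightarrow> f \<in> measurable circle_measure N"
  unfolding circle_measure_eq_completion by (rule measurable_completion) simp

lemma measurable_circle_measure_borel:
  assumes "f \<in> measurable borel N" shows "f \<in> measurable circle_measure N"
  by (rule measurable_circle_measure[OF measurable_restrict_space1[OF assms]])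

lemma continuous_on_circle_measurable:
  fixes f :: "complex \<Rightarrow> 'b::topological_space"
  assumes "continuous_on (sphere 0 1) f" shows "f \<in> borel_measurable circle_measure"
  by (rule measurable_circle_measure[OF borel_measurable_continuous_on_restrict[OF assms]])

text \<open>\<open>Arg\<close> is continuous off the closed negative real axis, which meets the
  circle only at -1, where its value is \<open>pi\<close>.\<close>

lemma borel_measurable_Arg_circle: "Arg \<in> borel_measurable borel_circle"
proof -
  let ?h = "\<lambda>z. indicator (- \<real>\<^sub>\<le>\<^sub>0) z *\<^sub>R Arg z + indicator {-1::complex} z * pi"
  have "?h \<in> borel_measurable borel"
  proof (rule borel_measurable_add)
    have "continuous_on (- \<real>\<^sub>\<le>\<^sub>0) Arg"
      by (intro continuous_at_imp_continuous_on ballI continuous_at_Arg) auto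
    then show "(\<lambda>z. indicator (- \<real>\<^sub>\<le>\<^sub>0) z *\<^sub>R Arg z) \<in> borel_measurable borel"
      by (rule borel_measurable_continuous_on_indicator[rotated]) (auto intro: borel_closed borel_comp)
    show "(\<lambda>z. indicator {-1::complex} z * pi) \<in> borel_measurable borel"
      by measurable
  qed
  then have "?h \<in> borel_measurable (restrict_space borel (sphere 0 1))"
    by (rule measurable_restrict_space1)
  moreover have "?h z = Arg z" if "z \<in> sphere 0 1" for z
  proof (cases "z \<in> \<real>\<^sub>\<le>\<^sub>0")
    case True
    then obtain x where x: "z = of_real x" "x \<le> 0" by (auto elim: nonpos_Reals_cases)
    with that have "z = -1" by auto
    with True show ?thesis using Arg_of_real[of "-1"] by simp
  next
    case False
    then have "z \<noteq> -1" by (metis complex_nonpos_Reals_iff Im_complex_of_real Re_complex_of_real neg_le_0_iff_le of_real_1 of_real_minus zero_le_one)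
    with False show ?thesis by simp
  qed
  ultimately show ?thesis
    using measurable_cong[of "restrict_space borel (sphere 0 1)" ?h Arg borel]
      measurable_cong_sets[OF sets_borel_circle refl] by (simp add: space_restrict_space)
qed

lemma uniform_measure_circle_density:
  "uniform_measure lborel {0..<2*pi} = density lborel (\<lambda>t. ennreal (indicator {0..<2*pi} t / (2 * pi)))"
proof -
  have "indicator {0..<2*pi} t / emeasure lborel {0..<2*pi} = ennreal (indicator {0..<2*pi} t / (2 * pi))" for t :: real
    using divide_ennreal[of 1 "2 * pi"] by (cases "t \<in> {0..<2*pi}") auto
  then show ?thesis
    unfolding uniform_measure_def by simp
qed

text \<open>\<open>P\<close> may be non-measurable: the exceptional angles are enclosed in a Borel
  null set \<open>N\<close>, which is transported to the circle as a preimage under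
  \<open>Arg\<close>.\<close>

lemma AE_circle_cis:
  assumes "AE t in lborel. P (cis t)"
  shows "AE z in circle_measure. P z"
proof -
  obtain N where N: "{t. \<not> P (cis t)} \<subseteq> N" "N \<in> null_sets lborel"
    using assms by (auto simp: eventually_ae_filter)
  have N_meas [measurable]: "N \<in> sets borel" using N(2) by auto
  note borel_measurable_Arg_circle [measurable]
  have [measurable]: "cis \<in> borel \<rightarrow>\<^sub>M restrict_space borel (sphere 0 1)"
    by (rule cis_measurable_circle)
  define S where "S = {z \<in> space borel_circle. Arg z \<in> N}"
  have S: "S \<in> sets borel_circle" unfolding S_def by measurable
  have "emeasure borel_circle S = emeasure (uniform_measure lborel {0..<2*pi}) (cis -` S \<inter> UNIV)"
    unfolding borel_circle_def using S
    by (subst emeasure_distr) (auto simp: measurable_cong_sets[OF sets_uniform_measure refl] cis_measurable_circle)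
  also have "\<dots> = 0"
  proof -
    \<comment> \<open>The measure is parametrised by angles from 0 to \<open>2 * pi\<close>, whereas
      \<open>Arg\<close> takes values in \<open>- pi < a <= pi\<close>; on the lower half circle the
      two differ by \<open>2 * pi\<close>.\<close>
    have "{t. t - 2 * pi \<in> N} \<in> null_sets lborel"
      by (rule null_sets_translation[OF N(2)])
    then have null: "N \<union> {t. t - 2 * pi \<in> N} \<in> null_sets lborel"
      using N(2) by (intro null_sets.Un) auto
    have "{0..<2*pi} \<inter> cis -` S \<subseteq> N \<union> {t. t - 2 * pi \<in> N}"
    proof
      fix t assume t: "t \<in> {0..<2*pi} \<inter> cis -` S"
      then have "Arg (cis t) \<in> N" by (simp add: S_def)
      moreover have "Arg (cis t) = t \<or> Arg (cis t) = t - 2 * pi"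
      proof (cases "t \<le> pi")
        case True
        then show ?thesis using t by (intro disjI1 Arg_cis) auto
      next
        case False
        have "cis t = cis (t - 2 * pi)" by (simp flip: cis_divide)
        moreover have "Arg (cis (t - 2 * pi)) = t - 2 * pi"
          using False t by (intro Arg_cis) auto
        ultimately show ?thesis by simp
      qed
      ultimately show "t \<in> N \<union> {t. t - 2 * pi \<in> N}" by auto
    qed
    then have "emeasure lborel ({0..<2*pi} \<inter> cis -` S) = 0"
      using null by (metis emeasure_eq_0 null_setsD1 null_setsD2)
    moreover have "cis -` S \<in> sets lborel"
      using S measurable_sets[OF cis_measurable_circle, of S] by simp
    ultimately show ?thesis by (simp add: emeasure_uniform_measure)
  qed
  finally have "S \<in> null_sets borel_circle" using S by auto
  then have "AE z in borel_circle. z \<notin> S" by (rule AE_not_in)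
  then have "AE z in borel_circle. P z"
    by (rule AE_mp) (use N(1) in \<open>auto intro!: AE_I2 simp: S_def cis_Arg_sphere dest!: subsetD\<close>)
  then show ?thesis
    unfolding circle_measure_eq_completion by (rule AE_completion)
qed

lemma integral_circle_measure:
  fixes f :: "complex \<Rightarrow> 'b::{banach, second_countable_topology}"
  assumes "f \<in> borel_measurable (restrict_space borel (sphere 0 1))"
  shows "integral\<^sup>L circle_measure f = (LINT t:{0..<2*pi}|lborel. f (cis t)) /\<^sub>R (2 * pi)"
proof -
  have fcis: "(\<lambda>t. f (cis t)) \<in> borel_measurable lborel"
    using measurable_compose[OF cis_measurable_circle assms] by simp
  have "integral\<^sup>L circle_measure f = integral\<^sup>L borel_circle f"
    unfolding circle_measure_eq_completion using assms by (intro integral_completion) simp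
  also have "\<dots> = (\<integral>t. f (cis t) \<partial>uniform_measure lborel {0..<2*pi})"
    unfolding borel_circle_def using assms
    by (intro integral_distr) (auto simp: measurable_cong_sets[OF sets_uniform_measure refl] cis_measurable_circle)
  also have "\<dots> = (\<integral>t. (indicator {0..<2*pi} t / (2 * pi)) *\<^sub>R f (cis t) \<partial>lborel)"
    unfolding uniform_measure_circle_density using fcis by (intro integral_density) auto
  also have "\<dots> = (\<integral>t. (1 / (2 * pi)) *\<^sub>R (indicator {0..<2*pi} t *\<^sub>R f (cis t)) \<partial>lborel)"
    by (intro Bochner_Integration.integral_cong) (auto simp: field_simps)
  also have "\<dots> = (LINT t:{0..<2*pi}|lborel. f (cis t)) /\<^sub>R (2 * pi)"
    unfolding set_lebesgue_integral_def inverse_eq_divide by (rule integral_scaleR_right)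
  finally show ?thesis .
qed

text \<open>Along the circle dz / z is a constant multiple of the parameter differential, so
  division by \<open>z\<close> turns the contour integral into a mean. This makes Cauchy's theory
  available for \<open>circle_measure\<close>.\<close>

lemma contour_integral_circlepath_mean:
  fixes k :: "complex \<Rightarrow> complex"
  assumes cont: "continuous_on (sphere 0 r) k" and r: "r > 0"
  shows "contour_integral (circlepath 0 r) (\<lambda>z. k z / z) =
    2 * of_real pi * \<i> * (\<integral>z. k (of_real r * z) \<partial>circle_measure)"
proof -
  let ?h = "\<lambda>t. k (of_real r * cis t)"
  have h_cont: "continuous_on A ?h" for A
    by (rule continuous_on_compose2[OF cont]) (auto intro!: continuous_intros simp: norm_mult r less_imp_le)
  have "continuous_on (sphere 0 1) (\<lambda>z. k (of_real r * z))"
    by (rule continuous_on_compose2[OF cont]) (auto intro!: continuous_intros simp: norm_mult r less_imp_le)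
  then have "(\<integral>z. k (of_real r * z) \<partial>circle_measure) = (LINT t:{0..<2*pi}|lborel. ?h t) /\<^sub>R (2 * pi)"
    by (intro integral_circle_measure borel_measurable_continuous_on_restrict)
  also have "(LINT t:{0..<2*pi}|lborel. ?h t) = (LINT t:{0..2*pi}|lborel. ?h t)"
    unfolding set_lebesgue_integral_def
  proof (rule integral_cong_AE)
    have "?h \<in> borel_measurable lborel"
      using borel_measurable_continuous_onI[OF h_cont] by simp
    then show "(\<lambda>t. indicator {0..<2 * pi} t *\<^sub>R ?h t) \<in> borel_measurable lborel"
      "(\<lambda>t. indicator {0..2 * pi} t *\<^sub>R ?h t) \<in> borel_measurable lborel"
      by (intro borel_measurable_scaleR; simp)+
    show "AE t in lborel. indicator {0..<2 * pi} t *\<^sub>R ?h t = indicator {0..2 * pi} t *\<^sub>R ?h t"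
      using AE_lborel_singleton[of "2 * pi"] by eventually_elim (auto simp: indicator_def)
  qed
  also have "\<dots> = integral {0..2*pi} ?h"
    by (rule set_borel_integral_eq_integral(2)[OF borel_integrable_atLeastAtMost'[OF h_cont]])
  finally have mean: "(\<integral>z. k (of_real r * z) \<partial>circle_measure) = integral {0..2*pi} ?h /\<^sub>R (2 * pi)" .
  have "((\<lambda>x. ?h (2 * pi * x)) has_integral (1 / \<bar>2 * pi\<bar>) *\<^sub>R integral {0..2*pi} ?h) ((\<lambda>x. x / (2 * pi)) ` {0..2*pi})"
    by (rule has_integral_stretch_real[OF integrable_integral[OF integrable_continuous_real[OF h_cont]]]) simp
  also have "(\<lambda>x. x / (2 * pi)) ` {0..2*pi} = {0..1}"
    by (subst image_divide_atLeastAtMost) auto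
  finally have "((\<lambda>x. ?h (2 * pi * x)) has_integral (1 / \<bar>2 * pi\<bar>) *\<^sub>R integral {0..2*pi} ?h) {0..1}" .
  moreover have "1 / \<bar>2 * pi\<bar> = inverse (2 * pi)"
    by (simp add: inverse_eq_divide)
  ultimately have stretch: "integral {0..1} (\<lambda>x. ?h (2 * pi * x)) = integral {0..2*pi} ?h /\<^sub>R (2 * pi)"
    by (metis integral_unique)
  have "contour_integral (circlepath 0 r) (\<lambda>z. k z / z) = integral {0..1} (\<lambda>x. (2 * of_real pi * \<i>) * ?h (2 * pi * x))"
    unfolding contour_integral_integral
  proof (rule integral_cong)
    fix x :: real
    have "exp (2 * of_real pi * \<i> * of_real x) = cis (2 * pi * x)"
      by (simp add: cis_conv_exp mult_ac)
    then have "circlepath 0 r x = of_real r * cis (2 * pi * x)"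
      "vector_derivative (circlepath 0 r) (at x) = 2 * of_real pi * \<i> * of_real r * cis (2 * pi * x)"
      by (simp add: circlepath, simp add: vector_derivative_circlepath)
    then show "k (circlepath 0 r x) / circlepath 0 r x * vector_derivative (circlepath 0 r) (at x) = 2 * of_real pi * \<i> * ?h (2 * pi * x)"
      using r by simp
  qed
  also have "\<dots> = 2 * of_real pi * \<i> * integral {0..1} (\<lambda>x. ?h (2 * pi * x))"
    by (rule integral_mult_right)
  finally show ?thesis unfolding stretch mean .
qed

section \<open>Radial boundary values and their integrals against kernels\<close>

text \<open>\<open>T\<close> is any representative of the radial limits; the freedom on null sets is
  used to make it unimodular everywhere on the circle.\<close>

definition radial :: "(complex \<Rightarrow> complex) \<Rightarrow> (complex \<Rightarrow> complex) \<Rightarrow> bool" where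
  "radial f T \<longleftrightarrow> (AE z in circle_measure. ((\<lambda>r. f (of_real r * z)) \<longlongrightarrow> T z) (at_left 1))"

text \<open>Radii that increase to 1; the summand 2 keeps even the first one strictly above
  \<open>a\<close>.\<close>

definition rseq :: "real \<Rightarrow> nat \<Rightarrow> real" where
  "rseq a n = 1 - (1 - a) / (real n + 2)"

lemma rseq_less: "a < 1 \<Longrightarrow> a < rseq a n" "a < 1 \<Longrightarrow> rseq a n < 1"
proof -
  assume "a < 1"
  then show "rseq a n < 1" by (simp add: rseq_def)
  have "(1 - a) / (real n + 2) < 1 - a"
    using \<open>a < 1\<close> by (simp add: divide_less_eq)
  then show "a < rseq a n" by (simp add: rseq_def)
qed

lemma filterlim_rseq:
  assumes "a < 1" shows "filterlim (rseq a) (at_left 1) sequentially"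
proof -
  have "rseq a \<longlonglongrightarrow> 1"
    unfolding rseq_def by real_asymp
  then show ?thesis
    using rseq_less(2)[OF assms] by (auto simp: filterlim_at less_imp_neq)
qed

lemma (in complete_measure) measurable_AE_cong:
  assumes f: "f \<in> measurable M N" and ae: "AE x in M. f x = g x" and g: "g \<in> space M \<rightarrow> space N"
  shows "g \<in> measurable M N"
proof (rule measurableI)
  fix A assume A: "A \<in> sets N"
  show "g -` A \<inter> space M \<in> sets M"
  proof (rule in_sets_AE)
    show "AE x in M. x \<in> f -` A \<inter> space M \<longleftrightarrow> x \<in> g -` A \<inter> space M"
      using ae by eventually_elim auto
  qed (use measurable_sets[OF f A] in auto)
qed (use g in auto)

lemma continuous_on_sphere_dilate:
  assumes "continuous_on (ball 0 1) (f :: complex \<Rightarrow> complex)" "0 < r" "r < 1"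
  shows "continuous_on (sphere 0 1) (\<lambda>z. f (of_real r * z))"
  by (rule continuous_on_compose2[OF assms(1)]) (use assms in \<open>auto intro!: continuous_intros simp: norm_mult\<close>)

text \<open>A limit along countably many radii is measurable, and completeness of
  \<open>circle_measure\<close> passes this on to every function that agrees with it almost
  everywhere.\<close>

lemma radial_measurable:
  assumes cont: "continuous_on (ball 0 1) f" and T: "radial f T"
  shows "T \<in> borel_measurable circle_measure"
proof -
  define \<rho> where "\<rho> = rseq 0"
  have \<rho>: "0 < \<rho> n" "\<rho> n < 1" "filterlim \<rho> (at_left 1) sequentially" for n
    unfolding \<rho>_def by (simp_all add: rseq_less filterlim_rseq)
  define T0 where "T0 z = lim (\<lambda>n. f (of_real (\<rho> n) * z))" for z
  have T0: "T0 \<in> borel_measurable circle_measure"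
    unfolding T0_def
    by (intro borel_measurable_lim_metric continuous_on_circle_measurable continuous_on_sphere_dilate cont \<rho>)
  have "AE z in circle_measure. T0 z = T z"
    using T unfolding radial_def
  proof eventually_elim
    case (elim z)
    from filterlim_compose[OF elim \<rho>(3)] show ?case
      unfolding T0_def by (rule limI)
  qed
  then show ?thesis
    using circle.measurable_AE_cong[OF T0] by simp
qed

text \<open>Dominated convergence as the radius tends to 1, when the mean does not depend on the
  radius. Only an annulus outside radius \<open>a\<close> is involved, so \<open>k\<close> may have
  poles further inside.\<close>

lemma radial_integral:
  assumes cont: "continuous_on (ball 0 1) f" and bound: "\<And>z. z \<in> ball 0 1 \<Longrightarrow> norm (f z) \<le> B" and T: "radial f T"
    and a: "0 \<le> a" "a < 1" and k: "continuous_on (cball 0 1 - ball 0 a) k"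
    and const: "\<And>r. a < r \<Longrightarrow> r < 1 \<Longrightarrow> (\<integral>z. f (of_real r * z) * k (of_real r * z) \<partial>circle_measure) = c"
  shows "(\<integral>z. T z * k z \<partial>circle_measure) = c"
proof -
  define \<rho> where "\<rho> = rseq a"
  have \<rho>: "a < \<rho> n" "\<rho> n < 1" "0 < \<rho> n" "filterlim \<rho> (at_left 1) sequentially" for n
    using a rseq_less[of a n] filterlim_rseq[of a] unfolding \<rho>_def by auto
  have k_sub: "continuous_on (sphere 0 1) (\<lambda>z. k (of_real r * z))" if "a < r" "r \<le> 1" for r
    by (rule continuous_on_compose2[OF k]) (use that a in \<open>auto intro!: continuous_intros simp: norm_mult\<close>)
  have "compact (cball 0 1 - ball 0 a :: complex set)"
    by (intro compact_diff) auto
  from compact_imp_bounded[OF compact_continuous_image[OF k this]]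
  obtain C where C: "\<And>z. z \<in> cball 0 1 - ball 0 a \<Longrightarrow> norm (k z) \<le> C"
    unfolding bounded_iff by (metis image_eqI)
  have "(\<lambda>n. \<integral>z. f (of_real (\<rho> n) * z) * k (of_real (\<rho> n) * z) \<partial>circle_measure) \<longlonglongrightarrow> (\<integral>z. T z * k z \<partial>circle_measure)"
  proof (rule integral_dominated_convergence[where w = "\<lambda>_. B * C"])
    show "(\<lambda>z. T z * k z) \<in> borel_measurable circle_measure"
      using k_sub[of 1] a
      by (intro borel_measurable_times radial_measurable[OF cont T] continuous_on_circle_measurable) auto
    show "(\<lambda>z. f (of_real (\<rho> n) * z) * k (of_real (\<rho> n) * z)) \<in> borel_measurable circle_measure" for n
      by (rule borel_measurable_times)
        (rule continuous_on_circle_measurable, rule continuous_on_sphere_dilate[OF cont] k_sub, use \<rho>(1-3)[of n] in auto)+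
    show "AE z in circle_measure. norm (f (of_real (\<rho> n) * z) * k (of_real (\<rho> n) * z)) \<le> B * C" for n
    proof (rule AE_I2)
      fix z assume "z \<in> space circle_measure"
      then have z: "norm z = 1" by simp
      then have "of_real (\<rho> n) * z \<in> ball 0 1" "of_real (\<rho> n) * z \<in> cball 0 1 - ball 0 a"
        using \<rho>(1-3)[of n] by (auto simp: norm_mult)
      then show "norm (f (of_real (\<rho> n) * z) * k (of_real (\<rho> n) * z)) \<le> B * C"
        unfolding norm_mult using bound C by (intro mult_mono) (auto intro: order_trans[OF norm_ge_zero])
    qed
    show "AE z in circle_measure. (\<lambda>n. f (of_real (\<rho> n) * z) * k (of_real (\<rho> n) * z)) \<longlonglongrightarrow> T z * k z"
      using T AE_space unfolding radial_def
    proof eventually_elim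
      case (elim z)
      have "(\<lambda>n. of_real (\<rho> n) * z) \<longlonglongrightarrow> of_real 1 * z"
        by (intro tendsto_intros filterlim_mono[OF \<rho>(4) at_within_le_nhds order_refl])
      moreover have "of_real (\<rho> n) * z \<in> cball 0 1 - ball 0 a" for n
        using \<rho>(1-3)[of n] elim by (auto simp: norm_mult)
      ultimately have "(\<lambda>n. k (of_real (\<rho> n) * z)) \<longlonglongrightarrow> k z"
        using elim a by (intro continuous_on_tendsto_compose[OF k]) auto
      then show ?case
        by (intro tendsto_mult filterlim_compose[OF elim(1) \<rho>(4)])
    qed
  qed simp
  moreover have "(\<lambda>n. \<integral>z. f (of_real (\<rho> n) * z) * k (of_real (\<rho> n) * z) \<partial>circle_measure) = (\<lambda>_. c)"
    using const \<rho> by auto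
  ultimately show ?thesis
    using LIMSEQ_unique tendsto_const by metis
qed

text \<open>Cauchy's formula on a circle around \<open>w\<close>, written as a mean: the numerator
  \<open>z\<close> of the kernel compensates for dz / z.\<close>

lemma radial_cauchy:
  assumes hol: "f holomorphic_on ball 0 1" and bound: "\<And>z. z \<in> ball 0 1 \<Longrightarrow> norm (f z) \<le> B" and T: "radial f T"
    and w: "norm w < 1"
  shows "(\<integral>z. T z * (z / (z - w)) \<partial>circle_measure) = f w"
proof (rule radial_integral[OF holomorphic_on_imp_continuous_on[OF hol] bound T])
  \<comment> \<open>The radius halfway between \<open>norm w\<close> and 1 keeps the pole
    \<open>w\<close> strictly inside.\<close>
  show "0 \<le> (1 + norm w) / 2" "(1 + norm w) / 2 < 1" using w by auto
  have nz: "z \<noteq> w" if "norm z \<ge> (1 + norm w) / 2" for z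
    using that w by auto
  show "continuous_on (cball 0 1 - ball 0 ((1 + norm w) / 2)) (\<lambda>z. z / (z - w))"
    using nz by (intro continuous_intros) (auto simp: not_less)
  fix r :: real assume r: "(1 + norm w) / 2 < r" "r < 1"
  have r': "norm w < r"
    using r(1) w by (simp add: field_simps)
  then have r'': "r > 0"
    using norm_ge_zero[of w] by linarith
  note r' = r' r''
  have "((\<lambda>z. f z / (z - w)) has_contour_integral (2 * of_real pi * \<i> * f w)) (circlepath 0 r)"
    by (rule Cauchy_integral_circlepath_simple)
      (use r r' in \<open>auto intro!: holomorphic_on_subset[OF hol]\<close>)
  then have "2 * of_real pi * \<i> * f w = contour_integral (circlepath 0 r) (\<lambda>z. f z / (z - w))"
    by (simp add: contour_integral_unique)
  also have "\<dots> = contour_integral (circlepath 0 r) (\<lambda>z. (f z * (z / (z - w))) / z)"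
    using r' by (intro contour_integral_cong) (auto simp: path_image_circlepath)
  also have "\<dots> = 2 * of_real pi * \<i> * (\<integral>z. (f (of_real r * z) * (of_real r * z / (of_real r * z - w))) \<partial>circle_measure)"
  proof (rule contour_integral_circlepath_mean)
    show "continuous_on (sphere 0 r) (\<lambda>z. f z * (z / (z - w)))"
      using r r' by (intro continuous_intros continuous_on_subset[OF holomorphic_on_imp_continuous_on[OF hol]]) auto
  qed fact
  finally show "(\<integral>z. f (of_real r * z) * (of_real r * z / (of_real r * z - w)) \<partial>circle_measure) = f w"
    by simp
qed

text \<open>Both sides are the residue of \<open>f z * z powi m / z\<close> at 0: the mean over a
  circle of radius between 0 and 1 does not depend on the radius, and the boundary integral is its
  limit.\<close>

lemma radial_fourier:
  assumes hol: "f holomorphic_on ball 0 1" and bound: "\<And>z. z \<in> ball 0 1 \<Longrightarrow> norm (f z) \<le> B" and T: "radial f T"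
    and s: "0 < s" "s < 1"
  shows "(\<integral>z. T z * z powi m \<partial>circle_measure) = (\<integral>z. f (of_real s * z) * (of_real s * z) powi m \<partial>circle_measure)"
proof -
  let ?q = "\<lambda>z. f z * z powi m / z"
  have mean: "(\<integral>z. f (of_real r * z) * (of_real r * z) powi m \<partial>circle_measure) = residue ?q 0" if r: "0 < r" "r < 1" for r
  proof -
    have "(?q has_contour_integral 2 * pi * \<i> * residue ?q 0) (circlepath 0 r)"
      by (rule base_residue[of "ball 0 1"])
        (use r in \<open>auto intro!: holomorphic_intros holomorphic_on_subset[OF hol]\<close>)
    then have "2 * of_real pi * \<i> * residue ?q 0 = contour_integral (circlepath 0 r) ?q"
      by (simp add: contour_integral_unique)
    also have "\<dots> = 2 * of_real pi * \<i> * (\<integral>z. f (of_real r * z) * (of_real r * z) powi m \<partial>circle_measure)"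
    proof (rule contour_integral_circlepath_mean)
      show "continuous_on (sphere 0 r) (\<lambda>z. f z * z powi m)"
        using r by (intro continuous_intros continuous_on_subset[OF holomorphic_on_imp_continuous_on[OF hol]]) auto
    qed fact
    finally show ?thesis by simp
  qed
  have "(\<integral>z. T z * z powi m \<partial>circle_measure) = residue ?q 0"
  proof (rule radial_integral[OF holomorphic_on_imp_continuous_on[OF hol] bound T])
    show "0 \<le> (1/2::real)" "1/2 < (1::real)" by simp_all
    show "continuous_on (cball 0 1 - ball 0 (1/2)) (\<lambda>z::complex. z powi m)"
      by (intro continuous_intros) auto
  qed (auto intro!: mean)
  then show ?thesis using mean[OF s] by simp
qed

subsection \<open>Trigonometric approximation and invariance of the measure\<close>

inductive trig_poly :: "(complex \<Rightarrow> complex) \<Rightarrow> bool" where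
  monom: "trig_poly (\<lambda>z. c * z powi m)"
| add: "trig_poly s \<Longrightarrow> trig_poly t \<Longrightarrow> trig_poly (\<lambda>z. s z + t z)"

lemma trig_poly_continuous: "trig_poly t \<Longrightarrow> continuous_on (sphere 0 1) t"
  by (induction rule: trig_poly.induct) (auto intro!: continuous_intros)

lemma trig_poly_scale: "trig_poly t \<Longrightarrow> trig_poly (\<lambda>z. c * t z)"
proof (induction rule: trig_poly.induct)
  case (monom d m)
  show ?case using trig_poly.monom[of "c * d" m] by (simp add: mult.assoc)
next
  case (add s t)
  then show ?case using trig_poly.add by (simp add: distrib_left)
qed

text \<open>Equality is claimed on the circle only, because exponents do not add at the origin:
  \<open>0 powi 1 * 0 powi -1\<close> is 0 but \<open>0 powi 0\<close> is 1.\<close>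

lemma trig_poly_mult:
  "trig_poly s \<Longrightarrow> trig_poly t \<Longrightarrow> \<exists>u. trig_poly u \<and> (\<forall>z\<in>sphere 0 1. s z * t z = u z)"
proof (induction rule: trig_poly.induct)
  case (monom c m)
  from monom.prems show ?case
  proof (induction rule: trig_poly.induct)
    case (monom d n)
    have "c * z powi m * (d * z powi n) = (c * d) * z powi (m + n)" if "z \<in> sphere 0 1" for z
    proof -
      have "z \<noteq> 0" using that by auto
      then show ?thesis by (simp add: power_int_add)
    qed
    then show ?case using trig_poly.monom by blast
  next
    case (add s t)
    then obtain u v where "trig_poly u" "trig_poly v"
      "\<forall>z\<in>sphere 0 1. c * z powi m * s z = u z" "\<forall>z\<in>sphere 0 1. c * z powi m * t z = v z" by blast
    then show ?case
      by (intro exI[of _ "\<lambda>z. u z + v z"] conjI trig_poly.add) (auto simp: distrib_left)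
  qed
next
  case (add s t')
  then obtain u v where "trig_poly u" "trig_poly v"
    "\<forall>z\<in>sphere 0 1. s z * t z = u z" "\<forall>z\<in>sphere 0 1. t' z * t z = v z" by blast
  then show ?case
    by (intro exI[of _ "\<lambda>z. u z + v z"] conjI trig_poly.add) (auto simp: distrib_right)
qed

lemma powi_sphere_cnj:
  fixes z :: complex
  assumes "norm z = 1" shows "z powi (- m) = cnj (z powi m)"
proof -
  have "inverse z = cnj z"
    using assms by (intro inverse_unique) (simp add: complex_norm_square[symmetric])
  then show ?thesis
    by (simp add: power_int_minus flip: power_int_inverse)
qed

lemma prob_sphere [simp]: "measure circle_measure (sphere 0 1) = 1"
  using circle.prob_space by simp

text \<open>Stone-Weierstrass for the real algebra of continuous functions that agree with a
  trigonometric polynomial on the circle. It separates points because it contains \<open>Re\<close>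
  and \<open>Im\<close>, the inverse of \<open>z\<close> being its conjugate there.\<close>

lemma trig_poly_approx_real:
  fixes u :: "complex \<Rightarrow> real"
  assumes u: "continuous_on (sphere 0 1) u" and e: "e > 0"
  obtains t where "trig_poly t" "\<And>z. z \<in> sphere 0 1 \<Longrightarrow> norm (of_real (u z) - t z) < e"
proof -
  define P where "P f \<longleftrightarrow> continuous_on (sphere 0 1) f \<and>
      (\<exists>t. trig_poly t \<and> (\<forall>z\<in>sphere 0 1. complex_of_real (f z) = t z))" for f :: "complex \<Rightarrow> real"
  have "\<exists>g. P g \<and> (\<forall>x\<in>sphere 0 1. \<bar>u x - g x\<bar> < e)"
  proof (rule Stone_Weierstrass_HOL[OF _ _ _ _ _ _ u e])
    fix c :: real
    show "P (\<lambda>x. c)"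
      unfolding P_def using trig_poly.monom[of "of_real c" 0] by auto
  next
    fix f g assume fg: "P f \<and> P g"
    then obtain s t where st: "trig_poly s" "trig_poly t"
      "\<And>z. z \<in> sphere 0 1 \<Longrightarrow> complex_of_real (f z) = s z" "\<And>z. z \<in> sphere 0 1 \<Longrightarrow> complex_of_real (g z) = t z"
      by (auto simp: P_def)
    show "P (\<lambda>x. f x + g x)"
      unfolding P_def using fg trig_poly.add[OF st(1,2)] st(3,4) by (auto simp: P_def intro!: continuous_intros)
    obtain v where "trig_poly v" "\<forall>z\<in>sphere 0 1. s z * t z = v z"
      using trig_poly_mult[OF st(1,2)] by blast
    then show "P (\<lambda>x. f x * g x)"
      unfolding P_def using fg st(3,4) by (auto simp: P_def intro!: continuous_intros)
  next
    fix x y :: complex assume xy: "x \<in> sphere 0 1 \<and> y \<in> sphere 0 1 \<and> x \<noteq> y"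
    have tp: "trig_poly (\<lambda>z. c * z powi 1 + d * z powi -1)" for c d
      by (intro trig_poly.intros)
    have "P Re"
      unfolding P_def
    proof (intro conjI exI[of _ "\<lambda>z. (1/2) * z powi 1 + (1/2) * z powi -1"] tp ballI)
      show "complex_of_real (Re z) = (1/2) * z powi 1 + (1/2) * z powi -1" if "z \<in> sphere 0 1" for z
        using that powi_sphere_cnj[of z 1] by (simp add: complex_eq_iff)
    qed (intro continuous_intros)
    moreover have "P Im"
      unfolding P_def
    proof (intro conjI exI[of _ "\<lambda>z. (-\<i>/2) * z powi 1 + (\<i>/2) * z powi -1"] tp ballI)
      show "complex_of_real (Im z) = (-\<i>/2) * z powi 1 + (\<i>/2) * z powi -1" if "z \<in> sphere 0 1" for z
        using that powi_sphere_cnj[of z 1] by (simp add: complex_eq_iff)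
    qed (intro continuous_intros)
    ultimately show "\<exists>f. P f \<and> f x \<noteq> f y"
      using xy complex_eq_iff by blast
  qed (auto simp: P_def)
  then obtain g t where "trig_poly t" "\<forall>x\<in>sphere 0 1. \<bar>u x - g x\<bar> < e" "\<forall>z\<in>sphere 0 1. complex_of_real (g z) = t z"
    by (auto simp: P_def)
  then show thesis
    by (intro that[of t]) (metis norm_of_real of_real_diff)+
qed

lemma trig_poly_approx:
  assumes u: "continuous_on (sphere 0 1) u" and e: "e > 0"
  obtains t where "trig_poly t" "\<And>z. z \<in> sphere 0 1 \<Longrightarrow> norm (u z - t z) < e"
proof -
  have "continuous_on (sphere 0 1) (\<lambda>z. Re (u z))" "continuous_on (sphere 0 1) (\<lambda>z. Im (u z))"
    using u by (auto intro!: continuous_intros)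
  then obtain s t where st: "trig_poly s" "trig_poly t"
    "\<And>z. z \<in> sphere 0 1 \<Longrightarrow> norm (of_real (Re (u z)) - s z) < e / 2"
    "\<And>z. z \<in> sphere 0 1 \<Longrightarrow> norm (of_real (Im (u z)) - t z) < e / 2"
    using trig_poly_approx_real half_gt_zero[OF e] by metis
  show thesis
  proof (rule that[of "\<lambda>z. s z + \<i> * t z"])
    show "trig_poly (\<lambda>z. s z + \<i> * t z)"
      by (intro trig_poly.add trig_poly_scale st)
    fix z :: complex assume z: "z \<in> sphere 0 1"
    have "u z - (s z + \<i> * t z) = (of_real (Re (u z)) - s z) + \<i> * (of_real (Im (u z)) - t z)"
      by (simp add: complex_eq_iff)
    also have "norm \<dots> \<le> norm (of_real (Re (u z)) - s z) + norm (\<i> * (of_real (Im (u z)) - t z))"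
      by (rule norm_triangle_ineq)
    also have "\<dots> < e / 2 + e / 2"
      using st(3,4)[OF z] by (intro add_strict_mono) (simp_all add: norm_mult)
    finally show "norm (u z - (s z + \<i> * t z)) < e" by simp
  qed
qed

section \<open>Density of trigonometric polynomials in L^1\<close>

lemma integrable_bounded_circle:
  fixes u :: "complex \<Rightarrow> 'b::{banach, second_countable_topology}"
  assumes "u \<in> borel_measurable circle_measure" "\<And>z. norm z = 1 \<Longrightarrow> norm (u z) \<le> B"
  shows "integrable circle_measure u"
  by (rule circle.integrable_const_bound[of _ B]) (use assms in auto)

lemma continuous_on_circle_bounded:
  assumes "continuous_on (sphere 0 1) (u :: complex \<Rightarrow> 'b::real_normed_vector)"
  obtains B where "B > 0" "\<And>z. norm z = 1 \<Longrightarrow> norm (u z) \<le> B"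
proof -
  obtain B where "\<And>z. z \<in> sphere 0 1 \<Longrightarrow> norm (u z) \<le> B"
    using compact_imp_bounded[OF compact_continuous_image[OF assms compact_sphere]]
    unfolding bounded_iff by (metis image_eqI)
  then show thesis by (intro that[of "max B 1"]) (auto simp: le_max_iff_disj)
qed

lemma continuous_on_circle_integrable:
  fixes u :: "complex \<Rightarrow> 'b::{banach, second_countable_topology}"
  assumes "continuous_on (sphere 0 1) u" shows "integrable circle_measure u"
  using continuous_on_circle_bounded[OF assms] integrable_bounded_circle[OF continuous_on_circle_measurable[OF assms]] by metis

lemma L1_triangle:
  fixes u v w :: "complex \<Rightarrow> complex"
  assumes "integrable M u" "integrable M v" "integrable M w"
  shows "(\<integral>z. norm (u z - w z) \<partial>M) \<le> (\<integral>z. norm (u z - v z) \<partial>M) + (\<integral>z. norm (v z - w z) \<partial>M)"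
proof -
  have "(\<integral>z. norm (u z - w z) \<partial>M) \<le> (\<integral>z. norm (u z - v z) + norm (v z - w z) \<partial>M)"
  proof (rule integral_mono)
    show "norm (u z - w z) \<le> norm (u z - v z) + norm (v z - w z)" for z
      using norm_triangle_ineq[of "u z - v z" "v z - w z"] by simp
  qed (use assms in auto)
  also have "\<dots> = (\<integral>z. norm (u z - v z) \<partial>M) + (\<integral>z. norm (v z - w z) \<partial>M)"
    using assms by (intro Bochner_Integration.integral_add) auto
  finally show ?thesis .
qed

text \<open>Continuous approximations of the indicator of a closed set from above. For empty
  \<open>C\<close> the convention \<open>infdist z {} = 0\<close> gives the constant 1, so the empty
  set is treated separately.\<close>

definition bump :: "complex set \<Rightarrow> nat \<Rightarrow> complex \<Rightarrow> real" where
  "bump C n z = max 0 (1 - real n * infdist z C)"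

lemma bump_continuous: "continuous_on A (bump C n)"
  unfolding bump_def by (intro continuous_intros)

lemma bump_bounds: "0 \<le> bump C n z" "bump C n z \<le> 1"
  by (auto simp: bump_def infdist_nonneg)

lemma bump_tendsto:
  assumes "closed C" "C \<noteq> {}"
  shows "(\<lambda>n. bump C n z) \<longlonglongrightarrow> indicator C z"
proof (cases "z \<in> C")
  case True
  then show ?thesis by (simp add: bump_def)
next
  case False
  then have pos: "infdist z C > 0"
    using assms in_closed_iff_infdist_zero[OF assms] infdist_nonneg[of z C] by (metis less_eq_real_def)
  obtain N :: nat where N: "1 / infdist z C \<le> real N" using real_arch_simple by blast
  have "bump C n z = 0" if "n \<ge> N" for n
  proof -
    have "1 / infdist z C \<le> real n" using N that by linarith
    then show ?thesis using pos by (simp add: bump_def field_simps)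
  qed
  then have "\<forall>\<^sub>F n in sequentially. bump C n z = 0"
    using eventually_sequentially by blast
  then show ?thesis using False by (simp add: tendsto_eventually)
qed

text \<open>\<open>D\<close> is membership in the L^1 closure of the trigonometric polynomials. It
  passes from continuous functions to indicators of closed sets, of Borel sets and of completed
  measurable sets, and by dominated limits to all integrable functions.\<close>

lemma integrable_trig_approx:
  fixes u :: "complex \<Rightarrow> complex"
  assumes "integrable circle_measure u" "e > 0"
  shows "\<exists>t. trig_poly t \<and> (\<integral>z. norm (u z - t z) \<partial>circle_measure) < e"
proof -
  define D where "D u \<longleftrightarrow> (\<forall>e>0. \<exists>t. trig_poly t \<and> (\<integral>z. norm (u z - t z) \<partial>circle_measure) < e)" for u :: "complex \<Rightarrow> complex"
  have tp_int: "integrable circle_measure t" if "trig_poly t" for t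
    by (rule continuous_on_circle_integrable[OF trig_poly_continuous[OF that]])
  have D_cont: "D v" if v: "continuous_on (sphere 0 1) v" for v
    unfolding D_def
  proof (intro allI impI)
    fix e :: real assume e: "e > 0"
    obtain t where t: "trig_poly t" "\<And>z. z \<in> sphere 0 1 \<Longrightarrow> norm (v z - t z) < e / 2"
      using trig_poly_approx[OF v half_gt_zero[OF e]] by blast
    have "(\<integral>z. norm (v z - t z) \<partial>circle_measure) \<le> (\<integral>z. e / 2 \<partial>circle_measure)"
      using t(2) by (intro integral_mono integrable_norm Bochner_Integration.integrable_diff tp_int t continuous_on_circle_integrable v)
        (auto simp: less_imp_le)
    also have "\<dots> < e" using e by simp
    finally show "\<exists>t. trig_poly t \<and> (\<integral>z. norm (v z - t z) \<partial>circle_measure) < e" using t by blast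
  qed
  have D_closure: "D v" if v: "integrable circle_measure v"
    and close: "\<And>e. e > 0 \<Longrightarrow> \<exists>w. integrable circle_measure w \<and> D w \<and> (\<integral>z. norm (v z - w z) \<partial>circle_measure) < e" for v
    unfolding D_def
  proof (intro allI impI)
    fix e :: real assume e: "e > 0"
    obtain w where w: "integrable circle_measure w" "D w" "(\<integral>z. norm (v z - w z) \<partial>circle_measure) < e / 2"
      using close[OF half_gt_zero[OF e]] by blast
    obtain t where t: "trig_poly t" "(\<integral>z. norm (w z - t z) \<partial>circle_measure) < e / 2"
      using w(2) half_gt_zero[OF e] unfolding D_def by blast
    have "(\<integral>z. norm (v z - t z) \<partial>circle_measure) < e"
      using L1_triangle[OF v w(1) tp_int[OF t(1)]] w(3) t(2) by linarith
    then show "\<exists>t. trig_poly t \<and> (\<integral>z. norm (v z - t z) \<partial>circle_measure) < e" using t by blast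
  qed
  have D_lim: "D v" if v: "integrable circle_measure v" and s: "\<And>i::nat. integrable circle_measure (s i)" "\<And>i. D (s i)"
    and w: "integrable circle_measure w"
    and lim: "\<And>z. norm z = 1 \<Longrightarrow> (\<lambda>i. s i z) \<longlonglongrightarrow> v z" and bound: "\<And>i z. norm z = 1 \<Longrightarrow> norm (v z - s i z) \<le> w z"
    for v s and w :: "complex \<Rightarrow> real"
  proof (rule D_closure[OF v])
    fix e :: real assume e: "e > 0"
    have "(\<lambda>i. \<integral>z. norm (v z - s i z) \<partial>circle_measure) \<longlonglongrightarrow> (\<integral>z. 0 \<partial>circle_measure)"
    proof (rule integral_dominated_convergence[OF _ _ w])
      show "AE z in circle_measure. (\<lambda>i. norm (v z - s i z)) \<longlonglongrightarrow> 0"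
      proof (rule AE_I2)
        fix z assume "z \<in> space circle_measure"
        then have "(\<lambda>i. v z - s i z) \<longlonglongrightarrow> v z - v z"
          by (intro tendsto_intros lim) simp
        then show "(\<lambda>i. norm (v z - s i z)) \<longlonglongrightarrow> 0"
          using tendsto_norm_zero by simp
      qed
    qed (use v s bound in auto)
    then have "\<forall>\<^sub>F i in sequentially. (\<integral>z. norm (v z - s i z) \<partial>circle_measure) < e"
      using e by (intro order_tendstoD) auto
    then obtain i where "(\<integral>z. norm (v z - s i z) \<partial>circle_measure) < e"
      using eventually_happens' sequentially_bot by blast
    then show "\<exists>w. integrable circle_measure w \<and> D w \<and> (\<integral>z. norm (v z - w z) \<partial>circle_measure) < e"
      using s by blast
  qed
  have D_add: "D (\<lambda>z. v z + w z)" if vw: "integrable circle_measure v" "integrable circle_measure w" "D v" "D w" for v w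
    unfolding D_def
  proof (intro allI impI)
    fix e :: real assume e: "e > 0"
    obtain s t where st: "trig_poly s" "trig_poly t" "(\<integral>z. norm (v z - s z) \<partial>circle_measure) < e / 2" "(\<integral>z. norm (w z - t z) \<partial>circle_measure) < e / 2"
      using vw(3,4) half_gt_zero[OF e] unfolding D_def by meson
    have "(\<integral>z. norm ((v z + w z) - (s z + t z)) \<partial>circle_measure) \<le> (\<integral>z. norm (v z - s z) + norm (w z - t z) \<partial>circle_measure)"
      using vw tp_int st by (intro integral_mono) (auto intro: norm_diff_triangle_ineq)
    also have "\<dots> = (\<integral>z. norm (v z - s z) \<partial>circle_measure) + (\<integral>z. norm (w z - t z) \<partial>circle_measure)"
      using vw tp_int st by (intro Bochner_Integration.integral_add) auto
    also have "\<dots> < e" using st by simp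
    finally show "\<exists>t. trig_poly t \<and> (\<integral>z. norm (v z + w z - t z) \<partial>circle_measure) < e"
      using trig_poly.add[OF st(1,2)] by (intro exI[of _ "\<lambda>z. s z + t z"]) auto
  qed
  have D_scale: "D (\<lambda>z. c * v z)" if v: "D v" for v c
    unfolding D_def
  proof (intro allI impI)
    fix e :: real assume e: "e > 0"
    then have "e / (norm c + 1) > 0" by (simp add: add_nonneg_pos)
    then obtain t where t: "trig_poly t" "(\<integral>z. norm (v z - t z) \<partial>circle_measure) < e / (norm c + 1)"
      using v unfolding D_def by meson
    have "(\<integral>z. norm (c * v z - c * t z) \<partial>circle_measure) = norm c * (\<integral>z. norm (v z - t z) \<partial>circle_measure)"
      by (simp flip: right_diff_distrib add: norm_mult)
    also have "\<dots> \<le> norm c * (e / (norm c + 1))"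
      using t(2) by (intro mult_left_mono) auto
    also have "\<dots> < e"
      using e by (simp add: field_simps add_pos_nonneg)
    finally show "\<exists>t. trig_poly t \<and> (\<integral>z. norm (c * v z - t z) \<partial>circle_measure) < e"
      using trig_poly_scale[OF t(1)] by blast
  qed
  have ind_meas: "(\<lambda>z. indicator A z :: complex) \<in> borel_measurable circle_measure" if "A \<in> sets borel" for A
    using that by (intro measurable_circle_measure_borel) auto
  have ind_int: "integrable circle_measure (\<lambda>z. indicator A z :: complex)" if "A \<in> sets borel" for A
    using ind_meas[OF that] by (rule integrable_bounded_circle[where B = 1]) (auto simp: indicator_def)
  have D_closed: "D (indicator C)" if C: "closed C" for C
  proof (cases "C = {}")
    case True
    then show ?thesis by (intro D_cont) simp
  next
    case False
    show ?thesis
    proof (rule D_lim[where s = "\<lambda>n z. of_real (bump C n z)" and w = "\<lambda>_. 2"])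
      show "integrable circle_measure (indicator C :: complex \<Rightarrow> complex)"
        using ind_int C by auto
      show "integrable circle_measure (\<lambda>z. complex_of_real (bump C n z))" "D (\<lambda>z. of_real (bump C n z))" for n
        by (intro D_cont continuous_on_circle_integrable continuous_intros bump_continuous)+
      show "(\<lambda>n. complex_of_real (bump C n z)) \<longlonglongrightarrow> indicator C z" for z
      proof -
        have "(\<lambda>n. complex_of_real (bump C n z)) \<longlonglongrightarrow> of_real (indicator C z)"
          by (intro tendsto_of_real bump_tendsto C False)
        then show ?thesis by (cases "z \<in> C") auto
      qed
      show "norm (indicator C z - complex_of_real (bump C n z)) \<le> 2" for n z
        using norm_triangle_ineq4[of "indicator C z" "complex_of_real (bump C n z)"] bump_bounds[of C n z]
        by (auto simp: indicator_def split: if_splits)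
    qed simp
  qed
  have D_borel: "D (indicator A)" if "A \<in> sets borel" for A
  proof -
    \<comment> \<open>Closed sets are stable under intersection and generate the Borel sets, so
      complements and disjoint countable unions suffice.\<close>
    have "Int_stable (Collect closed :: complex set set)" "Collect closed \<subseteq> Pow (UNIV :: complex set)"
      by (auto simp: Int_stable_def)
    moreover have "A \<in> sigma_sets UNIV (Collect closed)"
      using that unfolding borel_eq_closed by simp
    ultimately show ?thesis
    proof (induction rule: sigma_sets_induct_disjoint)
      case (basic A)
      then show ?case using D_closed by simp
    next
      case empty
      then show ?case by (intro D_cont) simp
    next
      case (compl A)
      then have A: "A \<in> sets borel" unfolding borel_eq_closed by simp
      have "D (\<lambda>z. 1 + (-1) * indicator A z)"
        by (intro D_add D_scale D_cont compl ind_int A continuous_on_circle_integrable continuous_intros integrable_mult_right)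
      also have "(\<lambda>z. 1 + (-1) * indicator A z :: complex) = indicator (UNIV - A)"
        by (auto simp: indicator_def)
      finally show ?case .
    next
      case (union A)
      then have A: "A i \<in> sets borel" for i unfolding borel_eq_closed by auto
      have sum_eq: "(\<Sum>i<n. indicator (A i) z :: complex) = indicator (\<Union>i<n. A i) z" for n z
      proof -
        have "disjoint_family_on A {..<n}" using union(1) disjoint_family_on_mono by blast
        then show ?thesis by (subst indicator_UN_disjoint) auto
      qed
      have D_sum: "D (\<lambda>z. \<Sum>i<n. indicator (A i) z)" for n
      proof (induction n)
        case 0 then show ?case by (intro D_cont) simp
      next
        case (Suc n)
        then show ?case by (simp) (intro D_add Bochner_Integration.integrable_sum ind_int A union)
      qed
      show ?case
      proof (rule D_lim[where s = "\<lambda>n z. \<Sum>i<n. indicator (A i) z" and w = "\<lambda>_. 2"])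
        show "(\<lambda>n. \<Sum>i<n. indicator (A i) z :: complex) \<longlonglongrightarrow> indicator (\<Union>i. A i) z" for z
          unfolding sum_eq by (rule LIMSEQ_indicator_UN)
        show "norm (indicator (\<Union>i. A i) z - (\<Sum>i<n. indicator (A i) z :: complex)) \<le> 2" for n z
          unfolding sum_eq by (auto simp: indicator_def)
      qed (use A in \<open>auto intro!: D_sum Bochner_Integration.integrable_sum ind_int\<close>)
    qed
  qed
  have D_sets: "D (indicator A)" if A: "A \<in> sets circle_measure" for A
  proof -
    \<comment> \<open>A set of the completion differs from its Borel main part by a null set, which
      does not affect L^1 distances.\<close>
    have "A \<in> sets (completion borel_circle)"
      using A by (simp only: circle_measure_eq_completion)
    then have "main_part borel_circle A \<in> sets borel_circle"
      by (rule main_part_sets)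
    then obtain A' where A': "A' \<in> sets borel" "main_part borel_circle A = sphere 0 1 \<inter> A'"
      by (auto simp: sets_restrict_space)
    have "AE z in circle_measure. z \<in> main_part borel_circle A \<longleftrightarrow> z \<in> A"
      using A unfolding circle_measure_eq_completion by (intro AE_completion AE_in_main_part)
    then have ae: "AE z in circle_measure. z \<in> A \<longleftrightarrow> z \<in> A'"
      using AE_space by eventually_elim (auto simp: A'(2))
    have "(\<integral>z. norm (indicator A z - t z) \<partial>circle_measure) = (\<integral>z. norm (indicator A' z - t z) \<partial>circle_measure)"
      if t: "trig_poly t" for t
    proof (rule integral_cong_AE)
      show "AE z in circle_measure. norm (indicator A z - t z) = norm (indicator A' z - t z)"
        using ae by eventually_elim (simp add: indicator_def)
    qed (use A ind_meas[OF A'(1)] borel_measurable_integrable[OF tp_int[OF t]] in auto)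
    then show ?thesis
      using D_borel[OF A'(1)] unfolding D_def by metis
  qed
  have "D u" using assms(1)
  proof (induction rule: integrable_induct)
    case (base A c)
    have "D (\<lambda>z. c * indicator A z)" by (intro D_scale D_sets base)
    also have "(\<lambda>z. c * indicator A z) = (\<lambda>z. indicator A z *\<^sub>R c)" by (auto simp: indicator_def)
    finally show ?case .
  next
    case (add f g)
    then show ?case by (intro D_add)
  next
    case (lim f s)
    show ?case
    proof (rule D_lim[where s = s and w = "\<lambda>z. 3 * norm (f z)"])
      fix i and z :: complex assume "norm z = 1"
      then have "norm (s i z) \<le> 2 * norm (f z)" using lim by auto
      then show "norm (f z - s i z) \<le> 3 * norm (f z)"
        using norm_triangle_ineq4[of "f z" "s i z"] by simp
    qed (use lim in auto)
  qed
  then show ?thesis using assms(2) unfolding D_def by blast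
qed

section \<open>Invariance of the circle measure\<close>

text \<open>The \<open>bump\<close> functions recover the measure of every closed set, and closed
  sets form an intersection-stable generator.\<close>

lemma measure_eqI_continuous:
  fixes N1 N2 :: "complex measure"
  assumes N: "finite_measure N1" "finite_measure N2" "sets N1 = sets borel" "sets N2 = sets borel"
    and eq: "\<And>\<phi> :: complex \<Rightarrow> real. continuous_on UNIV \<phi> \<Longrightarrow> (\<integral>z. \<phi> z \<partial>N1) = (\<integral>z. \<phi> z \<partial>N2)"
  shows "N1 = N2"
proof (rule measure_eqI_generator_eq[where E = "Collect closed" and \<Omega> = UNIV and A = "\<lambda>_. UNIV"])
  have lim: "(\<lambda>n. \<integral>z. bump C n z \<partial>N) \<longlonglongrightarrow> measure N C"
    if "finite_measure N" "sets N = sets borel" "closed C" "C \<noteq> {}" for N C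
  proof -
    interpret finite_measure N by fact
    note that(2) [measurable_cong]
    have [measurable]: "C \<in> sets borel" using that by auto
    have "(\<lambda>n. \<integral>z. bump C n z \<partial>N) \<longlonglongrightarrow> (\<integral>z. indicator C z \<partial>N)"
    proof (rule integral_dominated_convergence[where w = "\<lambda>_. 1"])
      show "bump C n \<in> borel_measurable N" for n
        using borel_measurable_continuous_onI[OF bump_continuous] by (simp add: measurable_cong_sets[OF that(2) refl])
    qed (use that bump_tendsto bump_bounds in auto)
    also have "(\<integral>z. indicator C z \<partial>N) = measure N C"
      using sets_eq_imp_space_eq[OF that(2)] by simp
    finally show ?thesis .
  qed
  show "emeasure N1 C = emeasure N2 C" if "C \<in> Collect closed" for C
  proof (cases "C = {}")
    case False
    have "(\<lambda>n. \<integral>z. bump C n z \<partial>N1) = (\<lambda>n. \<integral>z. bump C n z \<partial>N2)"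
      using eq[OF bump_continuous] by auto
    then have "measure N1 C = measure N2 C"
      using lim[OF N(1,3), of C] lim[OF N(2,4), of C] that False LIMSEQ_unique by force
    then show ?thesis
      using N(1,2) by (simp add: finite_measure.emeasure_eq_measure)
  qed simp
  show "emeasure N1 UNIV \<noteq> \<infinity>"
    using N(1) by (simp add: finite_measure.emeasure_eq_measure)
qed (use N in \<open>auto simp: Int_stable_def borel_eq_closed\<close>)

text \<open>Unlike \<open>boundary_map\<close>, the function \<open>T\<close> maps every point of
  the circle to the circle, so it can be composed without exceptional points.\<close>

definition has_inner_boundary :: "(complex \<Rightarrow> complex) \<Rightarrow> (complex \<Rightarrow> complex) \<Rightarrow> bool" where
  "has_inner_boundary f T \<longleftrightarrow> f holomorphic_on ball 0 1 \<and> f ` ball 0 1 \<subseteq> ball 0 1 \<and> radial f T \<and> T \<in> sphere 0 1 \<rightarrow> sphere 0 1"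

lemma has_inner_boundary_id: "has_inner_boundary id id"
proof -
  have "((\<lambda>r. of_real r * z) \<longlongrightarrow> z) (at_left 1)" for z :: complex
    by (rule tendsto_eq_intros refl | simp)+
  then show ?thesis
    by (auto simp: has_inner_boundary_def radial_def holomorphic_on_id)
qed

context
  fixes f T :: "complex \<Rightarrow> complex"
  assumes fT: "has_inner_boundary f T"
begin

lemma inner_holomorphic: "f holomorphic_on ball 0 1"
  and inner_bound: "z \<in> ball 0 1 \<Longrightarrow> norm (f z) \<le> 1"
  and inner_range: "z \<in> ball 0 1 \<Longrightarrow> f z \<in> ball 0 1"
  and inner_radial: "radial f T"
  and inner_boundary_norm: "norm z = 1 \<Longrightarrow> norm (T z) = 1"
  using fT by (auto simp: has_inner_boundary_def image_subset_iff less_imp_le Pi_iff)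

lemma inner_boundary_borel_measurable: "T \<in> borel_measurable circle_measure"
  by (rule radial_measurable[OF holomorphic_on_imp_continuous_on[OF inner_holomorphic] inner_radial])

text \<open>For positive powers this is the Cauchy formula for \<open>f z ^ k\<close> at the origin,
  where the kernel is 1 on the circle; negative powers are conjugates of positive ones.\<close>

lemma inner_boundary_integral_powi:
  assumes f0: "f 0 = 0"
  shows "(\<integral>z. T z powi m \<partial>circle_measure) = (if m = 0 then 1 else 0)"
proof -
  have pos: "(\<integral>z. T z ^ k \<partial>circle_measure) = 0" if k: "k > 0" for k :: nat
  proof -
    have "(\<integral>z. T z ^ k * (z / (z - 0)) \<partial>circle_measure) = f 0 ^ k"
    proof (rule radial_cauchy)
      show "(\<lambda>z. f z ^ k) holomorphic_on ball 0 1"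
        by (intro holomorphic_intros inner_holomorphic)
      show "norm (f z ^ k) \<le> 1" if "z \<in> ball 0 1" for z
        using inner_bound[OF that] by (simp add: norm_power power_le_one)
      show "radial (\<lambda>z. f z ^ k) (\<lambda>z. T z ^ k)"
        using inner_radial unfolding radial_def by eventually_elim (intro tendsto_intros)
    qed simp
    moreover have "(\<integral>z. T z ^ k * (z / (z - 0)) \<partial>circle_measure) = (\<integral>z. T z ^ k \<partial>circle_measure)"
      by (rule Bochner_Integration.integral_cong) auto
    ultimately show ?thesis using k by (simp only: f0 zero_power)
  qed
  consider "m = 0" | "m > 0" | "m < 0" by linarith
  then show ?thesis
  proof cases
    case 2
    then have "T z powi m = T z ^ nat m" for z by (simp add: power_int_def)
    with 2 pos[of "nat m"] show ?thesis by simp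
  next
    case 3
    have "(\<integral>z. T z powi m \<partial>circle_measure) = (\<integral>z. cnj (T z ^ nat (- m)) \<partial>circle_measure)"
    proof (rule Bochner_Integration.integral_cong)
      fix z assume "z \<in> space circle_measure"
      then have "inverse (T z) = cnj (T z)"
        using inner_boundary_norm[of z] by (intro inverse_unique) (simp add: complex_norm_square[symmetric])
      then show "T z powi m = cnj (T z ^ nat (- m))"
        using 3 by (simp add: power_int_def power_inverse)
    qed simp
    also have "\<dots> = cnj (\<integral>z. T z ^ nat (- m) \<partial>circle_measure)"
      by (rule Bochner_Integration.integral_cnj)
    finally show ?thesis using 3 pos[of "nat (- m)"] by simp
  qed simp
qed

lemma inner_boundary_comp_measurable:
  fixes u :: "complex \<Rightarrow> 'b::{banach, second_countable_topology}"
  assumes u: "continuous_on (sphere 0 1) u" shows "(\<lambda>z. u (T z)) \<in> borel_measurable circle_measure"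
proof -
  have "T \<in> circle_measure \<rightarrow>\<^sub>M restrict_space borel (sphere 0 1)"
    using inner_boundary_borel_measurable inner_boundary_norm by (intro measurable_restrict_space2) auto
  from measurable_compose[OF this borel_measurable_continuous_on_restrict[OF u]] show ?thesis .
qed

lemma inner_boundary_comp_integrable:
  fixes u :: "complex \<Rightarrow> 'b::{banach, second_countable_topology}"
  assumes u: "continuous_on (sphere 0 1) u" shows "integrable circle_measure (\<lambda>z. u (T z))"
proof -
  obtain B where "\<And>z. norm z = 1 \<Longrightarrow> norm (u z) \<le> B"
    using continuous_on_circle_bounded[OF u] by metis
  then show ?thesis
    by (intro integrable_bounded_circle[OF inner_boundary_comp_measurable[OF u], where B = B]) (auto simp: inner_boundary_norm)
qed

end

lemma integral_trig_poly_inner_boundary: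
  assumes "has_inner_boundary f T" "f 0 = 0" "trig_poly t"
  shows "(\<integral>z. t (T z) \<partial>circle_measure) = (\<integral>z. t z \<partial>circle_measure)"
  using assms(3)
proof (induction rule: trig_poly.induct)
  case (monom c m)
  \<comment> \<open>The integral of \<open>z powi m\<close> itself is the case of the identity
    map.\<close>
  show ?case
    using inner_boundary_integral_powi[OF assms(1,2), of m] inner_boundary_integral_powi[OF has_inner_boundary_id, of m] by simp
next
  case (add s t)
  have "integrable circle_measure (\<lambda>z. u (T z))" "integrable circle_measure u" if "trig_poly u" for u
    using inner_boundary_comp_integrable[OF assms(1) trig_poly_continuous[OF that]]
      continuous_on_circle_integrable[OF trig_poly_continuous[OF that]] by auto
  with add show ?case by simp
qed

lemma integral_continuous_inner_boundary:
  fixes u :: "complex \<Rightarrow> real"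
  assumes fT: "has_inner_boundary f T" "f 0 = 0" and u: "continuous_on (sphere 0 1) u"
  shows "(\<integral>z. u (T z) \<partial>circle_measure) = (\<integral>z. u z \<partial>circle_measure)"
proof -
  have cu: "continuous_on (sphere 0 1) (\<lambda>z. complex_of_real (u z))"
    by (intro continuous_intros u)
  define I where "I = (\<integral>z. complex_of_real (u (T z)) \<partial>circle_measure)"
  define J where "J = (\<integral>z. complex_of_real (u z) \<partial>circle_measure)"
  have "norm (I - J) \<le> e" if e: "e > 0" for e
  proof -
    obtain t where t: "trig_poly t" "\<And>z. z \<in> sphere 0 1 \<Longrightarrow> norm (complex_of_real (u z) - t z) < e / 2"
      using trig_poly_approx[OF cu half_gt_zero[OF e]] by blast
    \<comment> \<open>Uniform approximation on the circle survives composition with any map of the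
      circle into itself; this serves for \<open>T\<close> and for the identity.\<close>
    have bound: "norm ((\<integral>z. complex_of_real (u (S z)) \<partial>circle_measure) - (\<integral>z. t (S z) \<partial>circle_measure)) \<le> e / 2"
      if S: "has_inner_boundary h S" for h S
    proof -
      have int: "integrable circle_measure (\<lambda>z. complex_of_real (u (S z)))" "integrable circle_measure (\<lambda>z. t (S z))"
        using inner_boundary_comp_integrable[OF S cu] inner_boundary_comp_integrable[OF S trig_poly_continuous[OF t(1)]] by auto
      have "norm (\<integral>z. complex_of_real (u (S z)) - t (S z) \<partial>circle_measure) \<le> (\<integral>z. norm (complex_of_real (u (S z)) - t (S z)) \<partial>circle_measure)"
        by (rule integral_norm_bound)
      also have "\<dots> \<le> (\<integral>z. e / 2 \<partial>circle_measure)"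
        using int t(2) inner_boundary_norm[OF S] by (intro integral_mono) (auto simp: less_imp_le)
      finally show ?thesis using int by simp
    qed
    have "norm (I - J) \<le> norm (I - (\<integral>z. t (T z) \<partial>circle_measure)) + norm ((\<integral>z. t (T z) \<partial>circle_measure) - J)"
      using norm_triangle_ineq[of "I - (\<integral>z. t (T z) \<partial>circle_measure)" "(\<integral>z. t (T z) \<partial>circle_measure) - J"] by simp
    also have "\<dots> \<le> e / 2 + e / 2"
      using bound[OF fT(1)] bound[OF has_inner_boundary_id]
      unfolding I_def J_def integral_trig_poly_inner_boundary[OF fT t(1)]
      by (intro add_mono) (simp_all add: norm_minus_commute)
    finally show ?thesis by simp
  qed
  then have "norm (I - J) \<le> 0" by (rule field_le_epsilon[where y = 0, simplified])
  then show ?thesis by (simp add: I_def J_def)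
qed

text \<open>Agreement of integrals of continuous functions gives invariance on Borel sets. Preimages
  of Borel null sets are then null, so measurability and invariance extend to the
  completion.\<close>

theorem inner_boundary_measure_preserving:
  assumes fT: "has_inner_boundary f T" "f 0 = 0"
  shows "T \<in> measurable circle_measure circle_measure" "distr circle_measure circle_measure T = circle_measure"
proof -
  have T_meas: "T \<in> circle_measure \<rightarrow>\<^sub>M restrict_space borel (sphere 0 1)"
    using inner_boundary_borel_measurable[OF fT(1)] inner_boundary_norm[OF fT(1)] by (intro measurable_restrict_space2) auto
  have id_meas: "(\<lambda>z. z) \<in> circle_measure \<rightarrow>\<^sub>M borel"
    by (intro measurable_circle_measure_borel) simp
  note T_borel = inner_boundary_borel_measurable[OF fT(1)]
  have eq: "distr circle_measure borel T = distr circle_measure borel (\<lambda>z. z)"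
  proof (rule measure_eqI_continuous)
    fix \<phi> :: "complex \<Rightarrow> real" assume \<phi>: "continuous_on UNIV \<phi>"
    then have "\<phi> \<in> borel_measurable borel" by (rule borel_measurable_continuous_onI)
    then show "(\<integral>z. \<phi> z \<partial>distr circle_measure borel T) = (\<integral>z. \<phi> z \<partial>distr circle_measure borel (\<lambda>z. z))"
      using integral_continuous_inner_boundary[OF fT continuous_on_subset[OF \<phi>]]
      by (simp add: integral_distr[OF T_borel] integral_distr[OF id_meas])
  qed (auto intro!: circle.finite_measure_distr T_borel id_meas)
  have eq0: "distr circle_measure borel_circle T = borel_circle"
  proof (rule measure_eqI)
    fix A assume "A \<in> sets (distr circle_measure borel_circle T)"
    then have A: "A \<in> sets (restrict_space borel (sphere 0 1))" by simp
    then obtain A' where A': "A' \<in> sets borel" "A = sphere 0 1 \<inter> A'"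
      by (auto simp: sets_restrict_space)
    have T_meas': "T \<in> circle_measure \<rightarrow>\<^sub>M borel_circle"
      using T_meas by (simp add: measurable_cong_sets[OF refl sets_borel_circle])
    have A_meas: "A \<in> sets circle_measure"
      using A unfolding circle_measure_eq_completion by auto
    have "emeasure (distr circle_measure borel_circle T) A = emeasure circle_measure (T -` A \<inter> sphere 0 1)"
      using A by (subst emeasure_distr[OF T_meas']) simp_all
    also have "T -` A \<inter> sphere 0 1 = T -` A' \<inter> sphere 0 1"
      using inner_boundary_norm[OF fT(1)] by (auto simp: A'(2))
    also have "emeasure circle_measure \<dots> = emeasure (distr circle_measure borel T) A'"
      using A'(1) by (subst emeasure_distr[OF T_borel]) simp_all
    also have "\<dots> = emeasure circle_measure (A' \<inter> sphere 0 1)"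
      unfolding eq using A'(1) by (subst emeasure_distr[OF id_meas]) simp_all
    also have "\<dots> = emeasure borel_circle A"
      using A unfolding circle_measure_eq_completion by (simp add: A'(2) Int_commute)
    finally show "emeasure (distr circle_measure borel_circle T) A = emeasure borel_circle A" .
  qed simp
  have T_meas': "T \<in> circle_measure \<rightarrow>\<^sub>M borel_circle"
    using T_meas by (simp add: measurable_cong_sets[OF refl sets_borel_circle])
  show "T \<in> measurable circle_measure circle_measure"
    using circle.measurable_completion2[OF T_meas'] eq0
    by (simp add: circle_measure_eq_completion[symmetric])
  have "distr circle_measure (completion borel_circle) T = completion (distr circle_measure borel_circle T)"
    by (rule circle.completion_distr_eq[OF T_meas', symmetric]) (simp add: eq0)
  then show "distr circle_measure circle_measure T = circle_measure"
    by (simp add: eq0 circle_measure_eq_completion[symmetric])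
qed

subsection \<open>Composition of inner functions\<close>

lemma radial_boundary_map:
  assumes "f holomorphic_on ball 0 1" "\<And>z. z \<in> ball 0 1 \<Longrightarrow> norm (f z) \<le> B"
  shows "radial f (boundary_map f)"
proof -
  have "AE z in circle_measure. \<exists>l. ((\<lambda>r. f (of_real r * z)) \<longlongrightarrow> l) (at_left 1)"
    by (rule AE_circle_cis[OF Fatou_cis_AE[OF assms]])
  then show ?thesis
    unfolding radial_def boundary_map_def
  proof eventually_elim
    case (elim z)
    then obtain l where l: "((\<lambda>r. f (of_real r * z)) \<longlongrightarrow> l) (at_left 1)" by blast
    then show ?case using tendsto_Lim[OF trivial_limit_at_left_real l] by simp
  qed
qed

lemma radial_unique:
  assumes "radial f S" "radial f T"
  shows "AE z in circle_measure. S z = T z"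
  using assms unfolding radial_def
  by eventually_elim (rule tendsto_unique[OF trivial_limit_at_left_real])

text \<open>If \<open>t\<close> approximates the conjugate of \<open>D\<close> in L^1, then the
  integral of the squared modulus of \<open>D\<close> equals that of
  \<open>D z * (cnj (D z) - t z)\<close>, which is small because \<open>D\<close> is
  bounded.\<close>

lemma AE_zero_if_fourier_zero:
  assumes D: "D \<in> borel_measurable circle_measure" and B: "AE z in circle_measure. norm (D z) \<le> B"
    and zero: "\<And>m. (\<integral>z. D z * z powi m \<partial>circle_measure) = 0"
  shows "AE z in circle_measure. D z = 0"
proof -
  have int_mult: "integrable circle_measure (\<lambda>z. D z * t z)" if "integrable circle_measure t" for t
  proof (rule Bochner_Integration.integrable_bound[where f = "\<lambda>z. B * t z"])
    show "AE z in circle_measure. norm (D z * t z) \<le> norm (of_real B * t z)"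
      using B by eventually_elim (auto simp: norm_mult intro!: mult_right_mono)
  qed (use that D in auto)
  have tp_int: "integrable circle_measure t" if "trig_poly t" for t
    by (rule continuous_on_circle_integrable[OF trig_poly_continuous[OF that]])
  have trig: "(\<integral>z. D z * t z \<partial>circle_measure) = 0" if "trig_poly t" for t
    using that
  proof (induction rule: trig_poly.induct)
    case (monom c m)
    have "(\<integral>z. D z * (c * z powi m) \<partial>circle_measure) = c * (\<integral>z. D z * z powi m \<partial>circle_measure)"
      by (subst Bochner_Integration.integral_mult_right_zero[symmetric]) (simp add: mult_ac)
    then show ?case by (simp add: zero)
  next
    case (add s t)
    then show ?case by (simp add: distrib_left int_mult tp_int)
  qed
  have D_int: "integrable circle_measure D"
    using int_mult[of "\<lambda>_. 1"] by simp
  have cD_int: "integrable circle_measure (\<lambda>z. cnj (D z))"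
    using D_int by simp
  define I where "I = (\<integral>z. (norm (D z))\<^sup>2 \<partial>circle_measure)"
  have I_int: "integrable circle_measure (\<lambda>z. (norm (D z))\<^sup>2)"
  proof -
    have "integrable circle_measure (\<lambda>z. norm (D z * cnj (D z)))"
      by (intro integrable_norm int_mult cD_int)
    then show ?thesis by (simp only: norm_mult complex_mod_cnj power2_eq_square)
  qed
  have "I \<le> e" if e: "e > 0" for e
  proof -
    define B' where "B' = max B 1"
    have B': "B' > 0" by (simp add: B'_def)
    obtain t where t: "trig_poly t" "(\<integral>z. norm (cnj (D z) - t z) \<partial>circle_measure) < e / B'"
      using integrable_trig_approx[OF cD_int, of "e / B'"] e B' by auto
    have ct_int: "integrable circle_measure (\<lambda>z. cnj (D z) - t z)"
      by (intro Bochner_Integration.integrable_diff cD_int tp_int t)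
    have "of_real I = (\<integral>z. D z * cnj (D z) \<partial>circle_measure)"
      unfolding I_def complex_norm_square[symmetric] of_real_power[symmetric] by (rule integral_of_real[OF I_int, symmetric])
    also have "\<dots> = (\<integral>z. D z * (cnj (D z) - t z) \<partial>circle_measure)"
      using trig[OF t(1)] int_mult[OF cD_int] int_mult[OF tp_int[OF t(1)]] by (simp add: right_diff_distrib)
    finally have "\<bar>I\<bar> = norm (\<integral>z. D z * (cnj (D z) - t z) \<partial>circle_measure)"
      by (metis norm_of_real)
    also have "\<dots> \<le> (\<integral>z. norm (D z * (cnj (D z) - t z)) \<partial>circle_measure)"
      by (rule integral_norm_bound)
    also have "\<dots> \<le> (\<integral>z. B' * norm (cnj (D z) - t z) \<partial>circle_measure)"
    proof (rule integral_mono_AE)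
      show "AE z in circle_measure. norm (D z * (cnj (D z) - t z)) \<le> B' * norm (cnj (D z) - t z)"
        using B by eventually_elim (auto simp: norm_mult B'_def intro!: mult_right_mono)
    qed (use int_mult[OF ct_int] ct_int in auto)
    also have "\<dots> = B' * (\<integral>z. norm (cnj (D z) - t z) \<partial>circle_measure)"
      by simp
    also have "\<dots> \<le> e"
      using t(2) B' by (simp add: field_simps)
    finally show ?thesis by linarith
  qed
  then have "I \<le> 0" by (rule field_le_epsilon[where y = 0, simplified])
  moreover have "I \<ge> 0" unfolding I_def by simp
  ultimately have "I = 0" by (rule antisym)
  then have "(\<integral>z. (norm (D z))\<^sup>2 \<partial>circle_measure) = 0" by (simp only: I_def)
  then show ?thesis
    using integral_nonneg_eq_0_iff_AE[OF I_int] by simp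
qed

lemma circle_dominated_convergence:
  fixes s :: "nat \<Rightarrow> complex \<Rightarrow> complex"
  assumes "f \<in> borel_measurable circle_measure" "\<And>i. s i \<in> borel_measurable circle_measure"
    and "AE z in circle_measure. (\<lambda>i. s i z) \<longlonglongrightarrow> f z" "\<And>i z. norm z = 1 \<Longrightarrow> norm (s i z) \<le> B"
  shows "(\<lambda>i. \<integral>z. s i z \<partial>circle_measure) \<longlonglongrightarrow> (\<integral>z. f z \<partial>circle_measure)"
  by (rule integral_dominated_convergence[where w = "\<lambda>_. B"]) (use assms in auto)

text \<open>
  The curve \<open>f (r z)\<close> may approach \<open>T z\<close> tangentially, so the radial limits of \<open>g\<close> at \<open>T z\<close> cannot be
  used directly. Instead, the radial limit of \<open>g \<circ> f\<close> given by Fatou's theorem and \<open>S \<circ> T\<close> are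
  shown to have the same Fourier coefficients, approximating \<open>g\<close> by \<open>g (\<rho> z)\<close> with \<open>\<rho> < 1\<close>.
\<close>

theorem has_inner_boundary_compose:
  assumes fT: "has_inner_boundary f T" and f0: "f 0 = 0" and gS: "has_inner_boundary g S"
  shows "has_inner_boundary (g \<circ> f) (S \<circ> T)"
proof -
  let ?F = "g \<circ> f"
  note hf = inner_holomorphic[OF fT] and hg = inner_holomorphic[OF gS]
  note rf = inner_range[OF fT] and rg = inner_range[OF gS]
  note bg = inner_bound[OF gS]
  note T_norm = inner_boundary_norm[OF fT] and S_norm = inner_boundary_norm[OF gS]
  have cg: "continuous_on (ball 0 1) g" by (rule holomorphic_on_imp_continuous_on[OF hg])
  have hF: "?F holomorphic_on ball 0 1"
    by (rule holomorphic_on_compose_gen[OF hf hg]) (use rf in auto)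
  have bF: "norm (?F z) \<le> 1" if "z \<in> ball 0 1" for z
    using bg rf[OF that] by simp
  define R where "R = boundary_map ?F"
  have R: "radial ?F R"
    unfolding R_def by (rule radial_boundary_map[OF hF bF])
  have R_meas: "R \<in> borel_measurable circle_measure"
    by (rule radial_measurable[OF holomorphic_on_imp_continuous_on[OF hF] R])
  have ST_meas: "(\<lambda>z. S (T z)) \<in> borel_measurable circle_measure"
    by (rule measurable_compose[OF inner_boundary_measure_preserving(1)[OF fT f0] inner_boundary_borel_measurable[OF gS]])
  define \<rho> where "\<rho> = rseq 0"
  have \<rho>: "0 < \<rho> n" "\<rho> n < 1" for n
    unfolding \<rho>_def by (simp_all add: rseq_less)
  have \<rho>_lim: "filterlim \<rho> (at_left 1) sequentially"
    unfolding \<rho>_def by (rule filterlim_rseq) simp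
  then have \<rho>_tendsto: "\<rho> \<longlonglongrightarrow> 1"
    by (rule filterlim_mono[OF _ at_within_le_nhds order_refl])
  have in_ball: "of_real (\<rho> n) * z \<in> ball 0 1" if "norm z \<le> 1" for n and z :: complex
    using \<rho>[of n] that by (auto simp: norm_mult intro: le_less_trans[OF mult_left_le])
  have powi_meas: "(\<lambda>z. z powi m) \<in> borel_measurable circle_measure" for m
    by (rule continuous_on_circle_measurable) (auto intro!: continuous_intros)
  have coeff: "(\<integral>z. S (T z) * z powi m \<partial>circle_measure) = (\<integral>z. R z * z powi m \<partial>circle_measure)" for m
  proof -
    \<comment> \<open>On the circle of radius 1/2 the values of \<open>f\<close> stay inside the
      disc, where \<open>g\<close> is continuous. Any fixed radius strictly between 0 and 1 has this
      property.\<close>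
    let ?h = "complex_of_real (1/2)"
    have half: "?h * z \<in> ball 0 1" if "norm z = 1" for z using that by (simp add: norm_mult)
    have F_fourier: "(\<integral>z. R z * z powi m \<partial>circle_measure) = (\<integral>z. ?F (?h * z) * (?h * z) powi m \<partial>circle_measure)"
      by (rule radial_fourier[OF hF bF R]) auto
    have n_fourier: "(\<integral>z. g (of_real (\<rho> n) * T z) * z powi m \<partial>circle_measure) =
      (\<integral>z. g (of_real (\<rho> n) * f (?h * z)) * (?h * z) powi m \<partial>circle_measure)" for n
    proof (rule radial_fourier)
      show "(\<lambda>z. g (of_real (\<rho> n) * f z)) holomorphic_on ball 0 1"
        by (rule holomorphic_on_compose_gen[of "\<lambda>z. of_real (\<rho> n) * f z" _ g "ball 0 1", unfolded o_def])
          (use hf hg in_ball rf in \<open>auto intro!: holomorphic_intros simp: less_imp_le\<close>)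
      show "norm (g (of_real (\<rho> n) * f z)) \<le> 1" if "z \<in> ball 0 1" for z
        using rf[OF that] by (intro bg in_ball) simp
      \<comment> \<open>The point \<open>of_real (\<rho> n) * T z\<close> lies inside the disc,
        where \<open>g\<close> is continuous, so the direction in which \<open>f\<close> approaches
        \<open>T z\<close> does not matter.\<close>
      show "radial (\<lambda>z. g (of_real (\<rho> n) * f z)) (\<lambda>z. g (of_real (\<rho> n) * T z))"
        using inner_radial[OF fT] AE_space unfolding radial_def
      proof eventually_elim
        case (elim z)
        have "of_real (\<rho> n) * T z \<in> ball 0 1"
          using elim T_norm by (intro in_ball) simp
        then have "isCont g (of_real (\<rho> n) * T z)"
          using cg continuous_on_eq_continuous_at[OF open_ball] by blast
        then show ?case
          by (rule isCont_tendsto_compose) (intro tendsto_intros elim)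
      qed
    qed auto
    have lim1: "(\<lambda>n. \<integral>z. g (of_real (\<rho> n) * T z) * z powi m \<partial>circle_measure) \<longlonglongrightarrow> (\<integral>z. S (T z) * z powi m \<partial>circle_measure)"
    proof (rule circle_dominated_convergence[where B = 1])
      show "(\<lambda>z. S (T z) * z powi m) \<in> borel_measurable circle_measure"
        by (intro borel_measurable_times ST_meas powi_meas)
      show "(\<lambda>z. g (of_real (\<rho> n) * T z) * z powi m) \<in> borel_measurable circle_measure" for n
        by (intro borel_measurable_times powi_meas inner_boundary_comp_measurable[OF fT] continuous_on_sphere_dilate cg \<rho>)
      \<comment> \<open>Invariance of the measure under \<open>T\<close> is essential here: points
        whose image lies in the exceptional null set of \<open>S\<close> again form a null
        set.\<close>
      have "AE z in distr circle_measure circle_measure T. ((\<lambda>r. g (of_real r * z)) \<longlongrightarrow> S z) (at_left 1)"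
        using inner_radial[OF gS] unfolding inner_boundary_measure_preserving(2)[OF fT f0] radial_def .
      then have "AE z in circle_measure. ((\<lambda>r. g (of_real r * T z)) \<longlongrightarrow> S (T z)) (at_left 1)"
        by (rule AE_distrD[OF inner_boundary_measure_preserving(1)[OF fT f0]])
      then show "AE z in circle_measure. (\<lambda>n. g (of_real (\<rho> n) * T z) * z powi m) \<longlonglongrightarrow> S (T z) * z powi m"
        by eventually_elim (intro tendsto_mult tendsto_const filterlim_compose[OF _ \<rho>_lim])
      show "norm (g (of_real (\<rho> n) * T z) * z powi m) \<le> 1" if "norm z = 1" for n z
        using bg[OF in_ball[of "T z" n]] T_norm[OF that] that by (simp add: norm_mult norm_power_int)
    qed
    have lim2: "(\<lambda>n. \<integral>z. g (of_real (\<rho> n) * f (?h * z)) * (?h * z) powi m \<partial>circle_measure) \<longlonglongrightarrow>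
      (\<integral>z. ?F (?h * z) * (?h * z) powi m \<partial>circle_measure)"
    proof (rule circle_dominated_convergence[where B = "(1/2) powi m"])
      have powi_cont: "continuous_on (sphere 0 1) (\<lambda>z. (?h * z) powi m)"
        by (intro continuous_on_power_int continuous_intros disjI2 ballI) auto
      have cf: "continuous_on (sphere 0 1) (\<lambda>z. f (?h * z))"
        by (rule continuous_on_sphere_dilate[OF holomorphic_on_imp_continuous_on[OF hf]]) auto
      show "(\<lambda>z. ?F (?h * z) * (?h * z) powi m) \<in> borel_measurable circle_measure"
        by (intro continuous_on_circle_measurable continuous_on_mult continuous_on_sphere_dilate holomorphic_on_imp_continuous_on[OF hF] powi_cont)
          auto
      show "(\<lambda>z. g (of_real (\<rho> n) * f (?h * z)) * (?h * z) powi m) \<in> borel_measurable circle_measure" for n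
      proof (intro continuous_on_circle_measurable continuous_on_mult)
        show "continuous_on (sphere 0 1) (\<lambda>z. g (of_real (\<rho> n) * f (?h * z)))"
        proof (rule continuous_on_compose2[OF cg continuous_on_mult[OF continuous_on_const cf]])
          show "(\<lambda>z. of_real (\<rho> n) * f (?h * z)) ` sphere 0 1 \<subseteq> ball 0 1"
          proof (rule image_subsetI)
            fix z :: complex assume "z \<in> sphere 0 1"
            then show "of_real (\<rho> n) * f (?h * z) \<in> ball 0 1"
              using rf[OF half[of z]] by (intro in_ball) simp
          qed
        qed
      qed (rule powi_cont)
      show "AE z in circle_measure. (\<lambda>n. g (of_real (\<rho> n) * f (?h * z)) * (?h * z) powi m) \<longlonglongrightarrow> ?F (?h * z) * (?h * z) powi m"
      proof (rule AE_I2)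
        fix z assume "z \<in> space circle_measure"
        then have "f (?h * z) \<in> ball 0 1" using rf half by simp
        then have "isCont g (f (?h * z))"
          using cg continuous_on_eq_continuous_at[OF open_ball] by blast
        moreover have "(\<lambda>n. of_real (\<rho> n) * f (?h * z)) \<longlonglongrightarrow> of_real 1 * f (?h * z)"
          by (intro tendsto_intros \<rho>_tendsto)
        ultimately have "(\<lambda>n. g (of_real (\<rho> n) * f (?h * z))) \<longlonglongrightarrow> g (f (?h * z))"
          using isCont_tendsto_compose by fastforce
        then show "(\<lambda>n. g (of_real (\<rho> n) * f (?h * z)) * (?h * z) powi m) \<longlonglongrightarrow> ?F (?h * z) * (?h * z) powi m"
          unfolding o_def by (intro tendsto_mult tendsto_const)
      qed
      show "norm (g (of_real (\<rho> n) * f (?h * z)) * (?h * z) powi m) \<le> (1/2) powi m" if z: "norm z = 1" for n z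
      proof -
        have "norm (g (of_real (\<rho> n) * f (?h * z))) \<le> 1"
          using rf[OF half[OF z]] by (intro bg in_ball) simp
        then have "norm (g (of_real (\<rho> n) * f (?h * z))) * norm ((?h * z) powi m) \<le> 1 * norm ((?h * z) powi m)"
          by (intro mult_right_mono) auto
        then show ?thesis using z by (simp add: norm_mult norm_power_int power_int_mult_distrib norm_divide)
      qed
    qed
    show ?thesis
      unfolding F_fourier by (rule LIMSEQ_unique[OF lim1 lim2[folded n_fourier]])
  qed
  have "AE z in circle_measure. R z - S (T z) = 0"
  proof (rule AE_zero_if_fourier_zero[where B = 2])
    show "(\<lambda>z. R z - S (T z)) \<in> borel_measurable circle_measure"
      by (intro borel_measurable_diff R_meas ST_meas)
    have R_le: "AE z in circle_measure. norm (R z) \<le> 1"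
      using R AE_space unfolding radial_def
    proof eventually_elim
      case (elim z)
      show ?case
      proof (rule tendsto_upperbound[OF tendsto_norm[OF elim(1)]])
        show "\<forall>\<^sub>F r in at_left 1. norm (?F (of_real r * z)) \<le> 1"
        proof (rule eventually_at_leftI[of 0])
          fix r :: real assume "r \<in> {0<..<1}"
          then show "norm (?F (of_real r * z)) \<le> 1"
            using elim(2) by (intro bF) (simp add: norm_mult)
        qed simp
      qed simp
    qed
    then show bound: "AE z in circle_measure. norm (R z - S (T z)) \<le> 2"
      using AE_space
    proof eventually_elim
      case (elim z)
      then show ?case
        using norm_triangle_ineq4[of "R z" "S (T z)"] T_norm[of z] S_norm[of "T z"] by simp
    qed
    fix m
    have "integrable circle_measure (\<lambda>z. R z * z powi m)"
    proof (rule circle.integrable_const_bound[of _ 1])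
      show "AE z in circle_measure. norm (R z * z powi m) \<le> 1"
        using R_le AE_space by eventually_elim (simp add: norm_mult norm_power_int)
    qed (intro borel_measurable_times R_meas powi_meas)
    moreover have "integrable circle_measure (\<lambda>z. S (T z) * z powi m)"
      by (rule integrable_bounded_circle[where B = 1])
        (auto intro!: borel_measurable_times ST_meas powi_meas simp: norm_mult norm_power_int S_norm T_norm)
    ultimately show "(\<integral>z. (R z - S (T z)) * z powi m \<partial>circle_measure) = 0"
      by (simp add: left_diff_distrib coeff)
  qed
  then have "radial ?F (S \<circ> T)"
    using R unfolding radial_def by eventually_elim simp
  then show ?thesis
    using hF rf rg T_norm S_norm unfolding has_inner_boundary_def by (auto simp: image_subset_iff)
qed

subsection \<open>Decay of correlations\<close>

text \<open>An interchange of limits: the error of the approximating sequences is uniform in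
  \<open>n\<close>.\<close>

lemma tendsto_if_uniformly_approx:
  fixes x :: "nat \<Rightarrow> complex"
  assumes "\<And>e. e > 0 \<Longrightarrow> \<exists>y m. y \<longlonglongrightarrow> m \<and> (\<forall>n. norm (x n - y n) \<le> e) \<and> norm (l - m) \<le> e"
  shows "x \<longlonglongrightarrow> l"
proof (rule tendstoI)
  fix e :: real assume e: "e > 0"
  then obtain y m where y: "y \<longlonglongrightarrow> m" "\<And>n. norm (x n - y n) \<le> e / 4" "norm (l - m) \<le> e / 4"
    using assms[of "e / 4"] by auto
  have "\<forall>\<^sub>F n in sequentially. dist (y n) m < e / 4"
    using tendstoD[OF y(1), of "e / 4"] e by simp
  then show "\<forall>\<^sub>F n in sequentially. dist (x n) l < e"
  proof eventually_elim
    case (elim n)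
    have "x n - l = (x n - y n) + (y n - m) - (l - m)" by simp
    then have "norm (x n - l) \<le> norm (x n - y n) + norm (y n - m) + norm (l - m)"
      using norm_triangle_ineq4[of "(x n - y n) + (y n - m)" "l - m"] norm_triangle_ineq[of "x n - y n" "y n - m"] by simp
    then show ?case using y(2)[of n] y(3) elim e by (simp add: dist_norm)
  qed
qed

text \<open>The pairing carries no conjugate, so it is linear in both arguments.\<close>

definition uncorrelated :: "(nat \<Rightarrow> complex \<Rightarrow> complex) \<Rightarrow> (complex \<Rightarrow> complex) \<Rightarrow> (complex \<Rightarrow> complex) \<Rightarrow> bool" where
  "uncorrelated T u v \<longleftrightarrow> (\<lambda>n. \<integral>z. u z * v (T n z) \<partial>circle_measure)
     \<longlonglongrightarrow> (\<integral>z. u z \<partial>circle_measure) * (\<integral>z. v z \<partial>circle_measure)"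

lemma integrable_mult_bounded:
  fixes u v :: "complex \<Rightarrow> complex"
  assumes "integrable circle_measure u" "v \<in> borel_measurable circle_measure" "\<And>z. norm z = 1 \<Longrightarrow> norm (v z) \<le> C"
  shows "integrable circle_measure (\<lambda>z. u z * v z)"
proof (rule Bochner_Integration.integrable_bound[where f = "\<lambda>z. C * norm (u z)"])
  show "AE z in circle_measure. norm (u z * v z) \<le> norm (C * norm (u z))"
  proof (rule AE_I2)
    fix z assume "z \<in> space circle_measure"
    then have "norm (v z) * norm (u z) \<le> \<bar>C\<bar> * norm (u z)"
      using assms(3)[of z] by (intro mult_right_mono) auto
    then show "norm (u z * v z) \<le> norm (C * norm (u z))"
      by (simp add: norm_mult abs_mult mult.commute)
  qed
qed (use assms in auto)

lemma norm_integral_mult_le: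
  fixes u v :: "complex \<Rightarrow> complex"
  assumes "integrable circle_measure u" "v \<in> borel_measurable circle_measure" "\<And>z. norm z = 1 \<Longrightarrow> norm (v z) \<le> C"
  shows "norm (\<integral>z. u z * v z \<partial>circle_measure) \<le> C * (\<integral>z. norm (u z) \<partial>circle_measure)"
proof -
  have "norm (\<integral>z. u z * v z \<partial>circle_measure) \<le> (\<integral>z. norm (u z * v z) \<partial>circle_measure)"
    by (rule integral_norm_bound)
  also have "\<dots> \<le> (\<integral>z. C * norm (u z) \<partial>circle_measure)"
  proof (rule integral_mono)
    fix z assume "z \<in> space circle_measure"
    then show "norm (u z * v z) \<le> C * norm (u z)"
      using mult_right_mono[OF assms(3)[of z], of "norm (u z)"] by (simp add: norm_mult mult.commute)
  qed (use integrable_mult_bounded[OF assms] assms in auto)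
  also have "\<dots> = C * (\<integral>z. norm (u z) \<partial>circle_measure)" by simp
  finally show ?thesis .
qed

lemma norm_integral_circle_le:
  fixes v :: "complex \<Rightarrow> complex"
  assumes "\<And>z. norm z = 1 \<Longrightarrow> norm (v z) \<le> C" "C \<ge> 0"
  shows "norm (\<integral>z. v z \<partial>circle_measure) \<le> C"
proof (cases "integrable circle_measure v")
  case True
  have "norm (\<integral>z. v z \<partial>circle_measure) \<le> (\<integral>z. norm (v z) \<partial>circle_measure)"
    by (rule integral_norm_bound)
  also have "\<dots> \<le> (\<integral>z. C \<partial>circle_measure)"
    using True assms(1) by (intro integral_mono) auto
  finally show ?thesis by simp
qed (simp add: not_integrable_integral_eq assms(2))

section \<open>Correlations along a measure preserving sequence\<close>

locale measure_preserving_sequence =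
  fixes T :: "nat \<Rightarrow> complex \<Rightarrow> complex"
  assumes T_measurable: "T n \<in> measurable circle_measure circle_measure"
    and T_distr: "distr circle_measure circle_measure (T n) = circle_measure"
begin

lemma T_sphere: "norm z = 1 \<Longrightarrow> norm (T n z) = 1"
  using measurable_space[OF T_measurable, of z n] by simp

lemma integral_T:
  fixes v :: "complex \<Rightarrow> 'b::{banach, second_countable_topology}"
  shows "v \<in> borel_measurable circle_measure \<Longrightarrow> (\<integral>z. v (T n z) \<partial>circle_measure) = (\<integral>z. v z \<partial>circle_measure)"
  using integral_distr[OF T_measurable[of n], of v] by (simp add: T_distr)

lemma integrable_T:
  fixes v :: "complex \<Rightarrow> 'b::{banach, second_countable_topology}"
  shows "integrable circle_measure v \<Longrightarrow> integrable circle_measure (\<lambda>z. v (T n z))"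
  using integrable_distr[OF T_measurable[of n], of v] by (simp add: T_distr)

lemma measurable_T: "v \<in> borel_measurable circle_measure \<Longrightarrow> (\<lambda>z. v (T n z)) \<in> borel_measurable circle_measure"
  by (rule measurable_compose[OF T_measurable])

text \<open>For bounded \<open>v\<close>, replacing \<open>u\<close> by \<open>w\<close> changes
  every correlation by at most a constant times the L^1 distance, uniformly in
  \<open>n\<close>.\<close>

lemma uncorrelated_left_closure:
  assumes u: "integrable circle_measure u" and v: "v \<in> borel_measurable circle_measure" "\<And>z. norm z = 1 \<Longrightarrow> norm (v z) \<le> C"
    and close: "\<And>e. e > 0 \<Longrightarrow> \<exists>w. integrable circle_measure w \<and> (\<integral>z. norm (u z - w z) \<partial>circle_measure) < e \<and> uncorrelated T w v"
  shows "uncorrelated T u v"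
  unfolding uncorrelated_def
proof (rule tendsto_if_uniformly_approx)
  fix e :: real assume e: "e > 0"
  define C' where "C' = max C 1"
  have C': "C' > 0" "\<And>z. norm z = 1 \<Longrightarrow> norm (v z) \<le> C'"
    using v(2) by (force simp: C'_def le_max_iff_disj)+
  obtain w where w: "integrable circle_measure w" "(\<integral>z. norm (u z - w z) \<partial>circle_measure) < e / C'" "uncorrelated T w v"
    using close[of "e / C'"] e C' by auto
  have uw: "integrable circle_measure (\<lambda>z. u z - w z)" using u w by auto
  have small: "C' * (\<integral>z. norm (u z - w z) \<partial>circle_measure) \<le> e"
    using w(2) C'(1) by (simp add: field_simps)
  show "\<exists>y m. y \<longlonglongrightarrow> m \<and> (\<forall>n. norm ((\<integral>z. u z * v (T n z) \<partial>circle_measure) - y n) \<le> e) \<and>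
      norm ((\<integral>z. u z \<partial>circle_measure) * (\<integral>z. v z \<partial>circle_measure) - m) \<le> e"
  proof (intro exI conjI allI)
    show "(\<lambda>n. \<integral>z. w z * v (T n z) \<partial>circle_measure) \<longlonglongrightarrow> (\<integral>z. w z \<partial>circle_measure) * (\<integral>z. v z \<partial>circle_measure)"
      using w(3) unfolding uncorrelated_def .
    fix n
    have vT: "(\<lambda>z. v (T n z)) \<in> borel_measurable circle_measure" "\<And>z. norm z = 1 \<Longrightarrow> norm (v (T n z)) \<le> C'"
      using measurable_T[OF v(1)] C'(2) T_sphere by auto
    have "(\<integral>z. u z * v (T n z) \<partial>circle_measure) - (\<integral>z. w z * v (T n z) \<partial>circle_measure) = (\<integral>z. (u z - w z) * v (T n z) \<partial>circle_measure)"
      using integrable_mult_bounded[OF u vT] integrable_mult_bounded[OF w(1) vT] by (simp add: left_diff_distrib)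
    then show "norm ((\<integral>z. u z * v (T n z) \<partial>circle_measure) - (\<integral>z. w z * v (T n z) \<partial>circle_measure)) \<le> e"
      using norm_integral_mult_le[OF uw vT] small by simp
    have "(\<integral>z. u z \<partial>circle_measure) * (\<integral>z. v z \<partial>circle_measure) - (\<integral>z. w z \<partial>circle_measure) * (\<integral>z. v z \<partial>circle_measure) =
        (\<integral>z. u z - w z \<partial>circle_measure) * (\<integral>z. v z \<partial>circle_measure)"
      using u w(1) by (simp add: left_diff_distrib)
    also have "norm \<dots> \<le> (\<integral>z. norm (u z - w z) \<partial>circle_measure) * C'"
      unfolding norm_mult using C' by (intro mult_mono integral_norm_bound norm_integral_circle_le) (auto intro: less_imp_le)
    finally show "norm ((\<integral>z. u z \<partial>circle_measure) * (\<integral>z. v z \<partial>circle_measure) -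
        (\<integral>z. w z \<partial>circle_measure) * (\<integral>z. v z \<partial>circle_measure)) \<le> e"
      using small by (simp add: mult.commute)
  qed
qed

text \<open>Uniformity in \<open>n\<close> comes from invariance: composing with \<open>T n\<close>
  does not change the L^1 distance of \<open>v\<close> and \<open>w\<close>.\<close>

lemma uncorrelated_right_closure:
  assumes v: "integrable circle_measure v" and u: "u \<in> borel_measurable circle_measure" "\<And>z. norm z = 1 \<Longrightarrow> norm (u z) \<le> C"
    and close: "\<And>e. e > 0 \<Longrightarrow> \<exists>w. integrable circle_measure w \<and> (\<integral>z. norm (v z - w z) \<partial>circle_measure) < e \<and> uncorrelated T u w"
  shows "uncorrelated T u v"
  unfolding uncorrelated_def
proof (rule tendsto_if_uniformly_approx)
  fix e :: real assume e: "e > 0"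
  define C' where "C' = max C 1"
  have C': "C' > 0" "\<And>z. norm z = 1 \<Longrightarrow> norm (u z) \<le> C'"
    using u(2) by (force simp: C'_def le_max_iff_disj)+
  obtain w where w: "integrable circle_measure w" "(\<integral>z. norm (v z - w z) \<partial>circle_measure) < e / C'" "uncorrelated T u w"
    using close[of "e / C'"] e C' by auto
  have vw: "integrable circle_measure (\<lambda>z. v z - w z)" using v w by auto
  have small: "C' * (\<integral>z. norm (v z - w z) \<partial>circle_measure) \<le> e"
    using w(2) C'(1) by (simp add: field_simps)
  show "\<exists>y m. y \<longlonglongrightarrow> m \<and> (\<forall>n. norm ((\<integral>z. u z * v (T n z) \<partial>circle_measure) - y n) \<le> e) \<and>
      norm ((\<integral>z. u z \<partial>circle_measure) * (\<integral>z. v z \<partial>circle_measure) - m) \<le> e"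
  proof (intro exI conjI allI)
    show "(\<lambda>n. \<integral>z. u z * w (T n z) \<partial>circle_measure) \<longlonglongrightarrow> (\<integral>z. u z \<partial>circle_measure) * (\<integral>z. w z \<partial>circle_measure)"
      using w(3) unfolding uncorrelated_def .
    fix n
    have int: "integrable circle_measure (\<lambda>z. v (T n z))" "integrable circle_measure (\<lambda>z. w (T n z))"
      "integrable circle_measure (\<lambda>z. v (T n z) - w (T n z))"
      using integrable_T[OF v] integrable_T[OF w(1)] by auto
    have "(\<integral>z. u z * v (T n z) \<partial>circle_measure) - (\<integral>z. u z * w (T n z) \<partial>circle_measure) = (\<integral>z. (v (T n z) - w (T n z)) * u z \<partial>circle_measure)"
      using integrable_mult_bounded[OF int(1) u(1) C'(2)] integrable_mult_bounded[OF int(2) u(1) C'(2)]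
      by (simp add: algebra_simps)
    also have "norm \<dots> \<le> C' * (\<integral>z. norm (v (T n z) - w (T n z)) \<partial>circle_measure)"
      by (rule norm_integral_mult_le[OF int(3) u(1) C'(2)])
    also have "(\<integral>z. norm (v (T n z) - w (T n z)) \<partial>circle_measure) = (\<integral>z. norm (v z - w z) \<partial>circle_measure)"
      using vw by (intro integral_T) auto
    finally show "norm ((\<integral>z. u z * v (T n z) \<partial>circle_measure) - (\<integral>z. u z * w (T n z) \<partial>circle_measure)) \<le> e"
      using small by simp
    have "(\<integral>z. u z \<partial>circle_measure) * (\<integral>z. v z \<partial>circle_measure) - (\<integral>z. u z \<partial>circle_measure) * (\<integral>z. w z \<partial>circle_measure) =
        (\<integral>z. u z \<partial>circle_measure) * (\<integral>z. v z - w z \<partial>circle_measure)"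
      using v w(1) by (simp add: right_diff_distrib)
    also have "norm \<dots> \<le> C' * (\<integral>z. norm (v z - w z) \<partial>circle_measure)"
      unfolding norm_mult using C' by (intro mult_mono integral_norm_bound norm_integral_circle_le) (auto intro: less_imp_le)
    finally show "norm ((\<integral>z. u z \<partial>circle_measure) * (\<integral>z. v z \<partial>circle_measure) -
        (\<integral>z. u z \<partial>circle_measure) * (\<integral>z. w z \<partial>circle_measure)) \<le> e"
      using small by simp
  qed
qed

lemma uncorrelated_indicator:
  assumes A: "A \<in> sets circle_measure" and B: "B \<in> sets circle_measure"
  shows "uncorrelated T (indicator A) (indicator B) \<longleftrightarrow>
    (\<lambda>n. measure circle_measure (A \<inter> T n -` B)) \<longlonglongrightarrow> measure circle_measure A * measure circle_measure B"
proof -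
  have ind: "(\<integral>z. indicator S z \<partial>circle_measure) = complex_of_real (measure circle_measure S)"
    if "S \<in> sets circle_measure" for S
  proof -
    have "(\<integral>z. indicator S z \<partial>circle_measure) = (\<integral>z. complex_of_real (indicator S z) \<partial>circle_measure)"
      by (intro Bochner_Integration.integral_cong) (auto simp: indicator_def)
    also have "\<dots> = complex_of_real (measure circle_measure S)"
      using that sets.sets_into_space[OF that] by (simp add: Int_absorb2)
    finally show ?thesis .
  qed
  have AB: "A \<inter> T n -` B \<in> sets circle_measure" for n
  proof -
    have "A \<inter> T n -` B = A \<inter> (T n -` B \<inter> space circle_measure)"
      using sets.sets_into_space[OF A] by auto
    then show ?thesis using A measurable_sets[OF T_measurable B, of n] by auto
  qed
  have "(\<integral>z. indicator A z * indicator B (T n z) \<partial>circle_measure) = complex_of_real (measure circle_measure (A \<inter> T n -` B))" for n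
  proof -
    have "(\<integral>z. indicator A z * indicator B (T n z) \<partial>circle_measure) = (\<integral>z. (indicator (A \<inter> T n -` B) z :: complex) \<partial>circle_measure)"
      by (intro Bochner_Integration.integral_cong) (auto simp: indicator_def)
    then show ?thesis by (simp add: ind[OF AB])
  qed
  then show ?thesis
    unfolding uncorrelated_def ind[OF A] ind[OF B]
    by (simp flip: of_real_mult add: tendsto_of_real_iff)
qed

lemma uncorrelated_add_left:
  assumes "integrable circle_measure u" "integrable circle_measure u'"
    and v: "v \<in> borel_measurable circle_measure" "\<And>z. norm z = 1 \<Longrightarrow> norm (v z) \<le> C"
    and "uncorrelated T u v" "uncorrelated T u' v"
  shows "uncorrelated T (\<lambda>z. u z + u' z) v"
proof -
  have "integrable circle_measure (\<lambda>z. w z * v (T n z))" if "integrable circle_measure w" for w n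
    by (rule integrable_mult_bounded[OF that measurable_T[OF v(1)], where C = C]) (simp add: v T_sphere)
  then show ?thesis
    using tendsto_add[OF assms(5,6)[unfolded uncorrelated_def]] assms(1,2)
    unfolding uncorrelated_def by (simp add: distrib_right)
qed

lemma uncorrelated_add_right:
  assumes v: "integrable circle_measure v" "integrable circle_measure v'"
    and u: "u \<in> borel_measurable circle_measure" "\<And>z. norm z = 1 \<Longrightarrow> norm (u z) \<le> C"
    and "uncorrelated T u v" "uncorrelated T u v'"
  shows "uncorrelated T u (\<lambda>z. v z + v' z)"
proof -
  have "integrable circle_measure (\<lambda>z. u z * w (T n z))" if "integrable circle_measure w" for w n
    using integrable_mult_bounded[OF integrable_T[OF that] u] by (simp add: mult.commute)
  then show ?thesis
    using tendsto_add[OF assms(5,6)[unfolded uncorrelated_def]] v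
    unfolding uncorrelated_def by (simp add: distrib_left)
qed

lemma uncorrelated_scale:
  assumes "uncorrelated T u v"
  shows "uncorrelated T (\<lambda>z. c * u z) v" "uncorrelated T u (\<lambda>z. c * v z)"
  using tendsto_mult[OF tendsto_const[of c] assms[unfolded uncorrelated_def]]
  unfolding uncorrelated_def by (simp_all add: mult_ac)

text \<open>The hypotheses, with the factor 2, are those of the limit case of
  \<open>integrable_induct\<close>.\<close>

lemma L1_dominated:
  fixes f :: "complex \<Rightarrow> complex"
  assumes "integrable circle_measure f" "\<And>i::nat. integrable circle_measure (s i)"
    and "\<And>z. z \<in> space circle_measure \<Longrightarrow> (\<lambda>i. s i z) \<longlonglongrightarrow> f z"
    and bound: "\<And>i z. z \<in> space circle_measure \<Longrightarrow> norm (s i z) \<le> 2 * norm (f z)"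
    and e: "e > 0"
  shows "\<exists>i. (\<integral>z. norm (f z - s i z) \<partial>circle_measure) < e"
proof -
  have "(\<lambda>i. \<integral>z. norm (f z - s i z) \<partial>circle_measure) \<longlonglongrightarrow> (\<integral>z. 0 \<partial>circle_measure)"
  proof (rule integral_dominated_convergence[where w = "\<lambda>z. 3 * norm (f z)"])
    show "AE z in circle_measure. (\<lambda>i. norm (f z - s i z)) \<longlonglongrightarrow> 0"
    proof (rule AE_I2)
      fix z assume "z \<in> space circle_measure"
      then have "(\<lambda>i. f z - s i z) \<longlonglongrightarrow> f z - f z"
        by (intro tendsto_intros assms)
      then show "(\<lambda>i. norm (f z - s i z)) \<longlonglongrightarrow> 0"
        using tendsto_norm_zero by simp
    qed
    show "AE z in circle_measure. norm (norm (f z - s i z)) \<le> 3 * norm (f z)" for i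
    proof (rule AE_I2)
      fix z assume "z \<in> space circle_measure"
      then show "norm (norm (f z - s i z)) \<le> 3 * norm (f z)"
        using bound[of z i] norm_triangle_ineq4[of "f z" "s i z"] by simp
    qed
  qed (use assms in auto)
  then have "\<forall>\<^sub>F i in sequentially. (\<integral>z. norm (f z - s i z) \<partial>circle_measure) < e"
    using e by (intro order_tendstoD) auto
  then show ?thesis
    using eventually_happens' sequentially_bot by blast
qed

text \<open>The arguments are enlarged one at a time, since each closure step needs the other
  argument bounded: first the left one against indicators, then the right one against the bounded
  \<open>u\<close>.\<close>

theorem uncorrelated_if_indicators:
  assumes ind: "\<And>A B. A \<in> sets circle_measure \<Longrightarrow> B \<in> sets circle_measure \<Longrightarrow> uncorrelated T (indicator A) (indicator B)"
    and u: "u \<in> borel_measurable circle_measure" "\<And>z. norm z = 1 \<Longrightarrow> norm (u z) \<le> C" and v: "integrable circle_measure v"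
  shows "uncorrelated T u v"
proof -
  have indB: "indicator B \<in> borel_measurable circle_measure" "norm (indicator B z :: complex) \<le> 1" if "B \<in> sets circle_measure" for B z
    using that by (auto simp: indicator_def)
  have left: "uncorrelated T w (indicator B)" if w: "integrable circle_measure w" and B: "B \<in> sets circle_measure" for w B
    using w
  proof (induction rule: integrable_induct)
    case (base A c)
    have "uncorrelated T (\<lambda>z. c * indicator A z) (indicator B)"
      by (intro uncorrelated_scale ind base B)
    also have "(\<lambda>z. c * indicator A z) = (\<lambda>z. indicator A z *\<^sub>R c)" by (auto simp: indicator_def)
    finally show ?case .
  next
    case (add f g)
    then show ?case
      by (intro uncorrelated_add_left[where C = 1] indB B)
  next
    case (lim f s)
    show ?case
    proof (rule uncorrelated_left_closure[where C = 1])
      fix e :: real assume "e > 0"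
      then obtain i where "(\<integral>z. norm (f z - s i z) \<partial>circle_measure) < e"
        using L1_dominated[of f s e] lim by auto
      then show "\<exists>w. integrable circle_measure w \<and> (\<integral>z. norm (f z - w z) \<partial>circle_measure) < e \<and> uncorrelated T w (indicator B)"
        using lim by blast
    qed (use lim indB B in auto)
  qed
  have u_int: "integrable circle_measure u"
    by (rule integrable_bounded_circle[OF u])
  show ?thesis using v
  proof (induction rule: integrable_induct)
    case (base B c)
    have "uncorrelated T u (\<lambda>z. c * indicator B z)"
      by (intro uncorrelated_scale left u_int base)
    also have "(\<lambda>z. c * indicator B z) = (\<lambda>z. indicator B z *\<^sub>R c)" by (auto simp: indicator_def)
    finally show ?case .
  next
    case (add f g)
    then show ?case
      by (intro uncorrelated_add_right[where C = C] u)
  next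
    case (lim f s)
    show ?case
    proof (rule uncorrelated_right_closure[where C = C])
      fix e :: real assume "e > 0"
      then obtain i where "(\<integral>z. norm (f z - s i z) \<partial>circle_measure) < e"
        using L1_dominated[of f s e] lim by auto
      then show "\<exists>w. integrable circle_measure w \<and> (\<integral>z. norm (f z - w z) \<partial>circle_measure) < e \<and> uncorrelated T u w"
        using lim by blast
    qed (use lim u in auto)
  qed
qed

lemma trig_poly_bounded_integrable:
  assumes "trig_poly t"
  shows "integrable circle_measure t" "t \<in> borel_measurable circle_measure" "\<exists>B. \<forall>z. norm z = 1 \<longrightarrow> norm (t z) \<le> B"
  using trig_poly_continuous[OF assms] continuous_on_circle_integrable continuous_on_circle_measurable continuous_on_circle_bounded
  by metis+

text \<open>Bilinearity gives all trigonometric polynomials; their L^1 density and the two closure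
  steps do the rest.\<close>

theorem uncorrelated_if_powi:
  assumes powi: "\<And>j k. uncorrelated T (\<lambda>z. z powi j) (\<lambda>z. z powi k)"
    and u: "u \<in> borel_measurable circle_measure" "\<And>z. norm z = 1 \<Longrightarrow> norm (u z) \<le> C" and v: "integrable circle_measure v"
  shows "uncorrelated T u v"
proof -
  note tp = trig_poly_bounded_integrable
  have powi_tp: "trig_poly (\<lambda>z. z powi j)" for j
    using trig_poly.monom[of 1 j] by simp
  have right: "uncorrelated T (\<lambda>z. z powi j) t" if "trig_poly t" for j t
    using that
  proof (induction rule: trig_poly.induct)
    case (monom c m)
    show ?case by (rule uncorrelated_scale[OF powi])
  next
    case (add s t)
    obtain B where "\<And>z::complex. norm z = 1 \<Longrightarrow> norm (z powi j) \<le> B" using tp(3)[OF powi_tp[of j]] by blast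
    with add show ?case by (intro uncorrelated_add_right[where C = B] tp powi_tp)
  qed
  have both: "uncorrelated T s t" if s: "trig_poly s" and t: "trig_poly t" for s t
    using s
  proof (induction rule: trig_poly.induct)
    case (monom c m)
    show ?case by (rule uncorrelated_scale[OF right[OF t]])
  next
    case (add s s')
    obtain B where "\<And>z. norm z = 1 \<Longrightarrow> norm (t z) \<le> B" using tp(3)[OF t] by blast
    with add t show ?case by (intro uncorrelated_add_left[where C = B] tp)
  qed
  have u_int: "integrable circle_measure u"
    by (rule integrable_bounded_circle[OF u])
  have left: "uncorrelated T u t" if t: "trig_poly t" for t
  proof -
    obtain B where "\<And>z. norm z = 1 \<Longrightarrow> norm (t z) \<le> B" using tp(3)[OF t] by blast
    then show ?thesis
    proof (rule uncorrelated_left_closure[OF u_int tp(2)[OF t]])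
      fix e :: real assume "e > 0"
      then obtain s where "trig_poly s" "(\<integral>z. norm (u z - s z) \<partial>circle_measure) < e"
        using integrable_trig_approx[OF u_int] by blast
      then show "\<exists>w. integrable circle_measure w \<and> (\<integral>z. norm (u z - w z) \<partial>circle_measure) < e \<and> uncorrelated T w t"
        using both[OF _ t] tp(1) by blast
    qed
  qed
  show ?thesis
  proof (rule uncorrelated_right_closure[OF v u])
    fix e :: real assume "e > 0"
    then obtain t where "trig_poly t" "(\<integral>z. norm (v z - t z) \<partial>circle_measure) < e"
      using integrable_trig_approx[OF v] by blast
    then show "\<exists>w. integrable circle_measure w \<and> (\<integral>z. norm (v z - w z) \<partial>circle_measure) < e \<and> uncorrelated T u w"
      using left tp(1) by blast
  qed
qed

end

subsection \<open>Mixing and contraction\<close>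

text \<open>The value 1 is an arbitrary unimodular filler on the null set where
  \<open>boundary_map\<close> misbehaves.\<close>

lemma inner_function_has_inner_boundary:
  assumes "inner_function g"
  shows "has_inner_boundary g (\<lambda>z. if norm (boundary_map g z) = 1 then boundary_map g z else 1)"
proof -
  have "AE z in circle_measure. \<exists>l. ((\<lambda>r. g (of_real r * z)) \<longlongrightarrow> l) (at_left 1) \<and> norm l = 1"
    using assms unfolding inner_function_def by blast
  then have "radial g (\<lambda>z. if norm (boundary_map g z) = 1 then boundary_map g z else 1)"
    unfolding radial_def
  proof eventually_elim
    case (elim z)
    then obtain l where l: "((\<lambda>r. g (of_real r * z)) \<longlongrightarrow> l) (at_left 1)" "norm l = 1" by blast
    then have "boundary_map g z = l"
      unfolding boundary_map_def by (intro tendsto_Lim) auto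
    with l show ?case by simp
  qed
  with assms show ?thesis
    by (auto simp: has_inner_boundary_def inner_function_def)
qed

lemma inner_powi_integral_tendsto_0:
  fixes G T :: "nat \<Rightarrow> complex \<Rightarrow> complex" and k :: nat
  assumes GT: "\<And>n. has_inner_boundary (G n) (T n)" and lim: "\<And>w. w \<in> ball 0 1 \<Longrightarrow> (\<lambda>n. G n w) \<longlonglongrightarrow> 0"
    and k: "k > 0"
  shows "(\<lambda>n. \<integral>z. T n z ^ k * z powi j \<partial>circle_measure) \<longlonglongrightarrow> 0"
proof -
  let ?h = "complex_of_real (1/2)"
  have half: "?h * z \<in> ball 0 1" if "norm z = 1" for z using that by (simp add: norm_mult)
  have G_pow: "norm (G n z ^ k) \<le> 1" if "z \<in> ball 0 1" for n z
    using inner_bound[OF GT that] by (simp add: norm_power power_le_one)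
  have hol: "(\<lambda>z. G n z ^ k) holomorphic_on ball 0 1" for n
    by (intro holomorphic_intros inner_holomorphic[OF GT])
  have eq: "(\<integral>z. T n z ^ k * z powi j \<partial>circle_measure) = (\<integral>z. G n (?h * z) ^ k * (?h * z) powi j \<partial>circle_measure)" for n
  proof (rule radial_fourier[OF hol G_pow])
    show "radial (\<lambda>z. G n z ^ k) (\<lambda>z. T n z ^ k)"
      using inner_radial[OF GT] unfolding radial_def by eventually_elim (intro tendsto_intros)
  qed auto
  have powi_cont: "continuous_on (sphere 0 1) (\<lambda>z. (?h * z) powi j)"
    by (intro continuous_on_power_int continuous_intros disjI2 ballI) auto
  \<comment> \<open>The factor \<open>(?h * z) powi j\<close> does not depend on \<open>n\<close>,
    and its constant modulus \<open>(1/2) powi j\<close> dominates the integrands.\<close>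
  have "(\<lambda>n. \<integral>z. G n (?h * z) ^ k * (?h * z) powi j \<partial>circle_measure) \<longlonglongrightarrow> (\<integral>z. 0 \<partial>circle_measure)"
  proof (rule circle_dominated_convergence[where B = "(1/2) powi j"])
    show "(\<lambda>z. G n (?h * z) ^ k * (?h * z) powi j) \<in> borel_measurable circle_measure" for n
      by (intro continuous_on_circle_measurable continuous_on_mult powi_cont
          continuous_on_sphere_dilate[OF holomorphic_on_imp_continuous_on[OF hol]]) auto
    show "AE z in circle_measure. (\<lambda>n. G n (?h * z) ^ k * (?h * z) powi j) \<longlonglongrightarrow> 0"
    proof (rule AE_I2)
      fix z assume "z \<in> space circle_measure"
      then have "(\<lambda>n. G n (?h * z)) \<longlonglongrightarrow> 0" by (intro lim half) simp
      then have "(\<lambda>n. G n (?h * z) ^ k * (?h * z) powi j) \<longlonglongrightarrow> 0 ^ k * (?h * z) powi j"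
        by (intro tendsto_intros)
      then show "(\<lambda>n. G n (?h * z) ^ k * (?h * z) powi j) \<longlonglongrightarrow> 0"
        using k by (simp add: zero_power)
    qed
    show "norm (G n (?h * z) ^ k * (?h * z) powi j) \<le> (1/2) powi j" if z: "norm z = 1" for n z
    proof -
      have "norm (G n (?h * z) ^ k) * norm ((?h * z) powi j) \<le> 1 * norm ((?h * z) powi j)"
        by (intro mult_right_mono G_pow half z) auto
      then show ?thesis using z by (simp add: norm_mult norm_power_int power_int_mult_distrib norm_divide)
    qed
  qed auto
  then show ?thesis by (simp add: eq)
qed

lemma uncorrelated_powi:
  assumes GT: "\<And>n. has_inner_boundary (G n) (T n)" and lim: "\<And>w. w \<in> ball 0 1 \<Longrightarrow> (\<lambda>n. G n w) \<longlonglongrightarrow> 0"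
  shows "uncorrelated T (\<lambda>z. z powi j) (\<lambda>z. z powi k)"
proof (cases "k = 0")
  case True
  then show ?thesis by (simp add: uncorrelated_def)
next
  case False
  have zero: "(\<integral>z. z powi k \<partial>circle_measure) = 0"
    using inner_boundary_integral_powi[OF has_inner_boundary_id, of k] False by simp
  have "(\<lambda>n. \<integral>z. z powi j * T n z powi k \<partial>circle_measure) \<longlonglongrightarrow> 0"
  proof (cases "k > 0")
    case True
    then have "T n z powi k = T n z ^ nat k" for n z by (simp add: power_int_def)
    then show ?thesis
      using inner_powi_integral_tendsto_0[OF GT lim, of "nat k" j] True by (simp add: mult.commute)
  next
    case neg: False
    \<comment> \<open>For negative \<open>k\<close>, conjugation on the circle flips the signs of
      both exponents and leaves a positive power of \<open>T n\<close>.\<close>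
    have "(\<integral>z. z powi j * T n z powi k \<partial>circle_measure) = cnj (\<integral>z. T n z ^ nat (- k) * z powi (- j) \<partial>circle_measure)" for n
    proof -
      have "(\<integral>z. z powi j * T n z powi k \<partial>circle_measure) = (\<integral>z. cnj (T n z ^ nat (- k) * z powi (- j)) \<partial>circle_measure)"
      proof (rule Bochner_Integration.integral_cong)
        fix z assume "z \<in> space circle_measure"
        then have z: "norm z = 1" "norm (T n z) = 1" using inner_boundary_norm[OF GT] by auto
        have "T n z ^ nat (- k) = T n z powi (- k)" using neg by (simp add: power_int_def)
        then show "z powi j * T n z powi k = cnj (T n z ^ nat (- k) * z powi (- j))"
          using powi_sphere_cnj[OF z(1), of "- j"] powi_sphere_cnj[OF z(2), of "- k"] by (simp add: mult.commute)
      qed simp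
      then show ?thesis by (simp only: Bochner_Integration.integral_cnj)
    qed
    moreover have "(\<lambda>n. cnj (\<integral>z. T n z ^ nat (- k) * z powi (- j) \<partial>circle_measure)) \<longlonglongrightarrow> cnj 0"
      using False neg by (intro tendsto_cnj inner_powi_integral_tendsto_0[OF GT lim]) auto
    ultimately show ?thesis by simp
  qed
  then show ?thesis by (simp add: uncorrelated_def zero)
qed

lemma decreasing_pointwise_imp_contracting:
  assumes cont: "\<And>n. continuous_on (ball 0 1) (forward_comp g n)"
    and dec: "\<And>n w. w \<in> ball 0 1 \<Longrightarrow> norm (forward_comp g (Suc n) w) \<le> norm (forward_comp g n w)"
    and lim: "\<And>w. w \<in> ball 0 1 \<Longrightarrow> (\<lambda>n. forward_comp g n w) \<longlonglongrightarrow> 0"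
  shows "contracting g"
  unfolding contracting_def
proof (intro allI impI uniform_limitI)
  fix K :: "complex set" and e :: real assume K: "compact K \<and> K \<subseteq> ball 0 1" and e: "e > 0"
  define U where "U n = {w \<in> ball 0 1. norm (forward_comp g n w) < e}" for n
  have U_open: "open (U n)" for n
  proof -
    have "open (ball 0 1 \<inter> forward_comp g n -` ball 0 e)"
      by (rule continuous_on_open_vimage[THEN iffD1, rule_format, OF open_ball cont open_ball, unfolded Int_commute[of "_ -` _"]])
    moreover have "U n = ball 0 1 \<inter> forward_comp g n -` ball 0 e"
      by (auto simp: U_def)
    ultimately show ?thesis by simp
  qed
  have cover: "K \<subseteq> (\<Union>n\<in>UNIV. U n)"
  proof
    fix w assume "w \<in> K"
    then have w: "w \<in> ball 0 1" using K by auto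
    have "\<forall>\<^sub>F n in sequentially. dist (forward_comp g n w) 0 < e"
      by (rule tendstoD[OF lim[OF w] e])
    then obtain n where "dist (forward_comp g n w) 0 < e"
      using eventually_happens' sequentially_bot by blast
    then show "w \<in> (\<Union>n\<in>UNIV. U n)" using w by (auto simp: U_def)
  qed
  obtain C where C: "finite C" "K \<subseteq> (\<Union>n\<in>C. U n)"
    using compactE_image[OF _ _ cover] K U_open by metis
  \<comment> \<open>Monotonicity in \<open>n\<close> makes membership in \<open>U m\<close> persist
    for all later indices, so a finite subcover gives one index valid on all of
    \<open>K\<close>.\<close>
  have dec': "norm (forward_comp g n w) \<le> norm (forward_comp g m w)" if "m \<le> n" "w \<in> ball 0 1" for m n w
    using that(1)
  proof (induction rule: dec_induct)
    case (step n)
    then show ?case using order_trans[OF dec[OF that(2)]] by blast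
  qed simp
  \<comment> \<open>Inserting 0 keeps \<open>Max\<close> meaningful for an empty subcover, which
    occurs for empty \<open>K\<close>.\<close>
  show "\<forall>\<^sub>F n in sequentially. \<forall>w\<in>K. dist (forward_comp g n w) 0 < e"
  proof (rule eventually_sequentiallyI[of "Max (insert 0 C)"], rule ballI)
    fix n w assume n: "Max (insert 0 C) \<le> n" and "w \<in> K"
    then obtain m where m: "m \<in> C" "w \<in> U m" using C(2) by auto
    then have "m \<le> n" using n C(1) by simp
    from dec'[OF this, of w] m show "dist (forward_comp g n w) 0 < e"
      by (auto simp: U_def)
  qed
qed

theorem theorem5p2:
  fixes g :: "nat \<Rightarrow> complex \<Rightarrow> complex"
  assumes "\<And>n. n \<ge> 1 \<Longrightarrow> inner_function (g n)"
    and "\<And>n. n \<ge> 1 \<Longrightarrow> g n 0 = 0"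
  shows "mixing (\<lambda>n. boundary_map (forward_comp g n)) \<longleftrightarrow> contracting g"
proof -
  let ?G = "forward_comp g"
  have G0: "?G n 0 = 0" for n
    by (induction n) (use assms(2) in auto)
  \<comment> \<open>Only the existence of a circle-valued representative is carried through the
    induction. It starts at the identity, since \<open>forward_comp g 0\<close> is
    \<open>id\<close>.\<close>
  have "\<exists>T. has_inner_boundary (?G n) T" for n
  proof (induction n)
    case 0
    then show ?case using has_inner_boundary_id by (metis forward_comp.simps(1))
  next
    case (Suc n)
    then obtain T where T: "has_inner_boundary (?G n) T" by blast
    show ?case
      unfolding forward_comp.simps
      by (rule exI, rule has_inner_boundary_compose[OF T G0 inner_function_has_inner_boundary[OF assms(1)]]) simp
  qed
  then obtain T where GT: "\<And>n. has_inner_boundary (?G n) (T n)" by metis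
  interpret measure_preserving_sequence T
    using inner_boundary_measure_preserving[OF GT G0] by unfold_locales
  have T_eq: "AE z in circle_measure. boundary_map (?G n) z = T n z" for n
    by (rule radial_unique[OF radial_boundary_map[OF inner_holomorphic[OF GT] inner_bound[OF GT]] inner_radial[OF GT]])
  have measure_eq: "measure circle_measure (A \<inter> boundary_map (?G n) -` B) = measure circle_measure (A \<inter> T n -` B)"
    if A: "A \<in> sets circle_measure" and B: "B \<in> sets circle_measure" for A B n
  proof (rule measure_eq_AE)
    show ae: "AE z in circle_measure. z \<in> A \<inter> boundary_map (?G n) -` B \<longleftrightarrow> z \<in> A \<inter> T n -` B"
      using T_eq[of n] by eventually_elim simp
    have "A \<inter> T n -` B = A \<inter> (T n -` B \<inter> space circle_measure)"
      using sets.sets_into_space[OF A] by auto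
    then show TB: "A \<inter> T n -` B \<in> sets circle_measure"
      using A measurable_sets[OF T_measurable B, of n] by auto
    \<comment> \<open>Preimages under \<open>boundary_map\<close> are measurable because they differ
      from those under \<open>T n\<close> by null sets and the measure is complete.\<close>
    show "A \<inter> boundary_map (?G n) -` B \<in> sets circle_measure"
    proof (rule circle.in_sets_AE[OF _ TB])
      show "AE z in circle_measure. z \<in> A \<inter> T n -` B \<longleftrightarrow> z \<in> A \<inter> boundary_map (?G n) -` B"
        using ae by eventually_elim blast
    qed (use sets.sets_into_space[OF A] in auto)
  qed
  have mixing_iff: "mixing (\<lambda>n. boundary_map (?G n)) \<longleftrightarrow>
    (\<forall>A\<in>sets circle_measure. \<forall>B\<in>sets circle_measure. uncorrelated T (indicator A) (indicator B))"
    unfolding mixing_def by (simp add: measure_eq uncorrelated_indicator)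
  show ?thesis
  proof
    assume "mixing (\<lambda>n. boundary_map (?G n))"
    then have ind: "uncorrelated T (indicator A) (indicator B)"
      if "A \<in> sets circle_measure" "B \<in> sets circle_measure" for A B
      using that mixing_iff by blast
    have int_id: "integrable circle_measure (\<lambda>z. z)"
      by (intro continuous_on_circle_integrable continuous_intros)
    have id0: "(\<integral>z. z \<partial>circle_measure) = 0"
      using inner_boundary_integral_powi[OF has_inner_boundary_id, of 1] by simp
    have lim: "(\<lambda>n. ?G n w) \<longlonglongrightarrow> 0" if "w \<in> ball 0 1" for w
    proof -
      have w: "norm w < 1" using that by simp
      have "continuous_on (sphere 0 1) (\<lambda>z. z / (z - w))"
        using w by (intro continuous_intros) auto
      then obtain C where "\<And>z. norm z = 1 \<Longrightarrow> norm (z / (z - w)) \<le> C"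
        and "(\<lambda>z. z / (z - w)) \<in> borel_measurable circle_measure"
        using continuous_on_circle_bounded continuous_on_circle_measurable by metis
      \<comment> \<open>The second function, the identity, has mean 0, so the limit of the
        correlations is 0, while the correlations themselves are the values
        \<open>?G n w\<close>.\<close>
      then have "uncorrelated T (\<lambda>z. z / (z - w)) (\<lambda>z. z)"
        using uncorrelated_if_indicators[OF ind _ _ int_id] by blast
      moreover have "(\<integral>z. z / (z - w) * T n z \<partial>circle_measure) = ?G n w" for n
        using radial_cauchy[OF inner_holomorphic[OF GT] inner_bound[OF GT] inner_radial[OF GT] w, of n]
        by (simp add: mult.commute)
      ultimately show ?thesis by (simp add: uncorrelated_def id0)
    qed
    show "contracting g"
    proof (rule decreasing_pointwise_imp_contracting[OF _ _ lim])
      show "continuous_on (ball 0 1) (?G n)" for n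
        by (rule holomorphic_on_imp_continuous_on[OF inner_holomorphic[OF GT]])
      fix n w assume "w \<in> ball (0::complex) 1"
      then have "norm (?G n w) < 1" using inner_range[OF GT] by simp
      moreover have "g (Suc n) holomorphic_on ball 0 1" "\<And>z. norm z < 1 \<Longrightarrow> norm (g (Suc n) z) < 1"
        using assms(1)[of "Suc n"] by (auto simp: inner_function_def image_subset_iff)
      \<comment> \<open>The Schwarz lemma is applied to \<open>g (Suc n)\<close> at the point
        \<open>?G n w\<close>.\<close>
      ultimately show "norm (?G (Suc n) w) \<le> norm (?G n w)"
        using Schwarz_Lemma(1)[of "g (Suc n)" "?G n w"] assms(2)[of "Suc n"] by simp
    qed
  next
    assume contr: "contracting g"
    have lim: "(\<lambda>n. ?G n w) \<longlonglongrightarrow> 0" if "w \<in> ball 0 1" for w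
    proof -
      have "compact {w} \<and> {w} \<subseteq> ball 0 1" using that by simp
      then have "uniform_limit {w} ?G (\<lambda>_. 0) sequentially"
        using contr unfolding contracting_def by blast
      then show ?thesis by simp
    qed
    have "uncorrelated T (indicator A) (indicator B)"
      if A: "A \<in> sets circle_measure" and B: "B \<in> sets circle_measure" for A B
    proof (rule uncorrelated_if_powi[where C = 1])
      show "integrable circle_measure (indicator B :: complex \<Rightarrow> complex)"
        using B by (intro integrable_bounded_circle[where B = 1]) (auto simp: indicator_def)
    qed (use A in \<open>auto simp: indicator_def intro: uncorrelated_powi[OF GT lim]\<close>)
    then show "mixing (\<lambda>n. boundary_map (?G n))"
      unfolding mixing_iff by blast
  qed
qed

end
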